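(* Let $b\ge 2$ and $a>(b-1)!$ be integers, and let $r\ge 2$ be a fixed integer with $r<2(a+b)-1$. Then, as $k\to\infty$, \[ R_r(\mathcal{B}(K_{a,b});k)=\Omega\left(k^{\frac{b}{(r-2)b+1}}\right). \] Furthermore, if in addition $b=2$ or $a+b\le r$, then \[ R_r(\mathcal{B}(K_{a,b});k)=\Theta\left(k^{\frac{b}{(r-2)b+1}}\right). \]
   Context: For a graph $G$, a hypergraph $H$ is a Berge-$G$ if $V(G)\subset V(H)$ and there is a bijection $\phi:E(G)\to E(H)$ such that $e\subset\phi(e)$ for all $e\in E(G)$. $\mathcal{B}(G)$ denotes the family of all hypergraphs that are a Berge-$G$. For a family $\mathcal{F}$ of hypergraphs, $R_r(\mathcal{F};k)$ is the minimum $n$ such that for every coloring of the edges of the complete $r$-uniform hypergraph on $n$ vertices with $k$ colors there is a monochromatic subhypergraph isomorphic to some $F\in\mathcal{F}$. $K_{a,b}$ denotes the complete bipartite graph with parts of sizes $a$ and $b$. The implied constants may depend on $r,a,b$ but not on $k$. *)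

theory Defs
  imports Complex_Main "HOL-Library.FuncSet" "HOL-Library.Landau_Symbols"
begin

type_synonym 'a hypergraph = "'a set \<times> 'a set set"

abbreviation verts :: "'a hypergraph \<Rightarrow> 'a set" where
  "verts H \<equiv> fst H"

abbreviation edges :: "'a hypergraph \<Rightarrow> 'a set set" where
  "edges H \<equiv> snd H"

definition hypergraph :: "'a hypergraph \<Rightarrow> bool" where
  "hypergraph H \<longleftrightarrow> edges H \<subseteq> Pow (verts H)"

definition subhypergraph :: "'a hypergraph \<Rightarrow> 'a hypergraph \<Rightarrow> bool" where
  "subhypergraph H' H \<longleftrightarrow> hypergraph H' \<and> verts H' \<subseteq> verts H \<and> edges H' \<subseteq> edges H"

definition isomorphic :: "'a hypergraph \<Rightarrow> 'b hypergraph \<Rightarrow> bool" where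
  "isomorphic H H' \<longleftrightarrow>
     (\<exists>f. bij_betw f (verts H) (verts H') \<and> edges H' = (\<lambda>e. f ` e) ` edges H)"

definition complete_uniform :: "nat \<Rightarrow> nat \<Rightarrow> nat hypergraph" where
  "complete_uniform r n = ({..<n}, {e. e \<subseteq> {..<n} \<and> card e = r})"

(* Graphs are hypergraphs all of whose edges have two elements.
   The parts of K_{a,b} are {..<a} and {a..<a + b}. *)
definition complete_bipartite :: "nat \<Rightarrow> nat \<Rightarrow> nat hypergraph" where
  "complete_bipartite a b = ({..<a + b}, {{i, j} | i j. i \<in> {..<a} \<and> j \<in> {a..<a + b}})"

(* The vertices of H are drawn from the same type as those of G. This loses nothing
   when the type is infinite, since the Ramsey number only looks at members of the
   family up to isomorphism, and only at finite ones. *)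
definition Berge :: "'a hypergraph \<Rightarrow> 'a hypergraph set" where
  "Berge G = {H. hypergraph H \<and> verts G \<subseteq> verts H \<and>
     (\<exists>\<phi>. bij_betw \<phi> (edges G) (edges H) \<and> (\<forall>e \<in> edges G. e \<subseteq> \<phi> e))}"

definition monochromatic :: "('a set \<Rightarrow> nat) \<Rightarrow> 'a hypergraph \<Rightarrow> bool" where
  "monochromatic c H \<longleftrightarrow> (\<exists>i. \<forall>e \<in> edges H. c e = i)"

(* LEAST is only meaningful if some n qualifies; for the Berge family of a finite
   graph and r \<ge> 2 this is a consequence of Ramsey's theorem for hypergraphs. *)
definition ramsey_number :: "nat \<Rightarrow> 'a hypergraph set \<Rightarrow> nat \<Rightarrow> nat" where
  "ramsey_number r \<F> k =
     (LEAST n. \<forall>c \<in> edges (complete_uniform r n) \<rightarrow> {..<k}.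
        \<exists>H. subhypergraph H (complete_uniform r n) \<and> monochromatic c H \<and>
            (\<exists>F \<in> \<F>. isomorphic H F))"

end

theory Submission
  imports Defs "HOL-Algebra.Algebraic_Closure_Type" "HOL-Library.Function_Algebras" "HOL-Library.Z2"
begin

text \<open>A colour class of an \<open>r\<close>-uniform complete hypergraph on \<open>n\<close> vertices coloured with \<open>k\<close> colours has
on average about \<open>n ^ r / k\<close> edges, and a hypergraph without a Berge copy of \<open>K\<^sub>a\<^sub>,\<^sub>b\<close> has, in the cases of the upper
bound, \<open>O(n powr (2 - 1 / b))\<close> edges. The two orders of magnitude meet at \<open>k = n powr (r - 2 + 1 / b)\<close>,
and solving for \<open>n\<close> gives the exponent of the theorem.

\<^bold>\<open>Upper bound.\<close> Let the edges of a hypergraph without a Berge copy choose, one after the other, a pair of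
their vertices that no earlier edge has chosen. The chosen pairs form a graph \<open>G\<close>
without \<open>K\<^sub>a\<^sub>,\<^sub>b\<close>, because the edges that chose the pairs of a copy would form a Berge copy; an edge that
finds no free pair is a clique of \<open>G\<close>. So the number of edges is at most the number of edges of \<open>G\<close>
plus its number of \<open>r\<close>-cliques (\<open>Berge_free_card_le\<close>). The first number is bounded by
\<open>Kovari_Sos_Turan\<close>. There are no \<open>r\<close>-cliques if \<open>a + b \<le> r\<close>, and if \<open>b = 2\<close> every edge lies in boundedly
many of them, as its ends have fewer than \<open>a\<close> common neighbours. In general an edge lies in at most
\<open>n ^ (r - 2)\<close> cliques of size \<open>r\<close>; this weak bound still shows that the Ramsey number exists.

\<^bold>\<open>Lower bound.\<close> Cut every \<open>r\<close>-set into the half of its smallest and the half of its largest elements.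
As \<open>r < 2 * (a + b) - 1\<close>, both parts have fewer than \<open>a + b\<close> elements. Suppose that in a colour class any two
lower parts are equal or disjoint, any two upper parts are equal or disjoint, and no lower part meets an
upper part. Then the \<open>a + b\<close> core vertices of a Berge copy of \<open>K\<^sub>a\<^sub>,\<^sub>b\<close> lie in different
parts (\<open>embedding_between_groups\<close>), so the bipartite graph between lower and upper parts contains
\<open>K\<^sub>a\<^sub>,\<^sub>b\<close>. Making equally coloured parts equal or disjoint costs \<open>O(n ^ (r - 2))\<close> colours
(\<open>matching_colouring\<close>), and excluding \<open>K\<^sub>a\<^sub>,\<^sub>b\<close> from the graphs costs \<open>O(n powr (1 / b))\<close>
(\<open>norm_graph_colouring\<close>). Keeping lower parts away from upper parts would cost a logarithmic factor if done
naively. It is avoided by treating the edges according to the dyadic level \<open>j\<close> at which the two elements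
next to the cut separate: at level \<open>j\<close> the graph decomposes into blocks of \<open>2 ^ (j + 1)\<close> vertices, for which
\<open>O(2 powr (j / b))\<close> colours suffice, and the sum over the levels is dominated by its last terms.

\<^bold>\<open>Norm graphs.\<close> The colouring of the pairs is that of the projective norm graphs. In it, more than
\<open>(b - 1)!\<close> common neighbours of \<open>b\<close> vertices would give more than \<open>t!\<close> common solutions of
\<open>t = b - 1\<close> equations \<open>(\<Prod>j<t. x\<^sub>j - a\<^sub>i\<^sub>j) = c\<^sub>i\<close> with distinct \<open>a\<^sub>i\<^sub>j\<close> for each \<open>j\<close>. The bound \<open>t!\<close> for
such systems, usually obtained from commutative algebra, is proved here by linear algebra
(\<open>card_common_solutions_le_fact\<close>): the functions on the solution set are spanned by at most \<open>t!\<close> polynomials,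
which are found by dividing by the linear factors of one equation and induction on the number of variables.\<close>

section \<open>Norm equations over a field\<close>

text \<open>Spans of polynomial functions take the place of formal polynomials. The argument below only
bounds dimensions from above, and such bounds survive when polynomials are identified that induce the
same function.\<close>

interpretation fun_space: vector_space "\<lambda>c (f :: 'x \<Rightarrow> 'a :: field) x. c * f x"
  by unfold_locales (auto simp: fun_eq_iff algebra_simps)

lemma sum_fun_apply: "(\<Sum>i\<in>A. f i) x = (\<Sum>i\<in>A. f i x)"
  by (induction A rule: infinite_finite_induct) auto

definition monomial_fun :: "'v set \<Rightarrow> ('v \<Rightarrow> nat) \<Rightarrow> ('v \<Rightarrow> 'a :: field) \<Rightarrow> 'a" where
  "monomial_fun I e = (\<lambda>x. \<Prod>j\<in>I. x j ^ e j)"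

definition linear_factor :: "'v \<Rightarrow> 'a \<Rightarrow> ('v \<Rightarrow> 'a :: field) \<Rightarrow> 'a" where
  "linear_factor j c = (\<lambda>x. x j - c)"

definition linear_product :: "'v set \<Rightarrow> ('v \<Rightarrow> 'a) \<Rightarrow> ('v \<Rightarrow> 'a :: field) \<Rightarrow> 'a" where
  "linear_product A c = (\<lambda>x. \<Prod>j\<in>A. x j - c j)"

text \<open>The degree in the variable \<open>j\<close> is below \<open>d j\<close>. The bound is imposed for all \<open>j\<close>, also outside \<open>I\<close>,
so that a single bound \<open>0\<close> makes the space trivial even if \<open>I\<close> is empty: it stands for a negative degree.\<close>

definition poly_space :: "'v set \<Rightarrow> ('v \<Rightarrow> nat) \<Rightarrow> (('v \<Rightarrow> 'a :: field) \<Rightarrow> 'a) set" where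
  "poly_space I d = fun_space.span {monomial_fun I e | e. \<forall>j. e j < d j}"

text \<open>The map is additive and homogeneous, stated in one equation, so that it need not be packaged
as a linear map between two interpretations of the same locale.\<close>

lemma span_linear_image:
  fixes T :: "('x \<Rightarrow> 'a :: field) \<Rightarrow> ('y \<Rightarrow> 'a)"
  assumes "f \<in> fun_space.span S"
    and "\<And>c f g. T ((\<lambda>x. c * f x) + g) = (\<lambda>x. c * T f x) + T g"
    and "\<And>f. f \<in> S \<Longrightarrow> T f \<in> fun_space.span S'"
  shows "T f \<in> fun_space.span S'"
  using assms(1)
proof (induction rule: fun_space.span_induct_alt)
  case base
  have "T 0 = (\<lambda>x. (-1) * T 0 x) + T 0" using assms(2)[of "-1" 0 0]
    by (simp add: zero_fun_def plus_fun_def)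
  hence "T 0 = 0" by (simp add: fun_eq_iff)
  thus ?case by (simp only: fun_space.span_zero)
next
  case (step c x y)
  thus ?case by (simp only: assms(2) fun_space.span_add fun_space.span_scale assms(3))
qed

lemma span_mult_image:
  assumes "f \<in> fun_space.span S" "\<And>f. f \<in> S \<Longrightarrow> g * f \<in> fun_space.span S'"
  shows "g * f \<in> fun_space.span S'"
  using assms(1)
proof (rule span_linear_image)
  show "g * ((\<lambda>x. c * f x) + h) = (\<lambda>x. c * (g * f) x) + g * h" for c f h
    by (simp add: fun_eq_iff algebra_simps)
qed (rule assms(2))

lemma poly_space_zero: "0 \<in> poly_space I d"
  by (simp add: poly_space_def fun_space.span_zero)

lemma poly_space_add: "f \<in> poly_space I d \<Longrightarrow> g \<in> poly_space I d \<Longrightarrow> f + g \<in> poly_space I d"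
  by (simp add: poly_space_def fun_space.span_add)

lemma poly_space_scale: "f \<in> poly_space I d \<Longrightarrow> (\<lambda>x. c * f x) \<in> poly_space I d"
  by (simp add: poly_space_def fun_space.span_scale)

lemma monomial_in_poly_space: "(\<And>j. e j < d j) \<Longrightarrow> monomial_fun I e \<in> poly_space I d"
  unfolding poly_space_def by (intro fun_space.span_base) auto

lemma poly_space_trivial:
  assumes "d j = 0"
  shows "poly_space I d = ({0} :: (('v \<Rightarrow> 'a :: field) \<Rightarrow> 'a) set)"
proof -
  have "{monomial_fun I e | e. \<forall>j. e j < d j} = ({} :: (('v \<Rightarrow> 'a) \<Rightarrow> 'a) set)" using assms by (auto intro!: exI[of _ j])
  thus ?thesis unfolding poly_space_def by (simp only: fun_space.span_empty)
qed

lemma poly_space_extend: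
  assumes "finite I" "J \<subseteq> I" "\<And>j. j \<in> J \<Longrightarrow> d j \<le> d' j" "(\<And>j. d j > 0) \<Longrightarrow> (\<And>j. d' j > 0)"
  shows "poly_space J d \<subseteq> poly_space I d'"
  unfolding poly_space_def
proof (rule fun_space.span_minimal[OF _ fun_space.subspace_span], rule subsetI)
  fix g :: "('a \<Rightarrow> 'b) \<Rightarrow> 'b"
  assume "g \<in> {monomial_fun J e | e. \<forall>j. e j < d j}"
  then obtain e where e: "g = monomial_fun J e" "\<forall>j. e j < d j" by auto
  hence pos: "\<And>j. d' j > 0" using assms(4) by (metis not_less0 gr0I)
  have "g = monomial_fun I (\<lambda>j. if j \<in> J then e j else 0)"
    unfolding e(1) monomial_fun_def using assms(1,2)
    by (intro ext prod.mono_neutral_cong_left) auto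
  moreover have "monomial_fun I (\<lambda>j. if j \<in> J then e j else 0) \<in> poly_space I d'"
    using e pos assms(3) by (intro monomial_in_poly_space) (auto intro: less_le_trans)
  ultimately show "g \<in> fun_space.span {monomial_fun I e | e. \<forall>j. e j < d' j}"
    by (simp add: poly_space_def)
qed

text \<open>The bounds are compared only if all of them are positive; otherwise the space is trivial. This
makes the truncated subtraction in the degree bounds below harmless.\<close>

lemma linear_factor_mult_poly_space:
  fixes f :: "('v \<Rightarrow> 'a :: field) \<Rightarrow> 'a"
  assumes "finite I" "j \<in> I" "f \<in> poly_space I d"
    and "(\<And>i. d i > 0) \<Longrightarrow> (\<And>i. d i + of_bool (i = j) \<le> d' i)"
  shows "linear_factor j c * f \<in> poly_space I d'"
proof (cases "\<forall>i. d i > 0")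
  case True
  hence d': "d i + of_bool (i = j) \<le> d' i" for i using assms(4) by blast
  show ?thesis
    using assms(3) unfolding poly_space_def
  proof (rule span_mult_image)
    fix g :: "('v \<Rightarrow> 'a) \<Rightarrow> 'a" assume "g \<in> {monomial_fun I e | e. \<forall>j. e j < d j}"
    then obtain e where e: "g = monomial_fun I e" "\<And>j. e j < d j" by auto
    have "linear_factor j c * g = monomial_fun I (e(j := Suc (e j))) + (\<lambda>x. (-c) * monomial_fun I e x)"
      unfolding e(1) using assms(1,2) by (auto simp: fun_eq_iff linear_factor_def monomial_fun_def prod.remove algebra_simps)
    moreover have "monomial_fun I (e(j := Suc (e j))) \<in> poly_space I d'"
    proof (intro monomial_in_poly_space)
      show "(e(j := Suc (e j))) i < d' i" for i
        using d'[of i] e(2)[of i] by (cases "i = j") auto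
    qed
    moreover have "monomial_fun I e \<in> poly_space I d'"
    proof (intro monomial_in_poly_space)
      show "e i < d' i" for i using d'[of i] e(2)[of i] by linarith
    qed
    ultimately show "linear_factor j c * g \<in> fun_space.span {monomial_fun I e | e. \<forall>j. e j < d' j}"
      unfolding e(1) poly_space_def[symmetric] by (metis poly_space_add poly_space_scale)
  qed
next
  case False
  then obtain i where "d i = 0" by auto
  hence "poly_space I d = ({0} :: (('v \<Rightarrow> 'a) \<Rightarrow> 'a) set)" by (rule poly_space_trivial)
  hence "f = 0" using assms(3) by (simp only: singleton_iff)
  thus ?thesis by (simp add: poly_space_zero)
qed

lemma linear_product_mult_poly_space:
  fixes f :: "('v \<Rightarrow> 'a :: field) \<Rightarrow> 'a"
  assumes "finite I" "A \<subseteq> I" "f \<in> poly_space I d"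
    and "(\<And>i. d i > 0) \<Longrightarrow> (\<And>i. d i + of_bool (i \<in> A) \<le> d' i)"
  shows "linear_product A c * f \<in> poly_space I d'"
proof (cases "\<forall>i. d i > 0")
  case True
  hence d': "d i + of_bool (i \<in> A) \<le> d' i" for i using assms(4) by blast
  have "finite A" using assms finite_subset by blast
  hence "A \<subseteq> I \<Longrightarrow> (\<And>i. d i + of_bool (i \<in> A) \<le> d' i) \<Longrightarrow> ?thesis"
  proof (induction arbitrary: d' rule: finite_induct)
    case empty
    have "poly_space I d \<subseteq> poly_space I d'" using empty True assms(1)
      by (intro poly_space_extend) (auto intro: less_le_trans)
    thus ?case using assms(3) by (auto simp: linear_product_def one_fun_def[symmetric])
  next
    case (insert j A)
    define d1 where "d1 = (\<lambda>i. d i + of_bool (i \<in> A))"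
    have 1: "linear_product A c * f \<in> poly_space I d1"
      using insert by (intro insert.IH) (auto simp: d1_def)
    have "linear_factor j (c j) * (linear_product A c * f) \<in> poly_space I d'"
    proof (rule linear_factor_mult_poly_space[OF assms(1) _ 1])
      show "d1 i + of_bool (i = j) \<le> d' i" for i
        using insert.prems(2)[of i] insert.hyps by (auto simp: d1_def split: if_splits)
    qed (use insert in auto)
    moreover have "linear_product (insert j A) c * f = linear_factor j (c j) * (linear_product A c * f)"
      using insert.hyps by (simp add: fun_eq_iff linear_product_def linear_factor_def mult.assoc)
    ultimately show ?case by (simp only:)
  qed
  thus ?thesis using assms d' by blast
next
  case False
  then obtain i where "d i = 0" by auto
  hence "poly_space I d = ({0} :: (('v \<Rightarrow> 'a) \<Rightarrow> 'a) set)" by (rule poly_space_trivial)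
  hence "f = 0" using assms(3) by (simp only: singleton_iff)
  thus ?thesis by (simp add: poly_space_zero)
qed

text \<open>Division with remainder rests on \<open>x ^ n - c ^ n = (x - c) * (\<Sum>i<n. c ^ (n - Suc i) * x ^ i)\<close>, applied to
the variable \<open>x j\<close> in each monomial.\<close>

lemma poly_space_divide:
  assumes "finite I" "j \<in> I" "p \<in> poly_space I d" "\<And>i. d i \<le> d' i" "d'' = d'(j := d j - 1)"
  shows "\<exists>g \<in> poly_space (I - {j}) d. \<exists>r \<in> poly_space I d''. p = g + linear_factor j c * r"
  using assms(3) unfolding poly_space_def
proof (induction rule: fun_space.span_induct_alt)
  case base
  show ?case by (intro bexI[of _ 0]) (auto simp: fun_space.span_zero)
next
  case (step k m y)
  then obtain e where e: "m = monomial_fun I e" "\<And>j. e j < d j" by auto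
  from step obtain g r where gr: "g \<in> poly_space (I - {j}) d" "r \<in> poly_space I d''" "y = g + linear_factor j c * r"
    unfolding poly_space_def by blast
  define r' where "r' = (\<Sum>i<e j. (\<lambda>x. c ^ (e j - Suc i) * monomial_fun I (e(j := i)) x))"
  have r': "r' \<in> poly_space I d''"
    unfolding r'_def poly_space_def
  proof (intro fun_space.span_sum fun_space.span_scale)
    fix i assume "i \<in> {..<e j}"
    hence "(e(j := i)) l < d'' l" for l
      using e(2)[of l] assms(4)[of l] assms(5) by (cases "l = j") auto
    thus "monomial_fun I (e(j := i)) \<in> fun_space.span {monomial_fun I e | e. \<forall>j. e j < d'' j}"
      using monomial_in_poly_space unfolding poly_space_def by blast
  qed
  have "m = (\<lambda>x. c ^ e j * monomial_fun (I - {j}) e x) + linear_factor j c * r'"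
  proof
    fix x :: "'a \<Rightarrow> 'b"
    have s: "monomial_fun I (e(j := i)) x = x j ^ i * monomial_fun (I - {j}) e x" for i
      using assms(1,2) by (simp add: monomial_fun_def prod.remove)
    have "r' x = (\<Sum>i<e j. c ^ (e j - Suc i) * monomial_fun I (e(j := i)) x)"
      unfolding r'_def by (rule sum_fun_apply)
    also have "\<dots> = (\<Sum>i<e j. c ^ (e j - Suc i) * x j ^ i) * monomial_fun (I - {j}) e x"
      by (simp add: s sum_distrib_right mult.assoc)
    finally have "(x j - c) * r' x = (x j ^ e j - c ^ e j) * monomial_fun (I - {j}) e x"
      by (simp add: power_diff_sumr2 mult.assoc)
    moreover have "m x = x j ^ e j * monomial_fun (I - {j}) e x"
      using s[of "e j"] by (simp add: e)
    ultimately show "m x = ((\<lambda>x. c ^ e j * monomial_fun (I - {j}) e x) + linear_factor j c * r') x"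
      by (simp add: linear_factor_def algebra_simps)
  qed
  note m = this
  have "(\<lambda>x. k * m x) + y = ((\<lambda>x. k * (c ^ e j * monomial_fun (I - {j}) e x)) + g) + linear_factor j c * ((\<lambda>x. k * r' x) + r)"
  proof
    fix x :: "'a \<Rightarrow> 'b"
    have "m x = c ^ e j * monomial_fun (I - {j}) e x + linear_factor j c x * r' x" "y x = g x + linear_factor j c x * r x"
      using fun_cong[OF m, of x] fun_cong[OF gr(3), of x] by simp_all
    thus "((\<lambda>x. k * m x) + y) x = (((\<lambda>x. k * (c ^ e j * monomial_fun (I - {j}) e x)) + g) + linear_factor j c * ((\<lambda>x. k * r' x) + r)) x"
      unfolding plus_fun_apply times_fun_apply by (simp only: distrib_left ac_simps)
  qed
  moreover have "(\<lambda>x. k * (c ^ e j * monomial_fun (I - {j}) e x)) + g \<in> poly_space (I - {j}) d"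
    using gr(1) e(2) by (intro poly_space_add poly_space_scale monomial_in_poly_space)
  moreover have "(\<lambda>x. k * r' x) + r \<in> poly_space I d''"
    using gr(2) r' by (intro poly_space_add poly_space_scale)
  ultimately show ?case unfolding poly_space_def by blast
qed

text \<open>Dividing by the factors of an equation one variable at a time lowers the degree bounds one at a
time. All bounds that occur on the way have this shape, where \<open>L\<close> is the set of lowered variables.\<close>

definition degree_bound :: "nat \<Rightarrow> 'v set \<Rightarrow> 'v \<Rightarrow> nat" where
  "degree_bound D L j = D - of_bool (j \<in> L)"

text \<open>Where all the equations hold, the product of the \<open>i\<close>-th one is a constant. The multiples
collected here therefore agree on the solution set with functions of lower degree, although as
polynomials they need not have lower degree.\<close>

definition lower_part ::
    "'v set \<Rightarrow> 'i set \<Rightarrow> ('i \<Rightarrow> 'v \<Rightarrow> 'a) \<Rightarrow> 'v set \<Rightarrow> nat \<Rightarrow> (('v \<Rightarrow> 'a :: field) \<Rightarrow> 'a) set" where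
  "lower_part I T a L D = poly_space I (degree_bound D L) \<union>
     {linear_product I (a i) * g | i g. i \<in> T \<and> g \<in> poly_space I (degree_bound D L)}"

lemma span_subset_mem: "S \<subseteq> S' \<Longrightarrow> x \<in> fun_space.span S \<Longrightarrow> x \<in> fun_space.span S'"
  using fun_space.span_mono by blast

text \<open>Modulo \<open>x j - a t j\<close> the variable \<open>j\<close> disappears. What remains of the products is, up to the constants
\<open>a t j - a i j\<close>, the products of a system in the other variables without equation \<open>t\<close>. As these constants
are invertible, everything that can be reduced in the smaller system can be reduced in the larger one,
up to a multiple of \<open>x j - a t j\<close>.\<close>

lemma peel_one_variable:
  fixes a :: "'i \<Rightarrow> 'v \<Rightarrow> 'a :: field"
  assumes "finite I" "j \<in> I" "j \<notin> L" "\<And>i. i \<in> T - {t} \<Longrightarrow> a i j \<noteq> a t j"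
    and IH: "poly_space (I - {j}) (degree_bound (Suc D) L)
               \<subseteq> fun_space.span (lower_part (I - {j}) (T - {t}) a L D \<union> U)"
    and "p \<in> poly_space I (degree_bound (Suc D) L)"
  shows "\<exists>r \<in> poly_space I (degree_bound (Suc D) (insert j L)).
           p - linear_factor j (a t j) * r \<in> fun_space.span (lower_part I T a L D \<union> U)"
proof -
  let ?R = "poly_space I (degree_bound (Suc D) (insert j L)) :: (('v \<Rightarrow> 'a) \<Rightarrow> 'a) set"
  let ?S = "fun_space.span (lower_part I T a L D \<union> U)"
  let ?l = "linear_factor j (a t j)"
  have gen: "\<exists>r \<in> ?R. x - ?l * r \<in> ?S" if x: "x \<in> lower_part (I - {j}) (T - {t}) a L D \<union> U" for x
  proof (cases "x \<in> U \<or> D = 0 \<or> x \<in> poly_space (I - {j}) (degree_bound D L)")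
    case True
    have "x \<in> ?S"
    proof (cases "x \<in> U")
      case True
      thus ?thesis by (intro fun_space.span_base) auto
    next
      case False
      have "x \<in> poly_space I (degree_bound D L)"
      proof (cases "D = 0")
        case True
        hence "poly_space (I - {j}) (degree_bound D L) = ({0} :: (('v \<Rightarrow> 'a) \<Rightarrow> 'a) set)"
          by (intro poly_space_trivial[of _ j]) (simp add: degree_bound_def)
        hence "x = 0" using x False by (auto simp: lower_part_def fun_eq_iff)
        thus ?thesis by (simp only: poly_space_zero)
      next
        case D: False
        have "poly_space (I - {j}) (degree_bound D L) \<subseteq> (poly_space I (degree_bound D L) :: (('v \<Rightarrow> 'a) \<Rightarrow> 'a) set)"
          using assms(1) by (intro poly_space_extend) auto
        thus ?thesis using True False D by blast
      qed
      thus ?thesis by (intro fun_space.span_base) (auto simp: lower_part_def)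
    qed
    moreover have "x - ?l * 0 = x" by (simp add: fun_eq_iff)
    ultimately show ?thesis using poly_space_zero by metis
  next
    case False
    then obtain i h where ih: "i \<in> T - {t}" "h \<in> poly_space (I - {j}) (degree_bound D L)"
        "x = linear_product (I - {j}) (a i) * h" "D > 0"
      using x unfolding lower_part_def by auto
    \<comment> \<open>With \<open>k\<close> as follows, \<open>k * (x j - a i j) = 1 + k * (x j - a t j)\<close>.\<close>
    define k where "k = 1 / (a t j - a i j)"
    have k: "k * (a t j - a i j) = 1" using assms(4)[OF ih(1)] by (simp add: k_def)
    define r where "r = (\<lambda>y. - k * x y)"
    have "x \<in> poly_space (I - {j}) (degree_bound (Suc D) L)"
      unfolding ih(3) using assms(1) ih(4)
      by (intro linear_product_mult_poly_space[OF _ _ ih(2)]) (auto simp: degree_bound_def of_bool_def split: if_splits)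
    moreover have "poly_space (I - {j}) (degree_bound (Suc D) L) \<subseteq> ?R"
      using assms(1) ih(4) by (intro poly_space_extend) (auto simp: degree_bound_def)
    ultimately have "r \<in> ?R" unfolding r_def by (intro poly_space_scale) auto
    moreover have "x - ?l * r = (\<lambda>y. k * (linear_product I (a i) * h) y)"
    proof
      fix y
      have p: "linear_product I (a i) y = (y j - a i j) * linear_product (I - {j}) (a i) y"
        using assms(1,2) by (simp add: linear_product_def prod.remove)
      have "(x - ?l * r) y = (1 + k * (y j - a t j)) * x y"
        by (simp add: r_def linear_factor_def algebra_simps)
      also have "\<dots> = (k * (a t j - a i j) + k * (y j - a t j)) * x y" by (simp only: k)
      also have "\<dots> = k * ((y j - a i j) * x y)" by (simp add: algebra_simps)
      also have "\<dots> = k * (linear_product I (a i) * h) y" by (simp add: ih(3) p)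
      finally show "(x - ?l * r) y = k * (linear_product I (a i) * h) y" .
    qed
    moreover have "linear_product I (a i) * h \<in> ?S"
    proof (intro fun_space.span_base)
      have "poly_space (I - {j}) (degree_bound D L) \<subseteq> (poly_space I (degree_bound D L) :: (('v \<Rightarrow> 'a) \<Rightarrow> 'a) set)"
        using assms(1) by (intro poly_space_extend) auto
      thus "linear_product I (a i) * h \<in> lower_part I T a L D \<union> U"
        using ih(1,2) unfolding lower_part_def by blast
    qed
    ultimately show ?thesis using fun_space.span_scale by metis
  qed
  have "poly_space (I - {j}) (degree_bound (Suc D) L) \<subseteq> {g. \<exists>r \<in> ?R. g - ?l * r \<in> ?S}"
  proof
    fix g :: "('v \<Rightarrow> 'a) \<Rightarrow> 'a" assume "g \<in> poly_space (I - {j}) (degree_bound (Suc D) L)"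
    hence "g \<in> fun_space.span (lower_part (I - {j}) (T - {t}) a L D \<union> U)" using IH by blast
    hence "\<exists>r \<in> ?R. g - ?l * r \<in> ?S"
    proof (induction rule: fun_space.span_induct_alt)
      case base
      have "0 - ?l * 0 = 0" by (simp add: fun_eq_iff)
      thus ?case using poly_space_zero fun_space.span_zero by metis
    next
      case (step c x y)
      then obtain r1 r2 where r: "r1 \<in> ?R" "x - ?l * r1 \<in> ?S" "r2 \<in> ?R" "y - ?l * r2 \<in> ?S"
        using gen by blast
      have "(\<lambda>z. c * x z) + y - ?l * ((\<lambda>z. c * r1 z) + r2) = (\<lambda>z. c * (x - ?l * r1) z) + (y - ?l * r2)"
        by (simp add: fun_eq_iff algebra_simps)
      moreover have "(\<lambda>z. c * (x - ?l * r1) z) + (y - ?l * r2) \<in> ?S"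
        using r by (intro fun_space.span_add fun_space.span_scale)
      moreover have "(\<lambda>z. c * r1 z) + r2 \<in> ?R"
        using r by (intro poly_space_add poly_space_scale)
      ultimately show ?case by metis
    qed
    thus "g \<in> {g. \<exists>r \<in> ?R. g - ?l * r \<in> ?S}" by blast
  qed
  moreover obtain g r where gr: "g \<in> poly_space (I - {j}) (degree_bound (Suc D) L)" "r \<in> ?R" "p = g + ?l * r"
  proof -
    have "\<exists>g \<in> poly_space (I - {j}) (degree_bound (Suc D) L). \<exists>r \<in> ?R. p = g + ?l * r"
      using assms by (intro poly_space_divide[where d' = "degree_bound (Suc D) L"]) (auto simp: degree_bound_def fun_eq_iff)
    thus ?thesis using that by blast
  qed
  ultimately obtain r' where r': "r' \<in> ?R" "g - ?l * r' \<in> ?S" by blast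
  have "p - ?l * (r' + r) = g - ?l * r'" unfolding gr(3) by (simp add: fun_eq_iff algebra_simps)
  thus ?thesis using r' gr(2) poly_space_add by metis
qed

text \<open>Here \<open>S A D\<close> will consist of the multiples of the linear factors for the variables in \<open>A\<close>, and
\<open>R\<close> of the generators, each tagged with the degree \<open>D\<close> at which it is used. Tagging lets a single cardinality
count the generators of all degrees.\<close>

lemma reduction_chain:
  fixes S :: "'v set \<Rightarrow> nat \<Rightarrow> ('x \<Rightarrow> 'a :: field) set"
  assumes "finite B"
    and step: "\<And>A j. A \<subseteq> B \<Longrightarrow> j \<in> B - A \<Longrightarrow> \<exists>R. finite R \<and> card R \<le> m \<and>
      (\<forall>D. \<forall>p \<in> S A D. \<exists>q \<in> S (insert j A) D. p - q \<in> fun_space.span (W D \<union> {u. (D, u) \<in> R}))"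
  shows "\<exists>R. finite R \<and> card R \<le> card B * m \<and>
      (\<forall>D. \<forall>p \<in> S {} D. \<exists>q \<in> S B D. p - q \<in> fun_space.span (W D \<union> {u. (D, u) \<in> R}))"
proof -
  have "\<exists>R. finite R \<and> card R \<le> card A * m \<and>
      (\<forall>D. \<forall>p \<in> S {} D. \<exists>q \<in> S A D. p - q \<in> fun_space.span (W D \<union> {u. (D, u) \<in> R}))"
    if "A \<subseteq> B" for A
    using finite_subset[OF that assms(1)] that
  proof (induction rule: finite_induct)
    case empty
    have "p - p \<in> fun_space.span (W D \<union> {u. (D, u) \<in> {}})" for p D
      using fun_space.span_zero by (metis cancel_comm_monoid_add_class.diff_cancel)
    hence "\<exists>q \<in> S {} D. p - q \<in> fun_space.span (W D \<union> {u. (D, u) \<in> {}})" if "p \<in> S {} D" for p D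
      using that by blast
    thus ?case by (intro exI[of _ "{}"] conjI allI ballI) (simp_all only: finite.emptyI card.empty zero_le)
  next
    case (insert j A)
    obtain R where R: "finite R" "card R \<le> card A * m"
      "\<And>D p. p \<in> S {} D \<Longrightarrow> \<exists>q \<in> S A D. p - q \<in> fun_space.span (W D \<union> {u. (D, u) \<in> R})"
      using insert.IH insert.prems by blast
    obtain R' where R': "finite R'" "card R' \<le> m"
      "\<And>D p. p \<in> S A D \<Longrightarrow> \<exists>q \<in> S (insert j A) D. p - q \<in> fun_space.span (W D \<union> {u. (D, u) \<in> R'})"
      using step[of A j] insert.prems insert.hyps by blast
    have "\<exists>q \<in> S (insert j A) D. p - q \<in> fun_space.span (W D \<union> {u. (D, u) \<in> R \<union> R'})"
      if p: "p \<in> S {} D" for p D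
    proof -
      obtain q where q: "q \<in> S A D" "p - q \<in> fun_space.span (W D \<union> {u. (D, u) \<in> R})" using R(3)[OF p] by blast
      obtain q' where q': "q' \<in> S (insert j A) D" "q - q' \<in> fun_space.span (W D \<union> {u. (D, u) \<in> R'})"
        using R'(3)[OF q(1)] by blast
      have "p - q \<in> fun_space.span (W D \<union> {u. (D, u) \<in> R \<union> R'})" by (rule span_subset_mem[OF _ q(2)]) auto
      moreover have "q - q' \<in> fun_space.span (W D \<union> {u. (D, u) \<in> R \<union> R'})" by (rule span_subset_mem[OF _ q'(2)]) auto
      ultimately have "(p - q) + (q - q') \<in> fun_space.span (W D \<union> {u. (D, u) \<in> R \<union> R'})"
        by (rule fun_space.span_add)
      moreover have "(p - q) + (q - q') = p - q'" by (simp add: fun_eq_iff)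
      ultimately show ?thesis using q'(1) by metis
    qed
    moreover have "card (R \<union> R') \<le> card (insert j A) * m"
      using card_Un_le[of R R'] R(2) R'(2) insert.hyps by simp
    ultimately show ?case using R(1) R'(1) by (intro exI[of _ "R \<union> R'"] conjI allI ballI finite_UnI)
  qed
  thus ?thesis by blast
qed

lemma lower_part_mult:
  fixes f :: "('v \<Rightarrow> 'a :: field) \<Rightarrow> 'a"
  assumes "finite I" "A \<subseteq> I" "f \<in> lower_part I T a L1 D1"
    and "(\<And>i. degree_bound D1 L1 i > 0) \<Longrightarrow> (\<And>i. degree_bound D1 L1 i + of_bool (i \<in> A) \<le> degree_bound D2 L2 i)"
  shows "linear_product A c * f \<in> lower_part I T a L2 D2"
proof -
  have m: "linear_product A c * g \<in> poly_space I (degree_bound D2 L2)" if "g \<in> poly_space I (degree_bound D1 L1)"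
    for g :: "('v \<Rightarrow> 'a) \<Rightarrow> 'a"
    using linear_product_mult_poly_space[OF assms(1,2) that assms(4)] .
  consider "f \<in> poly_space I (degree_bound D1 L1)"
    | i g where "i \<in> T" "g \<in> poly_space I (degree_bound D1 L1)" "f = linear_product I (a i) * g"
    using assms(3) unfolding lower_part_def by auto
  thus ?thesis
  proof cases
    case 1
    thus ?thesis using m unfolding lower_part_def by blast
  next
    case 2
    have "linear_product A c * f = linear_product I (a i) * (linear_product A c * g)"
      unfolding 2(3) by (simp add: fun_eq_iff algebra_simps)
    thus ?thesis using m[OF 2(2)] 2(1) unfolding lower_part_def by blast
  qed
qed

text \<open>The factors removed earlier multiply the whole relation. They raise the degree by one in each
variable of \<open>A\<close>, which is compensated by the bounds having been lowered there.\<close>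

lemma peel_after_product:
  fixes a :: "'i \<Rightarrow> 'v \<Rightarrow> 'a :: field"
  assumes "finite I" "j \<in> I" "j \<notin> L'" "\<And>i. i \<in> T - {t} \<Longrightarrow> a i j \<noteq> a t j"
    and IH: "poly_space (I - {j}) (degree_bound (Suc D') L')
               \<subseteq> fun_space.span (lower_part (I - {j}) (T - {t}) a L' D' \<union> U)"
    and A: "A \<subseteq> I" "j \<notin> A"
    and degree_bound: "(\<And>i. degree_bound D' L' i > 0) \<Longrightarrow> (\<And>i. degree_bound D' L' i + of_bool (i \<in> A) \<le> degree_bound D L i)"
    and p: "p \<in> (*) (linear_product A (a t)) ` poly_space I (degree_bound (Suc D') L')"
  shows "\<exists>q \<in> (*) (linear_product (insert j A) (a t)) ` poly_space I (degree_bound (Suc D') (insert j L')).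
           p - q \<in> fun_space.span (lower_part I T a L D \<union> (*) (linear_product A (a t)) ` U)"
proof -
  let ?P = "linear_product A (a t)"
  obtain g where g: "g \<in> poly_space I (degree_bound (Suc D') L')" "p = ?P * g" using p by blast
  obtain r where r: "r \<in> poly_space I (degree_bound (Suc D') (insert j L'))"
    "g - linear_factor j (a t j) * r \<in> fun_space.span (lower_part I T a L' D' \<union> U)"
    using peel_one_variable[OF assms(1-4) IH g(1)] by blast
  have "?P * (g - linear_factor j (a t j) * r) \<in> fun_space.span (lower_part I T a L D \<union> (*) ?P ` U)"
    using r(2)
  proof (rule span_mult_image)
    fix f assume "f \<in> lower_part I T a L' D' \<union> U"
    hence "?P * f \<in> lower_part I T a L D \<union> (*) ?P ` U"
      using lower_part_mult[OF assms(1) A(1) _ degree_bound] by blast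
    thus "?P * f \<in> fun_space.span (lower_part I T a L D \<union> (*) ?P ` U)"
      by (rule fun_space.span_base)
  qed
  moreover have "finite A" using A assms(1) finite_subset by blast
  hence "?P * (g - linear_factor j (a t j) * r) = p - linear_product (insert j A) (a t) * r"
    using A(2) by (simp add: g(2) fun_eq_iff linear_product_def linear_factor_def algebra_simps)
  ultimately show ?thesis using r(1) by (metis imageI)
qed

text \<open>Fix an equation \<open>t\<close> and divide by its linear factors, first for the variables outside \<open>L\<close>, then for
those in \<open>L\<close>. The order keeps all intermediate bounds within one of each other, that is, of the form
\<open>degree_bound\<close>. Finally a multiple of the whole product of equation \<open>t\<close> is left, which belongs to the lower
part. Every division leaves a remainder in one variable less, to which the induction hypothesis contributes
\<open>fact n\<close> generators counted over all degrees. With \<open>n + 1\<close> divisions this is the recursion of the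
factorial. Counting over all degrees at once is essential: for a fixed degree the numbers are of Eulerian
type.\<close>

lemma graded_spanning_set:
  fixes a :: "'i \<Rightarrow> 'v \<Rightarrow> 'a :: field"
  assumes "finite I" "finite T" "card T = card I" "L \<subseteq> I" "\<And>j. j \<in> I \<Longrightarrow> inj_on (\<lambda>i. a i j) T"
  shows "\<exists>R. finite R \<and> card R \<le> fact (card I) \<and>
    (\<forall>D. poly_space I (degree_bound (Suc D) L) \<subseteq> fun_space.span (lower_part I T a L D \<union> {u. (D, u) \<in> R}))"
  using assms
proof (induction "card I" arbitrary: I T L)
  case 0
  hence I: "I = {}" "L = {}" by auto
  have m: "monomial_fun {} e = monomial_fun {} (\<lambda>_. 0)" for e :: "'v \<Rightarrow> nat" by (simp add: monomial_fun_def)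
  define R where "R = {(0 :: nat, monomial_fun {} (\<lambda>_. 0) :: ('v \<Rightarrow> 'a) \<Rightarrow> 'a)}"
  have "poly_space {} (degree_bound (Suc D) {}) \<subseteq> fun_space.span (lower_part {} T a {} D \<union> {u. (D, u) \<in> R})" for D
  proof (cases "D = 0")
    case True
    have "{monomial_fun {} e | e. \<forall>j. e j < degree_bound (Suc D) {} j} \<subseteq> {u. (D, u) \<in> R}"
      using True m by (auto simp: R_def)
    thus ?thesis unfolding poly_space_def by (intro fun_space.span_mono) blast
  next
    case False
    have "poly_space {} (degree_bound (Suc D) {}) \<subseteq> (poly_space {} (degree_bound D {}) :: (('v \<Rightarrow> 'a) \<Rightarrow> 'a) set)"
      using False by (intro poly_space_extend) (auto simp: degree_bound_def)
    also have "\<dots> \<subseteq> lower_part {} T a {} D \<union> {u. (D, u) \<in> R}" by (auto simp: lower_part_def)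
    also have "\<dots> \<subseteq> fun_space.span (lower_part {} T a {} D \<union> {u. (D, u) \<in> R})" by (rule fun_space.span_superset)
    finally show ?thesis .
  qed
  thus ?case unfolding I by (intro exI[of _ R]) (auto simp: R_def)
next
  case (Suc n)
  have "T \<noteq> {}" using Suc.hyps Suc.prems by auto
  then obtain t where t: "t \<in> T" by blast
  note finI = \<open>finite I\<close>
  have IH: "\<exists>R. finite R \<and> card R \<le> fact n \<and> (\<forall>D. poly_space (I - {j}) (degree_bound (Suc D) L')
       \<subseteq> fun_space.span (lower_part (I - {j}) (T - {t}) a L' D \<union> {u. (D, u) \<in> R}))"
    if "j \<in> I" "L' \<subseteq> I - {j}" for j L'
  proof -
    have "n = card (I - {j})" using that Suc.hyps(2) finI by simp
    moreover have "card (T - {t}) = card (I - {j})" using that Suc.prems t by simp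
    ultimately show ?thesis using Suc.hyps(1)[of "I - {j}" "T - {t}" L'] that Suc.prems
      by (metis Diff_subset finite_Diff inj_on_diff DiffD1)
  qed
  have dist: "a i j \<noteq> a t j" if "j \<in> I" "i \<in> T - {t}" for i j
    using Suc.prems(5)[OF that(1)] that(2) t by (auto simp: inj_on_def)
  define W where "W = (\<lambda>D. lower_part I T a L D)"
  \<comment> \<open>In these divisions the bounds outside \<open>L\<close> drop to those in \<open>L\<close>.\<close>
  define S1 where "S1 = (\<lambda>A D. (*) (linear_product A (a t)) ` poly_space I (degree_bound (Suc D) (L \<union> A)))"
  have "\<exists>R. finite R \<and> card R \<le> card (I - L) * fact n \<and>
      (\<forall>D. \<forall>p \<in> S1 {} D. \<exists>q \<in> S1 (I - L) D. p - q \<in> fun_space.span (W D \<union> {u. (D, u) \<in> R}))"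
  proof (rule reduction_chain)
    fix A j assume A: "A \<subseteq> I - L" "j \<in> (I - L) - A"
    have j: "j \<in> I" "L \<union> A \<subseteq> I - {j}" using A \<open>L \<subseteq> I\<close> by auto
    obtain R where R: "finite R" "card R \<le> fact n"
      "\<And>D. poly_space (I - {j}) (degree_bound (Suc D) (L \<union> A))
       \<subseteq> fun_space.span (lower_part (I - {j}) (T - {t}) a (L \<union> A) D \<union> {u. (D, u) \<in> R})"
      using IH[OF j] by blast
    define R' where "R' = (\<lambda>(D, u). (D, linear_product A (a t) * u)) ` R"
    have "\<exists>q \<in> S1 (insert j A) D. p - q \<in> fun_space.span (W D \<union> {u. (D, u) \<in> R'})"
      if p: "p \<in> S1 A D" for p D
    proof -
      have "\<exists>q \<in> (*) (linear_product (insert j A) (a t)) ` poly_space I (degree_bound (Suc D) (insert j (L \<union> A))).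
           p - q \<in> fun_space.span (lower_part I T a L D \<union> (*) (linear_product A (a t)) ` {u. (D, u) \<in> R})"
      proof (rule peel_after_product[OF finI _ _ _ R(3)])
        show "degree_bound D (L \<union> A) i + of_bool (i \<in> A) \<le> degree_bound D L i" if "\<And>i. degree_bound D (L \<union> A) i > 0" for i
          using A that[of i] by (auto simp: degree_bound_def of_bool_def split: if_splits)
      qed (use p A dist in \<open>auto simp: S1_def\<close>)
      moreover have "(*) (linear_product A (a t)) ` {u. (D, u) \<in> R} \<subseteq> {u. (D, u) \<in> R'}"
        by (force simp: R'_def)
      hence "lower_part I T a L D \<union> (*) (linear_product A (a t)) ` {u. (D, u) \<in> R} \<subseteq> W D \<union> {u. (D, u) \<in> R'}"
        unfolding W_def by blast
      note span_subset_mem[OF this]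
      moreover have "L \<union> insert j A = insert j (L \<union> A)" by blast
      ultimately show ?thesis unfolding S1_def by fastforce
    qed
    moreover have "finite R'" "card R' \<le> fact n"
      using R(1,2) card_image_le[OF R(1)] by (auto simp: R'_def intro: le_trans)
    ultimately show "\<exists>R. finite R \<and> card R \<le> fact n \<and>
      (\<forall>D. \<forall>p \<in> S1 A D. \<exists>q \<in> S1 (insert j A) D. p - q \<in> fun_space.span (W D \<union> {u. (D, u) \<in> R}))"
      by blast
  qed (use finI in auto)
  then obtain R1 where R1: "finite R1" "card R1 \<le> card (I - L) * fact n"
      "\<And>D p. p \<in> S1 {} D \<Longrightarrow> \<exists>q \<in> S1 (I - L) D. p - q \<in> fun_space.span (W D \<union> {u. (D, u) \<in> R1})"
    by blast
  \<comment> \<open>All bounds now equal \<open>D\<close>, and the induction hypothesis is needed one degree lower, as \<open>Suc D\<close> in the tags shows.\<close>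
  define S2 where "S2 = (\<lambda>A D. (*) (linear_product ((I - L) \<union> A) (a t)) ` poly_space I (degree_bound D A))"
  have "\<exists>R. finite R \<and> card R \<le> card L * fact n \<and>
      (\<forall>D. \<forall>p \<in> S2 {} D. \<exists>q \<in> S2 L D. p - q \<in> fun_space.span (W D \<union> {u. (D, u) \<in> R}))"
  proof (rule reduction_chain)
    fix A j assume A: "A \<subseteq> L" "j \<in> L - A"
    have j: "j \<in> I" "A \<subseteq> I - {j}" using A \<open>L \<subseteq> I\<close> by auto
    obtain R where R: "finite R" "card R \<le> fact n"
      "\<And>D. poly_space (I - {j}) (degree_bound (Suc D) A)
       \<subseteq> fun_space.span (lower_part (I - {j}) (T - {t}) a A D \<union> {u. (D, u) \<in> R})"
      using IH[OF j] by blast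
    let ?A = "(I - L) \<union> A"
    define R' where "R' = (\<lambda>(D, u). (Suc D, linear_product ?A (a t) * u)) ` R"
    have "\<exists>q \<in> S2 (insert j A) D. p - q \<in> fun_space.span (W D \<union> {u. (D, u) \<in> R'})"
      if p: "p \<in> S2 A D" for p D
    proof (cases D)
      case 0
      have "poly_space I (degree_bound D A) = ({0} :: (('v \<Rightarrow> 'a) \<Rightarrow> 'a) set)"
        using 0 by (intro poly_space_trivial[of _ j]) (simp add: degree_bound_def)
      hence "p = 0" using p by (auto simp: S2_def fun_eq_iff)
      hence "p - 0 = 0" by (simp add: fun_eq_iff)
      moreover have "linear_product ((I - L) \<union> insert j A) (a t) * 0 \<in> S2 (insert j A) D"
        unfolding S2_def using poly_space_zero by (intro imageI)
      hence "0 \<in> S2 (insert j A) D" by (simp only: mult_zero_right)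
      ultimately show ?thesis using fun_space.span_zero by metis
    next
      case (Suc D')
      have "\<exists>q \<in> (*) (linear_product (insert j ?A) (a t)) ` poly_space I (degree_bound (Suc D') (insert j A)).
           p - q \<in> fun_space.span (lower_part I T a L D \<union> (*) (linear_product ?A (a t)) ` {u. (D', u) \<in> R})"
      proof (rule peel_after_product[OF finI _ _ _ R(3)])
        show "degree_bound D' A i + of_bool (i \<in> ?A) \<le> degree_bound D L i" if "\<And>i. degree_bound D' A i > 0" for i
          using A that[of i] Suc by (auto simp: degree_bound_def of_bool_def split: if_splits)
      qed (use p A j dist Suc in \<open>auto simp: S2_def\<close>)
      moreover have "(*) (linear_product ?A (a t)) ` {u. (D', u) \<in> R} \<subseteq> {u. (D, u) \<in> R'}"
        by (force simp: R'_def Suc)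
      hence "lower_part I T a L D \<union> (*) (linear_product ?A (a t)) ` {u. (D', u) \<in> R} \<subseteq> W D \<union> {u. (D, u) \<in> R'}"
        unfolding W_def by blast
      note span_subset_mem[OF this]
      moreover have "(I - L) \<union> insert j A = insert j ?A" by blast
      ultimately show ?thesis unfolding S2_def Suc by fastforce
    qed
    moreover have "finite R'" "card R' \<le> fact n"
      using R(1,2) card_image_le[OF R(1)] by (auto simp: R'_def intro: le_trans)
    ultimately show "\<exists>R. finite R \<and> card R \<le> fact n \<and>
      (\<forall>D. \<forall>p \<in> S2 A D. \<exists>q \<in> S2 (insert j A) D. p - q \<in> fun_space.span (W D \<union> {u. (D, u) \<in> R}))"
      by blast
  qed (use finI \<open>L \<subseteq> I\<close> finite_subset in auto)
  then obtain R2 where R2: "finite R2" "card R2 \<le> card L * fact n"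
      "\<And>D p. p \<in> S2 {} D \<Longrightarrow> \<exists>q \<in> S2 L D. p - q \<in> fun_space.span (W D \<union> {u. (D, u) \<in> R2})"
    by blast
  have S12: "S1 (I - L) D \<subseteq> S2 {} D" for D
  proof (cases "D = 0")
    case False
    hence "poly_space I (degree_bound (Suc D) (L \<union> (I - L))) \<subseteq> (poly_space I (degree_bound D {}) :: (('v \<Rightarrow> 'a) \<Rightarrow> 'a) set)"
      using finI by (intro poly_space_extend) (auto simp: degree_bound_def)
    thus ?thesis unfolding S1_def S2_def by (auto intro!: image_mono)
  next
    case True
    obtain j where "j \<in> I" using Suc.hyps(2) by (metis card.empty all_not_in_conv nat.distinct(1))
    hence "poly_space I (degree_bound (Suc D) (L \<union> (I - L))) = ({0} :: (('v \<Rightarrow> 'a) \<Rightarrow> 'a) set)"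
      using True by (intro poly_space_trivial[of _ j]) (auto simp: degree_bound_def)
    hence "poly_space I (degree_bound (Suc D) (L \<union> (I - L))) \<subseteq> (poly_space I (degree_bound D {}) :: (('v \<Rightarrow> 'a) \<Rightarrow> 'a) set)"
      by (simp only: insert_subset poly_space_zero empty_subsetI simp_thms)
    thus ?thesis unfolding S1_def S2_def by (auto intro!: image_mono)
  qed
  have S2L: "S2 L D \<subseteq> W D" for D
  proof -
    have "(I - L) \<union> L = I" using \<open>L \<subseteq> I\<close> by auto
    thus ?thesis using t unfolding S2_def W_def lower_part_def by auto
  qed
  have "p \<in> fun_space.span (W D \<union> {u. (D, u) \<in> R1 \<union> R2})" if p: "p \<in> poly_space I (degree_bound (Suc D) L)" for p D
  proof -
    let ?S = "fun_space.span (W D \<union> {u. (D, u) \<in> R1 \<union> R2})"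
    have "linear_product {} (a t) * p = p" by (simp add: linear_product_def fun_eq_iff)
    moreover have "linear_product {} (a t) * p \<in> S1 {} D"
      unfolding S1_def Un_empty_right by (rule imageI[OF p])
    ultimately have "p \<in> S1 {} D" by (simp only:)
    then obtain q where q: "q \<in> S1 (I - L) D" "p - q \<in> fun_space.span (W D \<union> {u. (D, u) \<in> R1})"
      using R1(3) by blast
    then obtain q' where q': "q' \<in> S2 L D" "q - q' \<in> fun_space.span (W D \<union> {u. (D, u) \<in> R2})"
      using R2(3) S12 by blast
    have "p - q \<in> ?S" by (rule span_subset_mem[OF _ q(2)]) auto
    moreover have "q - q' \<in> ?S" by (rule span_subset_mem[OF _ q'(2)]) auto
    moreover have "q' \<in> ?S" using q'(1) S2L by (intro fun_space.span_base) auto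
    ultimately have "(p - q) + ((q - q') + q') \<in> ?S" by (intro fun_space.span_add)
    moreover have "(p - q) + ((q - q') + q') = p" by (simp add: fun_eq_iff)
    ultimately show ?thesis by metis
  qed
  moreover have "card (R1 \<union> R2) \<le> fact (card I)"
  proof -
    have "card (R1 \<union> R2) \<le> card R1 + card R2" by (rule card_Un_le)
    also have "\<dots> \<le> (card (I - L) + card L) * fact n" using R1(2) R2(2) by (simp add: algebra_simps)
    also have "card (I - L) + card L = Suc n"
      using Suc.hyps(2) finI \<open>L \<subseteq> I\<close> by (metis card_Diff_subset card_mono finite_subset le_add_diff_inverse2)
    finally show ?thesis using Suc.hyps(2)[symmetric] by simp
  qed
  ultimately show ?case using R1(1) R2(1) unfolding W_def by (intro exI[of _ "R1 \<union> R2"]) auto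
qed

text \<open>Lagrange interpolation: for every other point a linear factor in some coordinate vanishes there but not at \<open>v\<close>.\<close>

lemma indicator_in_poly_space:
  fixes V :: "('v \<Rightarrow> 'a :: field) set"
  assumes "finite I" "finite V" "v \<notin> V" "\<And>w. w \<in> V \<Longrightarrow> \<exists>j\<in>I. v j \<noteq> w j"
  shows "\<exists>D. \<exists>f \<in> poly_space I (degree_bound D {}). f v = 1 \<and> (\<forall>w\<in>V. f w = 0)"
  using assms(2-4)
proof (induction rule: finite_induct)
  case empty
  have "monomial_fun I (\<lambda>_. 0) \<in> poly_space I (degree_bound 1 {})" by (intro monomial_in_poly_space) (simp add: degree_bound_def)
  moreover have "monomial_fun I (\<lambda>_. 0) v = 1" by (simp add: monomial_fun_def)
  ultimately show ?case by blast
next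
  case (insert w V)
  then obtain D f where f: "f \<in> poly_space I (degree_bound D {})" "f v = 1" "\<forall>w\<in>V. f w = 0" by auto
  obtain j where j: "j \<in> I" "v j \<noteq> w j" using insert.prems by auto
  define g where "g = (\<lambda>x. (1 / (v j - w j)) * (linear_factor j (w j) * f) x)"
  have "g \<in> poly_space I (degree_bound (Suc D) {})" unfolding g_def using assms(1) j f(1)
    by (intro poly_space_scale linear_factor_mult_poly_space[OF _ _ f(1)]) (auto simp: degree_bound_def of_bool_def)
  moreover have "g v = 1" "\<forall>u\<in>insert w V. g u = 0" using f j by (auto simp: g_def linear_factor_def)
  ultimately show ?case by blast
qed

text \<open>By induction on the degree, every polynomial function agrees on \<open>V\<close> with a combination of the
generators. By interpolation the polynomial functions include all functions on \<open>V\<close>, a space of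
dimension \<open>card V\<close>. In the filtration by the maximal degree in a single variable the
constants \<open>b i\<close> have lower order than the products, which is why the same generators serve for all of them.\<close>

theorem card_common_solutions_le_fact:
  fixes a :: "'i \<Rightarrow> 'v \<Rightarrow> 'a :: field" and V :: "('v \<Rightarrow> 'a) set"
  assumes "finite I" "finite T" "card T = card I" "\<And>j. j \<in> I \<Longrightarrow> inj_on (\<lambda>i. a i j) T"
    and "finite V" "\<And>v i. v \<in> V \<Longrightarrow> i \<in> T \<Longrightarrow> (\<Prod>j\<in>I. v j - a i j) = b i"
    and "\<And>v w. v \<in> V \<Longrightarrow> w \<in> V \<Longrightarrow> v \<noteq> w \<Longrightarrow> \<exists>j\<in>I. v j \<noteq> w j"
  shows "card V \<le> fact (card I)"
proof -
  obtain R where R: "finite R" "card R \<le> fact (card I)"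
    "\<And>D. poly_space I (degree_bound (Suc D) {}) \<subseteq> fun_space.span (lower_part I T a {} D \<union> {u. (D, u) \<in> R})"
    using graded_spanning_set[of I T "{}" a] assms(1-4) by auto
  define res :: "(('v \<Rightarrow> 'a) \<Rightarrow> 'a) \<Rightarrow> ('v \<Rightarrow> 'a) \<Rightarrow> 'a" where "res = (\<lambda>f x. if x \<in> V then f x else 0)"
  have res_lin: "res ((\<lambda>x. c * f x) + g) = (\<lambda>x. c * res f x) + res g" for c f g
    by (simp add: res_def fun_eq_iff)
  let ?S = "fun_space.span (res ` snd ` R)"
  have span: "\<forall>p \<in> poly_space I (degree_bound D {}). res p \<in> ?S" for D
  proof (induction D)
    case 0
    have "poly_space I (degree_bound 0 {}) = ({0} :: (('v \<Rightarrow> 'a) \<Rightarrow> 'a) set)"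
      by (rule poly_space_trivial) (simp add: degree_bound_def)
    moreover have "res 0 = 0" by (simp add: res_def fun_eq_iff)
    ultimately show ?case using fun_space.span_zero by (metis singletonD)
  next
    case (Suc D)
    have "res p \<in> ?S" if "p \<in> fun_space.span (lower_part I T a {} D \<union> {u. (D, u) \<in> R})" for p
      using that
    proof (rule span_linear_image)
      fix f assume f: "f \<in> lower_part I T a {} D \<union> {u. (D, u) \<in> R}"
      then consider "f \<in> poly_space I (degree_bound D {})" | "(D, f) \<in> R"
        | i g where "i \<in> T" "g \<in> poly_space I (degree_bound D {})" "f = linear_product I (a i) * g"
        unfolding lower_part_def by auto
      thus "res f \<in> ?S"
      proof cases
        case 1
        thus ?thesis using Suc by blast
      next
        case 2
        hence "res f \<in> res ` snd ` R" by force
        thus ?thesis by (rule fun_space.span_base)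
      next
        case 3
        have "res f = (\<lambda>x. b i * res g x)"
          using assms(6)[OF _ 3(1)] by (auto simp: fun_eq_iff res_def 3(3) linear_product_def)
        thus ?thesis using Suc 3(2) fun_space.span_scale by metis
      qed
    qed (rule res_lin)
    thus ?case using R(3) by blast
  qed
  define \<delta> :: "('v \<Rightarrow> 'a) \<Rightarrow> ('v \<Rightarrow> 'a) \<Rightarrow> 'a" where "\<delta> = (\<lambda>v x. if x = v then 1 else 0)"
  have \<delta>_span: "\<delta> ` V \<subseteq> ?S"
  proof
    fix f assume "f \<in> \<delta> ` V"
    then obtain v where v: "v \<in> V" "f = \<delta> v" by blast
    obtain D g where g: "g \<in> poly_space I (degree_bound D {})" "g v = 1" "\<forall>w\<in>V - {v}. g w = 0"
    proof -
      have "\<exists>j\<in>I. v j \<noteq> w j" if "w \<in> V - {v}" for w using assms(7)[of v w] v(1) that by blast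
      thus ?thesis using indicator_in_poly_space[of I "V - {v}" v] assms(1,5) that by blast
    qed
    have "res g = \<delta> v"
    proof
      fix x show "res g x = \<delta> v x" using g(2,3) v(1) by (cases "x = v") (auto simp: res_def \<delta>_def)
    qed
    thus "f \<in> ?S" using span[of D] g(1) v(2) by metis
  qed
  have inj: "inj_on \<delta> V"
    by (rule inj_onI) (metis \<delta>_def one_neq_zero)
  have "\<delta> v \<notin> fun_space.span (\<delta> ` V - {\<delta> v})" for v
  proof
    assume mem: "\<delta> v \<in> fun_space.span (\<delta> ` V - {\<delta> v})"
    have "fun_space.span (\<delta> ` V - {\<delta> v}) \<subseteq> {f. f v = 0}"
    proof (rule fun_space.span_minimal)
      show "\<delta> ` V - {\<delta> v} \<subseteq> {f. f v = 0}" by (auto simp: \<delta>_def)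
      show "fun_space.subspace {f :: ('v \<Rightarrow> 'a) \<Rightarrow> 'a. f v = 0}"
        by (rule fun_space.subspaceI) auto
    qed
    from subsetD[OF this mem] show False by (simp add: \<delta>_def)
  qed
  note not_in_span = this
  have indep: "fun_space.independent (\<delta> ` V)"
  proof (unfold fun_space.dependent_def, rule notI, erule bexE)
    fix f assume f: "f \<in> \<delta> ` V" "f \<in> fun_space.span (\<delta> ` V - {f})"
    from f(1) obtain v where "f = \<delta> v" by (rule imageE)
    with f(2) not_in_span show False by (simp only:) 
  qed
  have fin: "finite (res ` snd ` R)" by (rule finite_imageI[OF finite_imageI[OF R(1)]])
  have "card (\<delta> ` V) \<le> card (res ` snd ` R)"
    by (rule conjunct2[OF fun_space.independent_span_bound[OF fin indep \<delta>_span]])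
  also have "\<dots> \<le> card (snd ` R)" by (rule card_image_le[OF finite_imageI[OF R(1)]])
  also have "\<dots> \<le> card R" by (rule card_image_le[OF R(1)])
  also note R(2)
  finally show ?thesis unfolding card_image[OF inj] .
qed

section \<open>Norm graphs over finite fields of characteristic two\<close>

text \<open>One algebraically closed field contains all finite fields of characteristic two, as the sets of
fixed points of the powers of the Frobenius map. Orders that are powers of two fit the dyadic blocks to which
the norm graphs are applied.\<close>

type_synonym F2_closure = "bit alg_closure"

lemma CHAR_bit: "CHAR(bit) = 2"
  by (rule CHAR_eq_posI) (auto simp: less_2_cases_iff)

lemma CHAR_F2_closure: "CHAR(F2_closure) = 2"
  by (simp add: CHAR_bit)

lemma frobenius_diff: "(x - y :: F2_closure) ^ (2 ^ n) = x ^ (2 ^ n) - y ^ (2 ^ n)"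
proof -
  have "(x + y) ^ (2 ^ n) = x ^ (2 ^ n) + y ^ (2 ^ n)"
    by (rule freshmans_dream'[where n = n]) (simp_all add: CHAR_bit)
  thus ?thesis by (simp only: minus_CHAR_2[OF CHAR_F2_closure])
qed

lemma frobenius_inj: "x ^ (2 ^ n) = y ^ (2 ^ n) \<Longrightarrow> x = (y :: F2_closure)"
  using frobenius_diff[of x y n] by simp

definition fixed_field :: "nat \<Rightarrow> F2_closure set" where
  "fixed_field Q = {x. x ^ Q = x}"

text \<open>The polynomial \<open>x ^ (2 ^ n) - x\<close> splits, and its derivative is \<open>-1\<close>, so it has no multiple roots.\<close>

lemma card_fixed_field:
  assumes "n > 0"
  shows "finite (fixed_field (2 ^ n))" "card (fixed_field (2 ^ n)) = 2 ^ n"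
proof -
  define p :: "F2_closure poly" where "p = monom 1 (2 ^ n) - monom 1 1"
  have n1: "(1 :: nat) < 2 ^ n" using assms by (intro one_less_power) auto
  have p_poly: "poly p x = x ^ (2 ^ n) - x" for x by (simp add: p_def poly_monom)
  have deg: "degree p = 2 ^ n"
    using n1 unfolding p_def diff_conv_add_uminus
    by (subst degree_add_eq_left) (auto simp: degree_monom_eq)
  have lc: "lead_coeff p = 1" using n1 by (simp add: deg) (simp add: p_def)
  have p0: "p \<noteq> 0" using deg by auto
  have two: "(2 :: F2_closure) = 0" using of_nat_CHAR[where 'a = F2_closure] by (simp add: CHAR_bit)
  have pd: "pderiv p = -1"
    unfolding p_def pderiv_diff pderiv_monom using assms two by (simp add: monom_0 one_pCons power_0_left)
  obtain A where A: "size A = degree p" "p = smult (lead_coeff p) (\<Prod>x\<in>#A. [:-x, 1:])"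
    using alg_closed_imp_factorization[OF p0] by blast
  have pA: "p = (\<Prod>x\<in>#A. [:-x, 1:])" using A(2) lc by simp
  have cnt: "count A x \<le> 1" for x
  proof (rule ccontr)
    assume "\<not> count A x \<le> 1"
    hence x: "x \<in># A" "x \<in># A - {#x#}" by (auto simp: in_diff_count not_less count_greater_zero_iff[symmetric] simp del: count_greater_zero_iff)
    define q where "q = (\<Prod>x\<in>#A - {#x#} - {#x#}. [:-x, 1:])"
    have "A = add_mset x (add_mset x (A - {#x#} - {#x#}))" using x by (metis insert_DiffM)
    hence "p = (\<Prod>x\<in># add_mset x (add_mset x (A - {#x#} - {#x#})). [:-x, 1:])" using pA by simp
    hence "p = [:-x, 1:] * ([:-x, 1:] * q)" by (simp only: image_mset_add_mset prod_mset.add_mset q_def)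
    moreover define l where "l = [:-x, 1:]"
    moreover have "poly l x = 0" by (simp add: l_def)
    ultimately have "poly (pderiv p) x = 0" by (simp add: pderiv_mult del: mult_pCons_left)
    thus False by (simp add: pd)
  qed
  have "A = mset_set (set_mset A)"
  proof (rule multiset_eqI)
    fix x show "count A x = count (mset_set (set_mset A)) x"
      using cnt[of x] by (cases "x \<in># A") (auto simp: count_mset_set' le_Suc_eq count_eq_zero_iff)
  qed
  hence "card (set_mset A) = size A" by (metis size_mset_set)
  moreover have "fixed_field (2 ^ n) = set_mset A"
  proof -
    have "x \<in> fixed_field (2 ^ n) \<longleftrightarrow> poly p x = 0" for x
      by (simp add: fixed_field_def p_poly)
    also have "poly p x = 0 \<longleftrightarrow> x \<in># A" for x
      by (subst pA) (auto simp: poly_prod_mset image_iff prod_mset_zero_iff)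
    finally show ?thesis by blast
  qed
  ultimately show "finite (fixed_field (2 ^ n))" "card (fixed_field (2 ^ n)) = 2 ^ n"
    using A(1) deg by simp_all
qed

text \<open>The norm of the field with \<open>q ^ t\<close> elements over the field with \<open>q\<close> elements.\<close>

definition field_norm :: "nat \<Rightarrow> nat \<Rightarrow> F2_closure \<Rightarrow> F2_closure" where
  "field_norm q t x = (\<Prod>j<t. x ^ (q ^ j))"

lemma field_norm_mult: "field_norm q t (x * y) = field_norm q t x * field_norm q t y"
  by (simp add: field_norm_def power_mult_distrib prod.distrib)

lemma field_norm_eq_0: "q > 0 \<Longrightarrow> field_norm q t x = 0 \<Longrightarrow> x = 0"
  by (auto simp: field_norm_def)

lemma field_norm_in_fixed_field:
  assumes "x \<in> fixed_field (q ^ t)"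
  shows "field_norm q t x \<in> fixed_field q"
proof -
  have "field_norm q t x ^ q * x = (\<Prod>j<t. x ^ (q ^ Suc j)) * x ^ (q ^ 0)"
    by (simp add: field_norm_def prod_power_distrib power_mult[symmetric] mult.commute)
  also have "\<dots> = (\<Prod>j<Suc t. x ^ (q ^ j))" by (simp only: prod.lessThan_Suc_shift mult.commute o_def)
  also have "\<dots> = field_norm q t x * x"
    using assms by (simp add: field_norm_def fixed_field_def)
  finally have *: "field_norm q t x ^ q * x = field_norm q t x * x" .
  show ?thesis
  proof (cases "x = 0")
    case True
    show ?thesis
    proof (cases "t = 0 \<or> q = 0")
      case True
      thus ?thesis using assms \<open>x = 0\<close> by (cases t) (auto simp: fixed_field_def field_norm_def)
    next
      case False
      hence "field_norm q t 0 = 0" by (auto simp: field_norm_def intro!: prod_zero bexI[of _ 0])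
      thus ?thesis using True False by (simp add: fixed_field_def)
    qed
  next
    case False
    thus ?thesis using * by (simp add: fixed_field_def)
  qed
qed

text \<open>As the Frobenius map is additive, \<open>field_norm q t (z - e i)\<close> is a product of linear factors in the
conjugates \<open>z ^ (q ^ j)\<close> of \<open>z\<close>. Treating the conjugates as independent variables only adds solutions.\<close>

lemma card_norm_equations_le_fact:
  fixes e c :: "'i \<Rightarrow> F2_closure"
  assumes "t > 0" "finite T" "card T = t" "inj_on e T" "finite Z"
    and "\<And>z i. z \<in> Z \<Longrightarrow> i \<in> T \<Longrightarrow> field_norm (2 ^ s) t (z - e i) = c i"
  shows "card Z \<le> fact t"
proof -
  define a where "a = (\<lambda>i j. e i ^ ((2 ^ s) ^ j))"
  define point where "point = (\<lambda>(z :: F2_closure) j. z ^ ((2 ^ s) ^ j) :: F2_closure)"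
  have inj: "inj_on point Z"
  proof (rule inj_onI)
    fix x y assume "point x = point y"
    from fun_cong[OF this, of 0] show "x = y" by (simp add: point_def)
  qed
  have "card (point ` Z) \<le> fact (card {..<t})"
  proof (rule card_common_solutions_le_fact[where T = T and a = a and b = c])
    show "inj_on (\<lambda>i. a i j) T" for j
      using assms(4) frobenius_inj by (auto simp: inj_on_def a_def power_mult[symmetric] simp flip: power_mult)
    show "(\<Prod>j\<in>{..<t}. v j - a i j) = c i" if "v \<in> point ` Z" "i \<in> T" for v i
    proof -
      obtain z where z: "z \<in> Z" "v = point z" using \<open>v \<in> point ` Z\<close> by blast
      have "(\<Prod>j\<in>{..<t}. v j - a i j) = field_norm (2 ^ s) t (z - e i)"
        unfolding field_norm_def z(2) point_def a_def
        by (intro prod.cong refl) (simp add: frobenius_diff flip: power_mult)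
      thus ?thesis using assms(6) z that by simp
    qed
    show "\<exists>j\<in>{..<t}. v j \<noteq> w j" if "v \<in> point ` Z" "w \<in> point ` Z" "v \<noteq> w" for v w
    proof (intro bexI[of _ 0])
      show "v 0 \<noteq> w 0" using that by (auto simp: point_def)
    qed (use assms in auto)
  qed (use assms in auto)
  thus ?thesis using card_image[OF inj] by simp
qed

text \<open>The colouring behind the projective norm graphs, which relate \<open>x\<close> and \<open>y\<close> if their
colour is \<open>(True, 1)\<close>. Pairs with equal first coordinates would all have norm \<open>0\<close> and form large complete bipartite
graphs; with the difference of the second coordinates as colour they form matchings instead.\<close>

definition norm_colour :: "nat \<Rightarrow> nat \<Rightarrow> F2_closure \<times> F2_closure \<Rightarrow> F2_closure \<times> F2_closure \<Rightarrow> bool \<times> F2_closure" where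
  "norm_colour q t x y = (if fst x = fst y then (False, snd x - snd y)
     else (True, field_norm q t (fst x - fst y) / (snd x * snd y)))"

definition norm_graph_verts :: "nat \<Rightarrow> nat \<Rightarrow> (F2_closure \<times> F2_closure) set" where
  "norm_graph_verts q t = fixed_field (q ^ t) \<times> (fixed_field q - {0})"

text \<open>Differences and sums coincide in characteristic two.\<close>

lemma norm_colour_commute: "norm_colour q t x y = norm_colour q t y x"
proof -
  have "u - v = v - u" for u v :: F2_closure by (simp only: minus_CHAR_2[OF CHAR_F2_closure] add.commute)
  thus ?thesis unfolding norm_colour_def by (metis mult.commute)
qed

lemma norm_colour_in:
  assumes "x \<in> norm_graph_verts (2 ^ s) t" "y \<in> norm_graph_verts (2 ^ s) t"
  shows "norm_colour (2 ^ s) t x y \<in> UNIV \<times> fixed_field (2 ^ s)"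
proof -
  have "fst x - fst y \<in> fixed_field ((2 ^ s) ^ t)"
    using assms by (auto simp: norm_graph_verts_def fixed_field_def frobenius_diff simp flip: power_mult)
  hence "field_norm (2 ^ s) t (fst x - fst y) \<in> fixed_field (2 ^ s)" by (rule field_norm_in_fixed_field)
  thus ?thesis using assms
    by (auto simp: norm_colour_def norm_graph_verts_def fixed_field_def power_divide power_mult_distrib frobenius_diff)
qed

text \<open>Dividing the equation for each \<open>y \<in> Y\<close> by that for a fixed \<open>y0 \<in> Y\<close> eliminates the second coordinate of
\<open>x\<close>. The quotients are norms of \<open>(fst x - fst y) / (fst x - fst y0)\<close>, which is linear in the inverse of
\<open>fst x - fst y0\<close>; so these inverses solve \<open>t\<close> norm equations.\<close>

lemma card_norm_colour_neighbours_le_fact: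
  assumes "t > 0" and Y: "Y \<subseteq> norm_graph_verts (2 ^ s) t" "card Y = Suc t"
    and P: "P \<subseteq> norm_graph_verts (2 ^ s) t" "finite P"
    and col: "\<And>x y. x \<in> P \<Longrightarrow> y \<in> Y \<Longrightarrow> norm_colour (2 ^ s) t x y = c"
  shows "card P \<le> fact t"
proof (cases "P = {}")
  case False
  then obtain x0 where x0: "x0 \<in> P" by blast
  let ?N = "field_norm (2 ^ s) t"
  have Y_fin: "finite Y" using Y(2) by (metis card.infinite nat.distinct(1))
  have "Y \<noteq> {}" using Y(2) by auto
  then obtain y0 where y0: "y0 \<in> Y" by blast
  have nz: "snd v \<noteq> 0" if "v \<in> P \<union> Y" for v using that P Y by (auto simp: norm_graph_verts_def)
  have eqD: "y = y'" if "y \<in> Y" "y' \<in> Y" "fst y = fst y'" for y y'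
  proof -
    have "norm_colour (2 ^ s) t x0 y = norm_colour (2 ^ s) t x0 y'" using col that x0 by simp
    moreover have "snd x0 \<noteq> 0" "snd y \<noteq> 0" "snd y' \<noteq> 0" using nz x0 that by auto
    moreover have "?N (fst x0 - fst y') \<noteq> 0" if "fst x0 \<noteq> fst y'" using that field_norm_eq_0[of "2 ^ s"] by force
    ultimately have "snd y = snd y'" using that(3)
      by (auto simp: norm_colour_def field_simps split: if_splits)
    thus ?thesis using that(3) by (simp add: prod_eq_iff)
  qed
  have neq: "fst x \<noteq> fst y" if xy: "x \<in> P" "y \<in> Y" for x y
  proof
    assume e: "fst x = fst y"
    hence "fst c = False" using col[OF xy] by (auto simp: norm_colour_def)
    hence all: "fst x = fst y'" if "y' \<in> Y" for y' using col[OF xy(1) that] by (auto simp: norm_colour_def split: if_splits)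
    hence "Y \<subseteq> {y}" using eqD xy(2) e by (metis singletonI subsetI)
    hence "card Y \<le> 1" using card_mono[of "{y}" Y] by simp
    thus False using Y(2) assms(1) by simp
  qed
  define c' where "c' = snd c"
  have nrm: "?N (fst x - fst y) = c' * snd x * snd y" if "x \<in> P" "y \<in> Y" for x y
    using col[OF that] neq[OF that] nz[of x] nz[of y] that by (auto simp: norm_colour_def c'_def field_simps)
  have c': "c' \<noteq> 0"
    using nrm[OF x0 y0] neq[OF x0 y0] field_norm_eq_0[of "2 ^ s" t "fst x0 - fst y0"] by auto
  \<comment> \<open>The substitution that makes the quotients of the norms linear.\<close>
  define z where "z = (\<lambda>x :: F2_closure \<times> F2_closure. 1 / (fst x - fst y0))"
  have inj: "inj_on z P"
  proof (rule inj_onI)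
    fix x x' assume x: "x \<in> P" "x' \<in> P" "z x = z x'"
    hence e: "fst x = fst x'" using neq[OF x(1) y0] neq[OF x(2) y0] by (simp add: z_def)
    hence "c' * snd x * snd y0 = c' * snd x' * snd y0" using nrm x y0 by metis
    hence "snd x = snd x'" using c' nz[of y0] y0 by simp
    thus "x = x'" using e by (simp add: prod_eq_iff)
  qed
  have "card (z ` P) \<le> fact t"
  proof (rule card_norm_equations_le_fact[where T = "Y - {y0}" and e = "\<lambda>y. 1 / (fst y - fst y0)"
        and c = "\<lambda>y. snd y / (snd y0 * ?N (fst y0 - fst y))"])
    show "inj_on (\<lambda>y. 1 / (fst y - fst y0)) (Y - {y0})"
    proof (rule inj_onI)
      fix y y' assume y: "y \<in> Y - {y0}" "y' \<in> Y - {y0}" "1 / (fst y - fst y0) = 1 / (fst y' - fst y0)"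
      hence "fst y = fst y'" using eqD[of y y0] eqD[of y' y0] y0 by auto
      thus "y = y'" using eqD y by blast
    qed
    show "?N (w - 1 / (fst y - fst y0)) = snd y / (snd y0 * ?N (fst y0 - fst y))"
      if "w \<in> z ` P" "y \<in> Y - {y0}" for w y
    proof -
      obtain x where x: "x \<in> P" "w = z x" using \<open>w \<in> z ` P\<close> by blast
      have y: "y \<in> Y" "fst y \<noteq> fst y0" using that(2) eqD[of y y0] y0 by blast+
      have n: "fst x - fst y0 \<noteq> 0" "fst y0 - fst y \<noteq> 0" "fst y - fst y0 \<noteq> 0" using neq[OF x(1) y0] y by auto
      have "fst x - fst y = (fst x - fst y0) * ((fst y0 - fst y) * (w - 1 / (fst y - fst y0)))"
      proof -
        have "u * ((- v) * (1 / u - 1 / v)) = u - v" if "u \<noteq> 0" "v \<noteq> 0" for u v :: F2_closure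
          using that by (simp add: field_simps)
        from this[OF n(1,3)] show ?thesis by (simp add: x(2) z_def)
      qed
      hence "?N (fst x - fst y) = ?N (fst x - fst y0) * (?N (fst y0 - fst y) * ?N (w - 1 / (fst y - fst y0)))"
        by (simp only: field_norm_mult)
      hence "c' * snd x * snd y = c' * snd x * snd y0 * (?N (fst y0 - fst y) * ?N (w - 1 / (fst y - fst y0)))"
        using nrm x y y0 by metis
      moreover have "c' * snd x \<noteq> 0" using c' nz x by auto
      ultimately have "snd y = snd y0 * (?N (fst y0 - fst y) * ?N (w - 1 / (fst y - fst y0)))"
        by (metis (no_types, opaque_lifting) mult.assoc mult_left_cancel)
      moreover have "?N (fst y0 - fst y) \<noteq> 0" using n field_norm_eq_0[of "2 ^ s"] by force
      ultimately show ?thesis using nz[of y0] y0 by (simp add: field_simps)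
    qed
  qed (use assms y0 Y_fin in auto)
  thus ?thesis using card_image[OF inj] by simp
qed simp

text \<open>Pairs are regarded as edges of a bipartite graph whose two vertex classes are copies of the same
set; the side with \<open>b\<close> vertices may be either of them.\<close>

definition bipartite_free_colouring :: "nat \<Rightarrow> nat \<Rightarrow> (nat \<Rightarrow> nat \<Rightarrow> nat) \<Rightarrow> bool" where
  "bipartite_free_colouring b n \<chi> \<longleftrightarrow> (\<forall>x<2 ^ n. \<forall>y<2 ^ n. \<chi> x y < 4 * 2 ^ (n div b)) \<and>
    (\<forall>P Y c. P \<subseteq> {..<2 ^ n} \<and> Y \<subseteq> {..<2 ^ n} \<and> card Y = b \<and>
       ((\<forall>x\<in>P. \<forall>y\<in>Y. \<chi> x y = c) \<or> (\<forall>x\<in>P. \<forall>y\<in>Y. \<chi> y x = c)) \<longrightarrow> card P \<le> fact (b - 1))"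

lemma bipartite_free_colouringD:
  "bipartite_free_colouring b n \<chi> \<Longrightarrow> P \<subseteq> {..<2 ^ n} \<Longrightarrow> Y \<subseteq> {..<2 ^ n} \<Longrightarrow> card Y = b \<Longrightarrow>
    (\<forall>x\<in>P. \<forall>y\<in>Y. \<chi> x y = c) \<or> (\<forall>x\<in>P. \<forall>y\<in>Y. \<chi> y x = c) \<Longrightarrow> card P \<le> fact (b - 1)"
  unfolding bipartite_free_colouring_def by blast

text \<open>The choice \<open>q = 2 ^ s\<close> with \<open>s = n div b + 1\<close> leaves room for \<open>2 ^ n\<close> vertices, since
\<open>q ^ (b - 1) * (q - 1) \<ge> q ^ b / 2 \<ge> 2 ^ n\<close>, while only \<open>2 * q\<close> colours occur.\<close>

theorem norm_graph_colouring:
  assumes "b \<ge> 2"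
  shows "\<exists>\<chi>. bipartite_free_colouring b n \<chi>"
proof -
  define t where "t = b - 1"
  have t: "t > 0" "b = Suc t" using assms by (auto simp: t_def)
  define s where "s = n div b + 1"
  define q :: nat where "q = 2 ^ s"
  have s: "s > 0" by (simp add: s_def)
  have fin: "finite (fixed_field q)" "finite (fixed_field (q ^ t))"
    and card: "card (fixed_field q) = q" "card (fixed_field (q ^ t)) = q ^ t"
    using card_fixed_field[of s] card_fixed_field[of "s * t"] s t by (auto simp: q_def power_mult)
  have "n < b * s" using assms unfolding s_def
    by (metis Suc_eq_plus1 dividend_less_times_div mult_Suc_right add.commute gr0I not_numeral_le_zero)
  hence "(2 :: nat) ^ Suc n \<le> 2 ^ (b * s)" by (intro power_increasing) auto
  also have "\<dots> = q ^ t * q" by (simp add: q_def t(2) power_mult[symmetric] power_add algebra_simps)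
  also have "\<dots> \<le> q ^ t * (2 * (q - 1))"
  proof (intro mult_left_mono)
    have "2 \<le> q" using s power_increasing[of 1 s "2 :: nat"] by (simp add: q_def)
    thus "q \<le> 2 * (q - 1)" by simp
  qed simp
  finally have size: "2 ^ n \<le> q ^ t * (q - 1)" by simp
  have fin_verts: "finite (norm_graph_verts q t)" using fin by (simp add: norm_graph_verts_def)
  have "0 \<in> fixed_field q" by (simp add: fixed_field_def q_def)
  hence "card (norm_graph_verts q t) = q ^ t * (q - 1)"
    using fin card by (simp add: norm_graph_verts_def card_cartesian_product)
  hence "card {..<(2::nat) ^ n} \<le> card (norm_graph_verts q t)" using size by simp
  then obtain f where f: "f ` {..<(2::nat) ^ n} \<subseteq> norm_graph_verts q t" "inj_on f {..<2 ^ n}"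
    using card_le_inj[OF _ fin_verts, of "{..<(2::nat) ^ n}"] by auto
  have "card ((UNIV :: bool set) \<times> fixed_field q) = 2 * q" using card by (simp add: card_cartesian_product)
  moreover have "finite ((UNIV :: bool set) \<times> fixed_field q)" using fin by simp
  ultimately obtain g where g: "g ` (UNIV \<times> fixed_field q) \<subseteq> {..<2 * q}" "inj_on g ((UNIV :: bool set) \<times> fixed_field q)"
    using card_le_inj[of "(UNIV :: bool set) \<times> fixed_field q" "{..<2 * q}"] by auto
  define \<chi> where "\<chi> = (\<lambda>x y. g (norm_colour q t (f x) (f y)))"
  have col_in: "norm_colour q t (f x) (f y) \<in> UNIV \<times> fixed_field q" if "x < 2 ^ n" "y < 2 ^ n" for x y
    unfolding q_def using f(1) that by (intro norm_colour_in) (auto simp: q_def)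
  have q: "2 * q = 4 * 2 ^ (n div b)" by (simp add: q_def s_def)
  have "\<chi> x y < 4 * 2 ^ (n div b)" if "x < 2 ^ n" "y < 2 ^ n" for x y
    using g(1) col_in[OF that] q unfolding \<chi>_def by (metis image_subset_iff lessThan_iff)
  moreover have "card P \<le> fact (b - 1)"
    if P: "P \<subseteq> {..<2 ^ n}" and Y: "Y \<subseteq> {..<2 ^ n}" "card Y = b"
      and c: "(\<forall>x\<in>P. \<forall>y\<in>Y. \<chi> x y = c) \<or> (\<forall>x\<in>P. \<forall>y\<in>Y. \<chi> y x = c)" for P Y c
  proof -
    have sym: "\<chi> x y = \<chi> y x" for x y unfolding \<chi>_def by (simp add: norm_colour_commute)
    have c: "\<chi> x y = c" if "x \<in> P" "y \<in> Y" for x y using c sym that by metis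
    have "\<exists>c'. \<forall>x\<in>P. \<forall>y\<in>Y. norm_colour q t (f x) (f y) = c'"
    proof (cases "P = {} \<or> Y = {}")
      case False
      then obtain x0 y0 where xy: "x0 \<in> P" "y0 \<in> Y" by blast
      have lt: "x < 2 ^ n" if "x \<in> P \<union> Y" for x using that P Y(1) by auto
      have "norm_colour q t (f x) (f y) = norm_colour q t (f x0) (f y0)" if "x \<in> P" "y \<in> Y" for x y
      proof (rule inj_onD[OF g(2)])
        show "g (norm_colour q t (f x) (f y)) = g (norm_colour q t (f x0) (f y0))"
          using c[OF that] c[OF xy] by (simp add: \<chi>_def)
      qed (use lt that xy in \<open>auto intro!: col_in\<close>)
      thus ?thesis by blast
    qed auto
    then obtain c' where c': "\<And>x y. x \<in> P \<Longrightarrow> y \<in> Y \<Longrightarrow> norm_colour q t (f x) (f y) = c'" by blast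
    have inj: "inj_on f P" "inj_on f Y" using f(2) P Y inj_on_subset by blast+
    have "card (f ` P) \<le> fact t"
    proof (rule card_norm_colour_neighbours_le_fact[where Y = "f ` Y" and s = s and c = c'])
      show "f ` Y \<subseteq> norm_graph_verts (2 ^ s) t" "f ` P \<subseteq> norm_graph_verts (2 ^ s) t"
        using f(1) P Y(1) by (auto simp: q_def)
      show "card (f ` Y) = Suc t" using card_image[OF inj(2)] Y t by simp
      show "norm_colour (2 ^ s) t x y = c'" if "x \<in> f ` P" "y \<in> f ` Y" for x y
        using c' that by (auto simp: q_def)
    qed (use t P finite_subset in auto)
    thus ?thesis using card_image[OF inj(1)] t by simp
  qed
  ultimately have "bipartite_free_colouring b n \<chi>" unfolding bipartite_free_colouring_def by blast
  thus ?thesis by (rule exI[of _ \<chi>])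
qed

section \<open>Berge copies as embeddings\<close>

definition complete_bipartite_in :: "nat \<Rightarrow> nat \<Rightarrow> 'a set set \<Rightarrow> bool" where
  "complete_bipartite_in a b G \<longleftrightarrow>
     (\<exists>S T. card S = a \<and> card T = b \<and> finite S \<and> finite T \<and> S \<inter> T = {} \<and> (\<forall>x\<in>S. \<forall>y\<in>T. {x, y} \<in> G))"

definition ramsey_property :: "nat \<Rightarrow> nat \<Rightarrow> nat \<Rightarrow> nat \<Rightarrow> nat \<Rightarrow> bool" where
  "ramsey_property a b r k n \<longleftrightarrow> (\<forall>c \<in> edges (complete_uniform r n) \<rightarrow> {..<k}.
        \<exists>H. subhypergraph H (complete_uniform r n) \<and> monochromatic c H \<and>
            (\<exists>F \<in> Berge (complete_bipartite a b). isomorphic H F))"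

text \<open>A Berge copy is represented by the placement \<open>f\<close> of its core and the hyperedges \<open>\<psi> i j\<close> assigned to
the edges of the graph, which is the form in which it is refuted and constructed below.\<close>

definition Berge_embedding :: "nat \<Rightarrow> nat \<Rightarrow> 'a set set \<Rightarrow> (nat \<Rightarrow> 'a) \<Rightarrow> (nat \<Rightarrow> nat \<Rightarrow> 'a set) \<Rightarrow> bool" where
  "Berge_embedding a b E f \<psi> \<longleftrightarrow> inj_on f {..<a + b} \<and>
     (\<forall>i<a. \<forall>j\<in>{a..<a + b}. \<psi> i j \<in> E \<and> f i \<in> \<psi> i j \<and> f j \<in> \<psi> i j) \<and>
     inj_on (\<lambda>(i, j). \<psi> i j) ({..<a} \<times> {a..<a + b})"

lemma edges_complete_bipartite:
  "edges (complete_bipartite a b) = (\<lambda>(i, j). {i, j}) ` ({..<a} \<times> {a..<a + b})"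
  by (force simp: complete_bipartite_def)

lemma verts_complete_bipartite: "verts (complete_bipartite a b) = {..<a + b}"
  by (simp add: complete_bipartite_def)

lemma inj_on_bipartite_edges: "inj_on (\<lambda>(i, j). {i, j}) ({..<a} \<times> {a..<a + b :: nat})"
  by (auto simp: inj_on_def doubleton_eq_iff)

lemma Berge_isomorphic_imp_embedding:
  assumes "hypergraph H" "F \<in> Berge (complete_bipartite a b)" "isomorphic H F"
  obtains f \<psi> where "Berge_embedding a b (edges H) f \<psi>" "f ` {..<a + b} \<subseteq> verts H"
proof -
  from assms(2) obtain \<phi> where F: "hypergraph F" "{..<a + b} \<subseteq> verts F"
    "bij_betw \<phi> (edges (complete_bipartite a b)) (edges F)"
    "\<And>e. e \<in> edges (complete_bipartite a b) \<Longrightarrow> e \<subseteq> \<phi> e"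
    unfolding Berge_def mem_Collect_eq verts_complete_bipartite by blast
  from assms(3) obtain h where h: "bij_betw h (verts H) (verts F)" "edges F = (\<lambda>e. h ` e) ` edges H"
    unfolding isomorphic_def by blast
  define g where "g = inv_into (verts H) h"
  have g: "bij_betw g (verts F) (verts H)" unfolding g_def by (rule bij_betw_inv_into[OF h(1)])
  have g_edge: "g ` e \<in> edges H" if "e \<in> edges F" for e
  proof -
    have "e \<in> (\<lambda>e. h ` e) ` edges H" using that unfolding h(2) .
    then obtain e' where e': "e' \<in> edges H" "e = h ` e'" by blast
    have "e' \<subseteq> verts H" using e'(1) assms(1) by (auto simp: hypergraph_def)
    hence "g ` e = e'" unfolding g_def e'(2)
      by (intro inv_into_image_cancel bij_betw_imp_inj_on[OF h(1)])
    thus ?thesis using e'(1) by simp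
  qed
  have edge: "{i, j} \<in> edges (complete_bipartite a b)" if "i < a" "j \<in> {a..<a + b}" for i j
    using that by (auto simp: complete_bipartite_def)
  define \<psi> where "\<psi> = (\<lambda>i j. g ` \<phi> {i, j})"
  have "Berge_embedding a b (edges H) g \<psi>"
    unfolding Berge_embedding_def
  proof (intro conjI allI impI ballI)
    show "inj_on g {..<a + b}" using g F(2) by (meson bij_betw_def inj_on_subset)
  next
    fix i j assume ij: "i < a" "j \<in> {a..<a + b}"
    have \<phi>: "\<phi> {i, j} \<in> edges F" using F(3) edge[OF ij] by (auto simp: bij_betw_def)
    show "\<psi> i j \<in> edges H" unfolding \<psi>_def by (rule g_edge[OF \<phi>])
    show "g i \<in> \<psi> i j" "g j \<in> \<psi> i j" using F(4)[OF edge[OF ij]] by (auto simp: \<psi>_def)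
  next
    show "inj_on (\<lambda>(i, j). \<psi> i j) ({..<a} \<times> {a..<a + b})"
    proof (rule inj_onI)
      fix p p' assume p: "p \<in> {..<a} \<times> {a..<a + b}" "p' \<in> {..<a} \<times> {a..<a + b}"
        and eq': "(\<lambda>(i, j). \<psi> i j) p = (\<lambda>(i, j). \<psi> i j) p'"
      obtain i j i' j' where pp: "p = (i, j)" "p' = (i', j')" by (metis prod.exhaust)
      have ij: "i \<in> {..<a}" "j \<in> {a..<a + b}" "i' \<in> {..<a}" "j' \<in> {a..<a + b}"
        and eq: "\<psi> i j = \<psi> i' j'"
        using p eq' pp by auto
      have e: "{i, j} \<in> edges (complete_bipartite a b)" "{i', j'} \<in> edges (complete_bipartite a b)"
        using edge ij by auto
      hence \<phi>: "\<phi> {i, j} \<in> edges F" "\<phi> {i', j'} \<in> edges F" using F(3) by (auto simp: bij_betw_def)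
      hence "\<phi> {i, j} \<subseteq> verts F" "\<phi> {i', j'} \<subseteq> verts F" using F(1) by (auto simp: hypergraph_def)
      hence "\<phi> {i, j} = \<phi> {i', j'}" using eq g unfolding \<psi>_def
        by (meson bij_betw_def inj_on_image_eq_iff)
      hence "{i, j} = {i', j'}" using F(3) e by (auto simp: bij_betw_def inj_on_def)
      thus "p = p'" using ij pp by (auto simp: doubleton_eq_iff)
    qed
  qed
  moreover have "g ` {..<a + b} \<subseteq> verts H" using g F(2) by (auto simp: bij_betw_def)
  ultimately show ?thesis using that by blast
qed

lemma extend_to_bijection:
  assumes "finite A" "S \<subseteq> A" "inj_on f S" "f ` S \<subseteq> A"
  obtains g where "bij_betw g A A" "\<And>x. x \<in> S \<Longrightarrow> g x = f x"
proof -
  have "card (A - S) = card (A - f ` S)"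
    using assms by (simp add: card_Diff_subset finite_subset card_image)
  then obtain h where h: "bij_betw h (A - S) (A - f ` S)"
    using assms(1) finite_same_card_bij by (metis finite_Diff)
  define g where "g = (\<lambda>x. if x \<in> S then f x else h x)"
  have "bij_betw g (S \<union> (A - S)) (f ` S \<union> (A - f ` S))"
  proof (rule bij_betw_combine)
    show "bij_betw g S (f ` S)" using assms(3) by (auto simp: bij_betw_def g_def inj_on_def)
    show "bij_betw g (A - S) (A - f ` S)" using h by (rule bij_betw_cong[THEN iffD1, rotated]) (auto simp: g_def)
  qed auto
  moreover have "S \<union> (A - S) = A" "f ` S \<union> (A - f ` S) = A" using assms by auto
  ultimately have "bij_betw g A A" by simp
  thus ?thesis using that[of g] by (simp add: g_def)
qed

text \<open>A member of the Berge family has the integers below \<open>a + b\<close> as core. It is obtained by applying to the edges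
the inverse of a permutation of all \<open>n\<close> vertices that extends \<open>f\<close>.\<close>

lemma embedding_imp_Berge_subhypergraph:
  assumes emb: "Berge_embedding a b E f \<psi>" and E: "E \<subseteq> edges (complete_uniform r n)"
    and f: "f ` {..<a + b} \<subseteq> {..<n}" and mono: "\<And>e. e \<in> E \<Longrightarrow> c e = i"
  shows "\<exists>H. subhypergraph H (complete_uniform r n) \<and> monochromatic c H \<and>
            (\<exists>F \<in> Berge (complete_bipartite a b). isomorphic H F)"
proof -
  have inj: "inj_on f {..<a + b}"
    and \<psi>: "\<And>i j. i < a \<Longrightarrow> j \<in> {a..<a + b} \<Longrightarrow> \<psi> i j \<in> E \<and> f i \<in> \<psi> i j \<and> f j \<in> \<psi> i j"
    and inj_\<psi>: "inj_on (\<lambda>(i, j). \<psi> i j) ({..<a} \<times> {a..<a + b})"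
    using emb unfolding Berge_embedding_def by blast+
  let ?I = "{..<a} \<times> {a..<a + b}"
  have "a + b \<le> n" using card_inj_on_le[OF inj f] by simp
  hence sub: "{..<a + b} \<subseteq> {..<n}" by auto
  obtain g where g: "bij_betw g {..<n} {..<n}" "\<And>x. x \<in> {..<a + b} \<Longrightarrow> g x = f x"
    using extend_to_bijection[OF _ sub inj f] by blast
  define h where "h = inv_into {..<n} g"
  have h: "bij_betw h {..<n} {..<n}" unfolding h_def by (rule bij_betw_inv_into[OF g(1)])
  have hf: "h (f x) = x" if "x \<in> {..<a + b}" for x
    using that g sub unfolding h_def by (metis bij_betw_inv_into_left subsetD)
  define H :: "nat hypergraph" where "H = ({..<n}, (\<lambda>(i, j). \<psi> i j) ` ?I)"
  define F :: "nat hypergraph" where "F = ({..<n}, (\<lambda>e. h ` e) ` edges H)"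
  have HE: "edges H \<subseteq> E" using \<psi> by (auto simp: H_def)
  have En: "e \<subseteq> {..<n}" if "e \<in> E" for e using E that by (auto simp: complete_uniform_def)
  have 1: "subhypergraph H (complete_uniform r n)"
    using HE E En by (auto simp: subhypergraph_def hypergraph_def H_def complete_uniform_def)
  have 2: "monochromatic c H" using HE mono unfolding monochromatic_def by blast
  have 3: "isomorphic H F" unfolding isomorphic_def F_def using h by (auto simp: H_def)
  have inj_e: "inj_on (\<lambda>p :: nat \<times> nat. {fst p, snd p}) ?I"
    using inj_on_bipartite_edges unfolding case_prod_unfold .
  define \<phi> where "\<phi> = (\<lambda>e. h ` (\<lambda>(i, j). \<psi> i j) (inv_into ?I (\<lambda>p. {fst p, snd p}) e))"
  have \<phi>: "\<phi> {i, j} = h ` \<psi> i j" if "i < a" "j \<in> {a..<a + b}" for i j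
  proof -
    have "inv_into ?I (\<lambda>p. {fst p, snd p}) {i, j} = (i, j)"
      using inv_into_f_f[OF inj_e, of "(i, j)"] that by simp
    thus ?thesis by (simp add: \<phi>_def)
  qed
  have eI: "edges (complete_bipartite a b) = (\<lambda>p. {fst p, snd p}) ` ?I"
    unfolding edges_complete_bipartite case_prod_unfold ..
  have "bij_betw \<phi> (edges (complete_bipartite a b)) (edges F)"
    unfolding bij_betw_def
  proof
    show "inj_on \<phi> (edges (complete_bipartite a b))"
    proof (rule inj_onI)
      fix e e' assume "e \<in> edges (complete_bipartite a b)" "e' \<in> edges (complete_bipartite a b)" and eq: "\<phi> e = \<phi> e'"
      then obtain i j i' j' where ij: "i < a" "j \<in> {a..<a + b}" "e = {i, j}" "i' < a" "j' \<in> {a..<a + b}" "e' = {i', j'}"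
        unfolding eI by auto
      have "h ` \<psi> i j = h ` \<psi> i' j'" using eq \<phi> ij by simp
      moreover have "\<psi> i j \<subseteq> {..<n}" "\<psi> i' j' \<subseteq> {..<n}" using \<psi> ij En by blast+
      ultimately have "\<psi> i j = \<psi> i' j'" using h by (meson bij_betw_def inj_on_image_eq_iff)
      hence "(i, j) = (i', j')" using inj_onD[OF inj_\<psi>, of "(i, j)" "(i', j')"] ij by auto
      thus "e = e'" using ij by simp
    qed
    show "\<phi> ` edges (complete_bipartite a b) = edges F"
      unfolding eI F_def H_def snd_conv image_image
      by (intro image_cong refl) (auto simp: \<phi>)
  qed
  moreover have "e \<subseteq> \<phi> e" if "e \<in> edges (complete_bipartite a b)" for e
  proof -
    obtain i j where ij: "i < a" "j \<in> {a..<a + b}" "e = {i, j}"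
    proof -
      obtain p where "p \<in> ?I" "e = {fst p, snd p}" using \<open>e \<in> _\<close> unfolding eI by blast
      thus ?thesis using that[of "fst p" "snd p"] by auto
    qed
    have "h (f i) \<in> h ` \<psi> i j" "h (f j) \<in> h ` \<psi> i j" using \<psi> ij by blast+
    thus ?thesis using \<phi>[OF ij(1,2)] hf[of i] hf[of j] ij by auto
  qed
  moreover have "hypergraph F"
  proof -
    have "h ` e \<subseteq> {..<n}" if "e \<in> edges H" for e
      using image_mono[OF En, of e h] HE that h by (auto simp: bij_betw_def)
    thus ?thesis by (auto simp: hypergraph_def F_def)
  qed
  ultimately have "F \<in> Berge (complete_bipartite a b)"
    unfolding Berge_def mem_Collect_eq verts_complete_bipartite using sub by (auto simp: F_def)
  thus ?thesis using 1 2 3 by blast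
qed

section \<open>Colourings without a Berge copy\<close>

lemma greedy_colouring:
  assumes "finite V" "\<And>x. x \<in> V \<Longrightarrow> card {y \<in> V. y \<noteq> x \<and> R x y} \<le> d"
    and sym: "\<And>x y. R x y \<Longrightarrow> R y x"
  shows "\<exists>f :: 'a \<Rightarrow> nat. (\<forall>x\<in>V. f x \<le> d) \<and> (\<forall>x\<in>V. \<forall>y\<in>V. x \<noteq> y \<and> R x y \<longrightarrow> f x \<noteq> f y)"
  using assms(1,2)
proof (induction rule: finite_induct)
  case (insert v V)
  have "card {y \<in> V. y \<noteq> x \<and> R x y} \<le> d" if "x \<in> V" for x
  proof -
    have "card {y \<in> V. y \<noteq> x \<and> R x y} \<le> card {y \<in> insert v V. y \<noteq> x \<and> R x y}"
      using insert by (intro card_mono) auto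
    thus ?thesis using insert.prems[of x] that by simp
  qed
  then obtain f :: "'a \<Rightarrow> nat" where f: "\<forall>x\<in>V. f x \<le> d" "\<forall>x\<in>V. \<forall>y\<in>V. x \<noteq> y \<and> R x y \<longrightarrow> f x \<noteq> f y"
    using insert.IH by blast
  let ?N = "{y \<in> V. y \<noteq> v \<and> R v y}"
  have "?N = {y \<in> insert v V. y \<noteq> v \<and> R v y}" by auto
  hence "card ?N \<le> d" using insert.prems[of v] by simp
  hence "card (f ` ?N) \<le> d" using card_image_le[of ?N f] insert.hyps by simp
  hence "card (f ` ?N) < card {..d}" by simp
  hence "\<not> {..d} \<subseteq> f ` ?N" using card_mono[of "f ` ?N" "{..d}"] insert.hyps by auto
  then obtain c where c: "c \<le> d" "c \<notin> f ` ?N" by blast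
  have "\<forall>x\<in>insert v V. (f(v := c)) x \<le> d" using f(1) c(1) by simp
  moreover have "(f(v := c)) x \<noteq> (f(v := c)) y" if "x \<in> insert v V" "y \<in> insert v V" "x \<noteq> y" "R x y" for x y
    using that f(2) c(2) sym[of x y] insert.hyps by (cases "x = v"; cases "y = v") auto
  ultimately show ?case by blast
qed auto

lemma card_subsets_containing_le:
  assumes "s > 0"
  shows "card {h. h \<subseteq> {..<n :: nat} \<and> card h = s \<and> z \<in> h} \<le> n ^ (s - 1)"
proof -
  have "inj_on (\<lambda>h. h - {z}) {h. h \<subseteq> {..<n} \<and> card h = s \<and> z \<in> h}" by (auto simp: inj_on_def)
  moreover have "(\<lambda>h. h - {z}) ` {h. h \<subseteq> {..<n} \<and> card h = s \<and> z \<in> h} \<subseteq> {h. h \<subseteq> {..<n} \<and> card h = s - 1}"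
    by (auto simp: card_Diff_singleton)
  moreover have "finite {h. h \<subseteq> {..<n} \<and> card h = s - 1}" by simp
  ultimately have "card {h. h \<subseteq> {..<n} \<and> card h = s \<and> z \<in> h} \<le> card {h. h \<subseteq> {..<n} \<and> card h = s - 1}"
    by (rule card_inj_on_le)
  also have "\<dots> = n choose (s - 1)" using n_subsets[of "{..<n}" "s - 1"] by simp
  also have "\<dots> \<le> n ^ (s - 1)" by (cases "s - 1 \<le> n") (auto simp: binomial_le_pow binomial_eq_0)
  finally show ?thesis .
qed

text \<open>A set of size \<open>s\<close> meets at most \<open>s * n ^ (s - 1)\<close> other ones, and greedy colouring uses one colour
more than that.\<close>

lemma matching_colouring:
  assumes "s > 0"
  shows "\<exists>\<mu> :: nat set \<Rightarrow> nat. (\<forall>h. h \<subseteq> {..<n} \<and> card h = s \<longrightarrow> \<mu> h \<le> s * n ^ (s - 1)) \<and>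
    (\<forall>h h'. h \<subseteq> {..<n} \<and> card h = s \<and> h' \<subseteq> {..<n} \<and> card h' = s \<and> \<mu> h = \<mu> h' \<longrightarrow> h = h' \<or> h \<inter> h' = {})"
proof -
  let ?V = "{h. h \<subseteq> {..<n} \<and> card h = s}"
  have "\<exists>f :: nat set \<Rightarrow> nat. (\<forall>x\<in>?V. f x \<le> s * n ^ (s - 1)) \<and>
      (\<forall>x\<in>?V. \<forall>y\<in>?V. x \<noteq> y \<and> x \<inter> y \<noteq> {} \<longrightarrow> f x \<noteq> f y)"
  proof (rule greedy_colouring)
    fix h assume h: "h \<in> ?V"
    hence fin: "finite h" using assms by (simp add: card_ge_0_finite)
    have "card {y \<in> ?V. y \<noteq> h \<and> h \<inter> y \<noteq> {}} \<le> card (\<Union>z\<in>h. {y. y \<subseteq> {..<n} \<and> card y = s \<and> z \<in> y})"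
      using fin by (intro card_mono) auto
    also have "\<dots> \<le> (\<Sum>z\<in>h. card {y. y \<subseteq> {..<n} \<and> card y = s \<and> z \<in> y})" by (rule card_UN_le[OF fin])
    also have "\<dots> \<le> (\<Sum>z\<in>h. n ^ (s - 1))" using card_subsets_containing_le[OF assms] by (intro sum_mono)
    also have "\<dots> = s * n ^ (s - 1)" using h by simp
    finally show "card {y \<in> ?V. y \<noteq> h \<and> h \<inter> y \<noteq> {}} \<le> s * n ^ (s - 1)" .
  qed auto
  thus ?thesis by (elim exE) (rule_tac x = f in exI, blast)
qed

lemma differing_bit:
  fixes x y :: nat
  assumes "x < 2 ^ m" "y < 2 ^ m" "x div 2 ^ j \<noteq> y div 2 ^ j"
  shows "\<exists>i\<in>{j..<m}. bit x i \<noteq> bit y i"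
proof -
  have "drop_bit j x \<noteq> drop_bit j y" using assms(3) by (simp add: drop_bit_eq_div)
  then obtain l where l: "bit (drop_bit j x) l \<noteq> bit (drop_bit j y) l" by (metis bit_eqI)
  hence ne: "bit x (j + l) \<noteq> bit y (j + l)" by (simp add: bit_drop_bit_eq)
  have "\<not> bit z i" if "z < 2 ^ m" "m \<le> i" for z i :: nat
  proof -
    have "z < 2 ^ i" using that by (meson le_less_trans less_le_trans one_le_numeral power_increasing)
    thus ?thesis by (simp add: bit_iff_odd)
  qed
  hence "j + l < m" using ne assms(1,2) by (meson not_less)
  thus ?thesis using ne by (intro bexI[of _ "j + l"]) auto
qed

lemma card_small_subsets_le:
  assumes "finite A"
  shows "finite {J. J \<subseteq> A \<and> card J \<le> k}" "card {J. J \<subseteq> A \<and> card J \<le> k} \<le> (card A + 1) ^ k"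
proof -
  show fin: "finite {J. J \<subseteq> A \<and> card J \<le> k}" using assms by simp
  show "card {J. J \<subseteq> A \<and> card J \<le> k} \<le> (card A + 1) ^ k"
  proof (induction k)
    case 0
    have "{J. J \<subseteq> A \<and> card J \<le> 0} = {{}}" using finite_subset[OF _ assms] by (auto simp: card_eq_0_iff)
    thus ?case by simp
  next
    case (Suc k)
    let ?F = "\<lambda>k. {J. J \<subseteq> A \<and> card J \<le> k}"
    have "?F (Suc k) \<subseteq> (\<lambda>(J, x). case x of None \<Rightarrow> J | Some y \<Rightarrow> insert y J) ` (?F k \<times> (insert None (Some ` A)))"
    proof
      fix J assume J: "J \<in> ?F (Suc k)"
      have finJ: "finite J" using J assms finite_subset by auto
      show "J \<in> (\<lambda>(J, x). case x of None \<Rightarrow> J | Some y \<Rightarrow> insert y J) ` (?F k \<times> (insert None (Some ` A)))"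
      proof (cases "card J \<le> k")
        case True
        thus ?thesis using J by (intro image_eqI[of _ _ "(J, None)"]) auto
      next
        case False
        hence "J \<noteq> {}" by auto
        then obtain y where y: "y \<in> J" by blast
        have "card (J - {y}) \<le> k" using J y finJ by (auto simp: card_Diff_singleton)
        thus ?thesis using J y by (intro image_eqI[of _ _ "(J - {y}, Some y)"]) auto
      qed
    qed
    hence "card (?F (Suc k)) \<le> card (?F k \<times> (insert None (Some ` A)))"
      using assms by (intro surj_card_le) auto
    also have "\<dots> = card (?F k) * (card A + 1)"
      using assms by (simp add: card_cartesian_product card_insert_if card_image)
    also have "\<dots> \<le> (card A + 1) ^ k * (card A + 1)" using Suc by (intro mult_right_mono) auto
    finally show ?case by (simp add: mult.commute)
  qed
qed

definition separates :: "nat set set \<Rightarrow> nat \<Rightarrow> nat \<Rightarrow> nat \<Rightarrow> bool" where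
  "separates \<S> m j k \<longleftrightarrow>
     (\<forall>A B. finite A \<and> finite B \<and> card A * card B \<le> k \<and> A \<subseteq> {..<2 ^ m} \<and> B \<subseteq> {..<2 ^ m} \<and>
        (\<forall>x\<in>A. \<forall>y\<in>B. x div 2 ^ j \<noteq> y div 2 ^ j) \<longrightarrow> (\<exists>S\<in>\<S>. A \<subseteq> S \<and> B \<inter> S = {}))"

text \<open>For \<open>x \<in> A\<close> and \<open>y \<in> B\<close> pick a bit from position \<open>j\<close> on in which they differ. The pattern of these at
most \<open>k\<close> bits tells the elements of \<open>A\<close> from those of \<open>B\<close>. So it suffices to take all sets that are
described by at most \<open>k\<close> positions and a set of patterns on them; their number is
polynomial in \<open>m - j\<close>.\<close>

lemma separating_family:
  "\<exists>\<S>. finite \<S> \<and> card \<S> \<le> (m - j + 1) ^ k * 2 ^ 2 ^ k \<and> separates \<S> m j k"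
proof -
  define Js where "Js = {J. J \<subseteq> {j..<m} \<and> card J \<le> k}"
  define \<S> where "\<S> = (\<lambda>(J, P). {x :: nat. {i \<in> J. bit x i} \<in> P}) ` (SIGMA J : Js. Pow (Pow J))"
  have Js: "finite Js" "card Js \<le> (m - j + 1) ^ k"
    using card_small_subsets_le[of "{j..<m}" k] by (simp_all add: Js_def)
  have finJ: "finite J" if "J \<in> Js" for J using that finite_subset by (auto simp: Js_def)
  have fin: "finite (SIGMA J : Js. Pow (Pow J))" using Js finJ by auto
  have "card \<S> \<le> card (SIGMA J : Js. Pow (Pow J))" unfolding \<S>_def by (rule card_image_le[OF fin])
  also have "\<dots> = (\<Sum>J\<in>Js. card (Pow (Pow J)))" using Js finJ by (intro card_SigmaI) auto
  also have "\<dots> \<le> (\<Sum>J\<in>Js. 2 ^ 2 ^ k)"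
  proof (rule sum_mono)
    fix J assume J: "J \<in> Js"
    have "card (Pow (Pow J)) = 2 ^ 2 ^ card J" using finJ[OF J] by (simp add: card_Pow)
    also have "\<dots> \<le> 2 ^ 2 ^ k" using J by (intro power_increasing) (auto simp: Js_def)
    finally show "card (Pow (Pow J)) \<le> 2 ^ 2 ^ k" .
  qed
  also have "\<dots> = card Js * 2 ^ 2 ^ k" by simp
  also have "\<dots> \<le> (m - j + 1) ^ k * 2 ^ 2 ^ k" using Js by (intro mult_right_mono) auto
  finally have card: "card \<S> \<le> (m - j + 1) ^ k * 2 ^ 2 ^ k" .
  have sep: "\<exists>S\<in>\<S>. A \<subseteq> S \<and> B \<inter> S = {}"
    if A: "finite A" "finite B" "card A * card B \<le> k" "A \<subseteq> {..<2 ^ m}" "B \<subseteq> {..<2 ^ m}"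
      "\<And>x y. x \<in> A \<Longrightarrow> y \<in> B \<Longrightarrow> x div 2 ^ j \<noteq> y div 2 ^ j" for A B
  proof -
    define d where "d = (\<lambda>(x, y). SOME i. i \<in> {j..<m} \<and> bit (x :: nat) i \<noteq> bit (y :: nat) i)"
    have d: "d (x, y) \<in> {j..<m} \<and> bit x (d (x, y)) \<noteq> bit y (d (x, y))" if "x \<in> A" "y \<in> B" for x y
    proof -
      have "\<exists>i. i \<in> {j..<m} \<and> bit x i \<noteq> bit y i"
        using differing_bit[of x m y j] A(4-6) that by blast
      from someI_ex[OF this] show ?thesis by (simp add: d_def)
    qed
    define J where "J = d ` (A \<times> B)"
    have "card J \<le> card (A \<times> B)" unfolding J_def using A by (intro card_image_le) auto
    hence "card J \<le> k" using A(3) by (simp add: card_cartesian_product)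
    moreover have "J \<subseteq> {j..<m}" using d by (auto simp: J_def)
    ultimately have J: "J \<in> Js" by (simp add: Js_def)
    define P where "P = (\<lambda>x. {i \<in> J. bit x i}) ` A"
    define S where "S = {x :: nat. {i \<in> J. bit x i} \<in> P}"
    have "S \<in> \<S>" unfolding \<S>_def S_def using J by (intro image_eqI[of _ _ "(J, P)"]) (auto simp: P_def)
    moreover have "A \<subseteq> S" by (auto simp: S_def P_def)
    moreover have "y \<notin> S" if "y \<in> B" for y
    proof
      assume "y \<in> S"
      then obtain x where x: "x \<in> A" "{i \<in> J. bit y i} = {i \<in> J. bit x i}" by (auto simp: S_def P_def)
      have "d (x, y) \<in> J" using x that by (auto simp: J_def)
      thus False using x(2) d[OF x(1) that] by blast
    qed
    ultimately show ?thesis by blast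
  qed
  show ?thesis
    unfolding separates_def
  proof (intro exI[of _ \<S>] conjI allI impI)
    show "finite \<S>" unfolding \<S>_def by (rule finite_imageI[OF fin])
    show "card \<S> \<le> (m - j + 1) ^ k * 2 ^ 2 ^ k" by (rule card)
    fix A B :: "nat set"
    assume A: "finite A \<and> finite B \<and> card A * card B \<le> k \<and> A \<subseteq> {..<2 ^ m} \<and> B \<subseteq> {..<2 ^ m} \<and>
        (\<forall>x\<in>A. \<forall>y\<in>B. x div 2 ^ j \<noteq> y div 2 ^ j)"
    show "\<exists>S\<in>\<S>. A \<subseteq> S \<and> B \<inter> S = {}"
    proof (rule sep)
      show "x div 2 ^ j \<noteq> y div 2 ^ j" if "x \<in> A" "y \<in> B" for x y using A that by blast
    qed (use A in blast)+
  qed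
qed

lemma lowest_elements_exist:
  assumes "finite (h :: nat set)" "s \<le> card h"
  shows "\<exists>A\<subseteq>h. card A = s \<and> (\<forall>x\<in>A. \<forall>y\<in>h - A. x < y)"
  using assms(2)
proof (induction s)
  case 0
  show ?case by (intro exI[of _ "{}"]) auto
next
  case (Suc s)
  then obtain A where A: "A \<subseteq> h" "card A = s" "\<forall>x\<in>A. \<forall>y\<in>h - A. x < y" by auto
  have fin: "finite (h - A)" "finite A" using assms(1) A(1) finite_subset by auto
  have "h - A \<noteq> {}" using A(1,2) Suc.prems by auto
  define z where "z = Min (h - A)"
  have z: "z \<in> h - A" unfolding z_def by (rule Min_in[OF fin(1) \<open>h - A \<noteq> {}\<close>])
  have "x < y" if "x \<in> insert z A" "y \<in> h - insert z A" for x y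
  proof (cases "x = z")
    case True
    have "z \<le> y" unfolding z_def using fin(1) that by (intro Min_le) auto
    moreover have "y \<noteq> z" using that by auto
    ultimately show ?thesis using True by simp
  next
    case False
    thus ?thesis using A(3) that by auto
  qed
  thus ?case using A z fin by (intro exI[of _ "insert z A"]) auto
qed

text \<open>Here \<open>P\<close> and \<open>Q\<close> are the two sides of the core, \<open>s\<close> and \<open>s'\<close> tell whether a core vertex lies below or above
the cut, and \<open>g\<close> and \<open>g'\<close> name the part that contains it. Suppose that two vertices of \<open>P\<close> lie in the same part. A
vertex of \<open>Q\<close> across the cut would be joined to both of them by the same hyperedge. So all of \<open>Q\<close> lies in that part,
and then all of \<open>P\<close> for the same reason, which makes the part too big.\<close>

lemma groups_inj_on:
  fixes e :: "'i \<Rightarrow> 'j \<Rightarrow> 'v set"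
  assumes same: "\<And>i j. i \<in> P \<Longrightarrow> j \<in> Q \<Longrightarrow> s i = s' j \<Longrightarrow> g i = g' j"
    and diff: "\<And>i j. i \<in> P \<Longrightarrow> j \<in> Q \<Longrightarrow> s i \<noteq> s' j \<Longrightarrow> e i j = g i \<union> g' j"
    and inj: "\<And>i j i' j'. i \<in> P \<Longrightarrow> j \<in> Q \<Longrightarrow> i' \<in> P \<Longrightarrow> j' \<in> Q \<Longrightarrow> e i j = e i' j' \<Longrightarrow> i = i' \<and> j = j'"
    and sides: "\<And>i i'. i \<in> P \<Longrightarrow> i' \<in> P \<Longrightarrow> g i = g i' \<Longrightarrow> s i = (s i' :: bool)"
    and big: "\<And>G. \<not> ((\<forall>i\<in>P. g i = G) \<and> (\<forall>j\<in>Q. g' j = G))"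
    and two: "j1 \<in> Q" "j2 \<in> Q" "j1 \<noteq> j2"
  shows "inj_on g P"
proof (rule inj_onI, rule ccontr)
  fix i i' assume i: "i \<in> P" "i' \<in> P" "g i = g i'" "i \<noteq> i'"
  have s: "s i = s i'" using sides i by blast
  have Q: "s' j = s i \<and> g' j = g i" if j: "j \<in> Q" for j
  proof -
    have "s' j = s i"
    proof (rule ccontr)
      assume "s' j \<noteq> s i"
      hence "e i j = e i' j" using diff[of i j] diff[of i' j] i j s by auto
      thus False using inj i j by blast
    qed
    thus ?thesis using same[of i j] i j by simp
  qed
  have "g k = g i" if k: "k \<in> P" for k
  proof -
    have "s k = s i"
    proof (rule ccontr)
      assume "s k \<noteq> s i"
      hence "e k j1 = e k j2" using diff[of k j1] diff[of k j2] k two Q by auto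
      thus False using inj k two by blast
    qed
    thus ?thesis using same[of k j1] Q[of j1] k two by simp
  qed
  thus False using big[of "g i"] Q by blast
qed

text \<open>By \<open>groups_inj_on\<close>, applied to both sides of the core, each part contains at most one vertex of
either side. If it contained one of each, \<open>i\<close> and \<open>j\<close>, then any other vertices \<open>i'\<close> and \<open>j'\<close> of the two sides
would have to lie across the cut and hence in a common part as well; then the edges of
\<open>i\<close>, \<open>j'\<close> and of \<open>i'\<close>, \<open>j\<close> would be the same hyperedge. So one side of the core lies entirely below the cut
and the other side above.\<close>

lemma embedding_between_groups:
  fixes E :: "'v set set" and Lo Up :: "'v set \<Rightarrow> 'v set"
  assumes split: "\<And>h. h \<in> E \<Longrightarrow> Lo h \<union> Up h = h \<and> Lo h \<subseteq> S \<and> Up h \<inter> S = {}"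
    and small: "\<And>h. h \<in> E \<Longrightarrow> finite h \<and> card (Lo h) < a + b \<and> card (Up h) < a + b"
    and Lo_disj: "\<And>h h'. h \<in> E \<Longrightarrow> h' \<in> E \<Longrightarrow> Lo h \<inter> Lo h' \<noteq> {} \<Longrightarrow> Lo h = Lo h'"
    and Up_disj: "\<And>h h'. h \<in> E \<Longrightarrow> h' \<in> E \<Longrightarrow> Up h \<inter> Up h' \<noteq> {} \<Longrightarrow> Up h = Up h'"
    and emb: "Berge_embedding a b E f \<psi>" and ab: "a \<ge> 2" "b \<ge> 2"
  shows "\<exists>g. inj_on g {..<a} \<and> inj_on g {a..<a + b} \<and>
    ((\<forall>i<a. \<forall>j\<in>{a..<a + b}. Lo (\<psi> i j) = g i \<and> Up (\<psi> i j) = g j) \<or>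
     (\<forall>i<a. \<forall>j\<in>{a..<a + b}. Lo (\<psi> i j) = g j \<and> Up (\<psi> i j) = g i))"
proof -
  let ?P = "{..<a}" and ?Q = "{a..<a + b}"
  have inj_f: "inj_on f {..<a + b}"
    and \<psi>: "\<And>i j. i \<in> ?P \<Longrightarrow> j \<in> ?Q \<Longrightarrow> \<psi> i j \<in> E \<and> f i \<in> \<psi> i j \<and> f j \<in> \<psi> i j"
    and inj_\<psi>: "inj_on (\<lambda>(i, j). \<psi> i j) (?P \<times> ?Q)"
    using emb unfolding Berge_embedding_def by blast+
  have inj: "i = i' \<and> j = j'" if "i \<in> ?P" "j \<in> ?Q" "i' \<in> ?P" "j' \<in> ?Q" "\<psi> i j = \<psi> i' j'" for i j i' j'
    using inj_onD[OF inj_\<psi>, of "(i, j)" "(i', j')"] that by auto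
  have in_Lo: "x \<in> Lo h" if "h \<in> E" "x \<in> h" "x \<in> S" for x h using split[OF that(1)] that(2,3) by blast
  have in_Up: "x \<in> Up h" if "h \<in> E" "x \<in> h" "x \<notin> S" for x h using split[OF that(1)] that(2,3) by blast
  have Lo_S: "Lo h \<subseteq> S" and Up_S: "Up h \<inter> S = {}" and un: "Lo h \<union> Up h = h" if "h \<in> E" for h
    using split[OF that] by blast+
  \<comment> \<open>Some hyperedge of the copy through the core vertex \<open>i\<close>; the part that contains the vertex does not depend on the choice.\<close>
  define ed where "ed = (\<lambda>i. if i < a then \<psi> i a else \<psi> 0 i)"
  have ed: "ed i \<in> E \<and> f i \<in> ed i" if "i \<in> ?P \<union> ?Q" for i
    using \<psi>[of i a] \<psi>[of 0 i] that ab by (cases "i < a") (auto simp: ed_def)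
  define s where "s = (\<lambda>i. f i \<in> S)"
  define g where "g = (\<lambda>i. if s i then Lo (ed i) else Up (ed i))"
  have Lo_eq: "Lo h = g i" if "i \<in> ?P \<union> ?Q" "h \<in> E" "f i \<in> h" "s i" for i h
  proof -
    have "f i \<in> Lo h" using in_Lo that(2-4) unfolding s_def by blast
    moreover have "f i \<in> Lo (ed i)" using in_Lo ed[OF that(1)] that(4) unfolding s_def by blast
    ultimately have "Lo h = Lo (ed i)" using Lo_disj ed[OF that(1)] that(2) by blast
    thus ?thesis using that(4) by (simp add: g_def)
  qed
  have Up_eq: "Up h = g i" if "i \<in> ?P \<union> ?Q" "h \<in> E" "f i \<in> h" "\<not> s i" for i h
  proof -
    have "f i \<in> Up h" using in_Up that(2-4) unfolding s_def by blast
    moreover have "f i \<in> Up (ed i)" using in_Up ed[OF that(1)] that(4) unfolding s_def by blast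
    ultimately have "Up h = Up (ed i)" using Up_disj ed[OF that(1)] that(2) by blast
    thus ?thesis using that(4) by (simp add: g_def)
  qed
  have f_in: "f i \<in> g i" if "i \<in> ?P \<union> ?Q" for i
    using in_Lo[of "ed i" "f i"] in_Up[of "ed i" "f i"] ed[OF that] by (auto simp: g_def s_def)
  have g_S: "(g i \<subseteq> S \<longleftrightarrow> s i)" if "i \<in> ?P \<union> ?Q" for i
    using Lo_S[of "ed i"] Up_S[of "ed i"] ed[OF that] f_in[OF that] by (auto simp: g_def s_def)
  have small_g: "finite (g i) \<and> card (g i) < a + b" if "i \<in> ?P \<union> ?Q" for i
  proof -
    have "finite (Lo (ed i))" "finite (Up (ed i))"
      using small[of "ed i"] un[of "ed i"] ed[OF that] by (metis finite_Un)+
    thus ?thesis using small[of "ed i"] ed[OF that] by (auto simp: g_def)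
  qed
  have same: "g i = g j" if "i \<in> ?P" "j \<in> ?Q" "s i = s j" for i j
  proof -
    let ?h = "\<psi> i j"
    have h: "?h \<in> E" "f i \<in> ?h" "f j \<in> ?h" using \<psi>[OF that(1,2)] by blast+
    have ij: "i \<in> ?P \<union> ?Q" "j \<in> ?P \<union> ?Q" using that by blast+
    show ?thesis
    proof (cases "s i")
      case True
      hence "s j" using that(3) by blast
      from Lo_eq[OF ij(1) h(1,2) True] Lo_eq[OF ij(2) h(1,3) this] show ?thesis by (rule trans[OF sym])
    next
      case False
      hence "\<not> s j" using that(3) by blast
      from Up_eq[OF ij(1) h(1,2) False] Up_eq[OF ij(2) h(1,3) this] show ?thesis by (rule trans[OF sym])
    qed
  qed
  have diff: "\<psi> i j = g i \<union> g j" if "i \<in> ?P" "j \<in> ?Q" "s i \<noteq> s j" for i j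
  proof -
    let ?h = "\<psi> i j"
    have h: "?h \<in> E" "f i \<in> ?h" "f j \<in> ?h" using \<psi>[OF that(1,2)] by blast+
    have ij: "i \<in> ?P \<union> ?Q" "j \<in> ?P \<union> ?Q" using that by blast+
    have u: "Lo ?h \<union> Up ?h = ?h" by (rule un[OF h(1)])
    show ?thesis
    proof (cases "s i")
      case True
      hence "\<not> s j" using that(3) by blast
      from u[unfolded Lo_eq[OF ij(1) h(1,2) True] Up_eq[OF ij(2) h(1,3) this]] show ?thesis by (rule sym)
    next
      case False
      hence "s j" using that(3) by blast
      from u[unfolded Lo_eq[OF ij(2) h(1,3) this] Up_eq[OF ij(1) h(1,2) False]] show ?thesis by blast
    qed
  qed
  have sides: "s i = s j" if "i \<in> ?P \<union> ?Q" "j \<in> ?P \<union> ?Q" "g i = g j" for i j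
    using g_S[OF that(1)] g_S[OF that(2)] that(3) by simp
  have big: "\<not> ((\<forall>i\<in>?P. g i = G) \<and> (\<forall>j\<in>?Q. g j = G))" for G
  proof
    assume G: "(\<forall>i\<in>?P. g i = G) \<and> (\<forall>j\<in>?Q. g j = G)"
    have PQ: "{..<a + b} = ?P \<union> ?Q" by auto
    have "f i \<in> G" if "i \<in> {..<a + b}" for i
    proof -
      have "i \<in> ?P \<union> ?Q" using that PQ by blast
      thus ?thesis using f_in[of i] G by blast
    qed
    hence sub: "f ` {..<a + b} \<subseteq> G" by blast
    have "g 0 = G" "0 \<in> ?P \<union> ?Q" using G ab by auto
    hence G_small: "finite G" "card G < a + b" using small_g[of 0] by blast+
    have "card {..<a + b} \<le> card G" by (rule card_inj_on_le[OF inj_f sub G_small(1)])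
    thus False using G_small(2) by simp
  qed
  have injP: "inj_on g ?P"
  proof (rule groups_inj_on[where Q = ?Q and s = s and s' = s and g' = g and e = \<psi> and ?j1.0 = a and ?j2.0 = "Suc a"])
    show "s i = s i'" if "i \<in> ?P" "i' \<in> ?P" "g i = g i'" for i i' using sides that by blast
    show "g i = g j" if "i \<in> ?P" "j \<in> ?Q" "s i = s j" for i j by (rule same[OF that])
    show "\<psi> i j = g i \<union> g j" if "i \<in> ?P" "j \<in> ?Q" "s i \<noteq> s j" for i j by (rule diff[OF that])
    show "i = i' \<and> j = j'" if "i \<in> ?P" "j \<in> ?Q" "i' \<in> ?P" "j' \<in> ?Q" "\<psi> i j = \<psi> i' j'" for i j i' j'
      by (rule inj[OF that])
    show "\<not> ((\<forall>i\<in>?P. g i = G) \<and> (\<forall>j\<in>?Q. g j = G))" for G by (rule big)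
  qed (use ab in auto)
  have injQ: "inj_on g ?Q"
  proof (rule groups_inj_on[where Q = ?P and s = s and s' = s and g' = g and e = "\<lambda>j i. \<psi> i j" and ?j1.0 = 0 and ?j2.0 = "1"])
    show "s i = s i'" if "i \<in> ?Q" "i' \<in> ?Q" "g i = g i'" for i i' using sides that by blast
    show "g j = g i" if "j \<in> ?Q" "i \<in> ?P" "s j = s i" for i j using same[of i j] that by simp
    show "\<psi> i j = g j \<union> g i" if "j \<in> ?Q" "i \<in> ?P" "s j \<noteq> s i" for i j using diff[of i j] that by blast
    show "j = j' \<and> i = i'" if "j \<in> ?Q" "i \<in> ?P" "j' \<in> ?Q" "i' \<in> ?P" "\<psi> i j = \<psi> i' j'" for i j i' j'
      using inj[of i j i' j'] that by blast
    show "\<not> ((\<forall>j\<in>?Q. g j = G) \<and> (\<forall>i\<in>?P. g i = G))" for G using big[of G] by blast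
  qed (use ab in auto)
  have opp: "s i \<noteq> s j" if ij: "i \<in> ?P" "j \<in> ?Q" for i j
  proof
    assume s: "s i = s j"
    define i' where "i' = (if i = 0 then 1 else 0 :: nat)"
    define j' where "j' = (if j = a then Suc a else a)"
    have i': "i' \<in> ?P" "i' \<noteq> i" using ab by (auto simp: i'_def)
    have j': "j' \<in> ?Q" "j' \<noteq> j" using ab by (auto simp: j'_def)
    have gij: "g i = g j" using same ij s by blast
    have 1: "s i \<noteq> s j'"
      using same[OF ij(1) j'(1)] ij j' gij inj_onD[OF injQ, of j j'] by metis
    have 2: "s i' \<noteq> s j"
      using same[OF i'(1) ij(2)] ij i' gij inj_onD[OF injP, of i i'] by metis
    have "g i' = g j'" using same[OF i'(1) j'(1)] 1 2 s by blast
    hence "\<psi> i j' = \<psi> i' j" unfolding diff[OF ij(1) j'(1) 1] diff[OF i'(1) ij(2) 2] gij by blast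
    thus False using inj ij i' j' by blast
  qed
  have "(\<forall>i<a. \<forall>j\<in>?Q. Lo (\<psi> i j) = g i \<and> Up (\<psi> i j) = g j) \<or>
     (\<forall>i<a. \<forall>j\<in>?Q. Lo (\<psi> i j) = g j \<and> Up (\<psi> i j) = g i)"
  proof (cases "s a")
    case True
    have P: "\<not> s i" if "i \<in> ?P" for i using opp[OF that, of a] True ab by auto
    have Q: "s j" if "j \<in> ?Q" for j using opp[OF _ that, of 0] P[of 0] ab by auto
    show ?thesis
    proof (intro disjI2 allI impI ballI)
      fix i j assume ij: "i < a" "j \<in> ?Q"
      hence i: "i \<in> ?P" by simp
      have h: "\<psi> i j \<in> E" "f i \<in> \<psi> i j" "f j \<in> \<psi> i j" using \<psi>[OF i ij(2)] by blast+
      show "Lo (\<psi> i j) = g j \<and> Up (\<psi> i j) = g i"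
        using Lo_eq[OF UnI2[OF ij(2)] h(1,3) Q[OF ij(2)]] Up_eq[OF UnI1[OF i] h(1,2) P[OF i]] by blast
    qed
  next
    case False
    have P: "s i" if "i \<in> ?P" for i using opp[OF that, of a] False ab by auto
    have Q: "\<not> s j" if "j \<in> ?Q" for j using opp[OF _ that, of 0] P[of 0] ab by auto
    show ?thesis
    proof (intro disjI1 allI impI ballI)
      fix i j assume ij: "i < a" "j \<in> ?Q"
      hence i: "i \<in> ?P" by simp
      have h: "\<psi> i j \<in> E" "f i \<in> \<psi> i j" "f j \<in> \<psi> i j" using \<psi>[OF i ij(2)] by blast+
      show "Lo (\<psi> i j) = g i \<and> Up (\<psi> i j) = g j"
        using Lo_eq[OF UnI1[OF i] h(1,2) P[OF i]] Up_eq[OF UnI2[OF ij(2)] h(1,3) Q[OF ij(2)]] by blast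
    qed
  qed
  thus ?thesis using injP injQ by blast
qed

lemma summable_power_geometric:
  fixes x :: real
  assumes "0 < x" "x < 1"
  shows "summable (\<lambda>l. (real l + 2) ^ K * x ^ l)"
proof -
  define f where "f = (\<lambda>l. (real l + 2) ^ K * x ^ l)"
  have "(\<lambda>l. 1 + inverse (real (Suc l))) \<longlonglongrightarrow> 1 + 0"
    by (intro tendsto_add tendsto_const LIMSEQ_inverse_real_of_nat)
  hence "(\<lambda>l. (1 + inverse (real (Suc l))) ^ K * x) \<longlonglongrightarrow> (1 + 0) ^ K * x"
    by (intro tendsto_mult tendsto_power tendsto_const)
  moreover have "(1 + 0) ^ K * x < (1 + x) / 2" "(1 + x) / 2 < 1" using assms by auto
  ultimately have "eventually (\<lambda>l. (1 + inverse (real (Suc l))) ^ K * x < (1 + x) / 2) sequentially"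
    using order_tendstoD(2) by blast
  then obtain N where N: "\<And>l. l \<ge> N \<Longrightarrow> (1 + inverse (real (Suc l))) ^ K * x < (1 + x) / 2"
    by (auto simp: eventually_sequentially)
  have "summable f"
  proof (rule summable_ratio_test[where c = "(1 + x) / 2" and N = N])
    show "(1 + x) / 2 < 1" using assms by simp
    fix l assume l: "N \<le> l"
    have "1 \<le> (real l + 2) / real (Suc l)" by (simp add: le_divide_eq_1_pos)
    hence "real (Suc l) + 2 \<le> (1 + inverse (real (Suc l))) * (real l + 2)"
      unfolding distrib_right by (simp add: divide_inverse mult.commute)
    hence "(real (Suc l) + 2) ^ K \<le> ((1 + inverse (real (Suc l))) * (real l + 2)) ^ K"
      by (intro power_mono) auto
    hence "f (Suc l) \<le> ((1 + inverse (real (Suc l))) * (real l + 2)) ^ K * x ^ Suc l"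
      unfolding f_def using assms by (intro mult_right_mono) auto
    also have "\<dots> = ((1 + inverse (real (Suc l))) ^ K * x) * f l"
      by (simp add: f_def power_mult_distrib)
    also have "\<dots> \<le> (1 + x) / 2 * f l"
      using N[OF l] assms by (intro mult_right_mono) (auto simp: f_def)
    finally show "norm (f (Suc l)) \<le> (1 + x) / 2 * norm (f l)" using assms by (simp add: f_def)
  qed
  thus ?thesis by (simp add: f_def)
qed

text \<open>Substituting \<open>j = m - 1 - l\<close> turns the sum into \<open>2 powr (m / b)\<close> times a partial sum of the convergent series
with terms \<open>(l + 2) ^ K * 2 powr (- l / b)\<close>: the number of separating sets grows only polynomially,
while the number of norm graph colours drops geometrically.\<close>

lemma weighted_level_sum_le:
  assumes "b > 0"
  shows "\<exists>Z>0. \<forall>m. (\<Sum>j<m. real (m - j + 1) ^ K * 2 powr (real (j + 1) / real b)) \<le> Z * 2 powr (real m / real b)"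
proof -
  define x where "x = 2 powr (- 1 / real b)"
  have x: "0 < x" "x < 1" using assms by (simp_all add: x_def powr_less_one)
  define f where "f = (\<lambda>l. (real l + 2) ^ K * x ^ l)"
  have f: "summable f" "\<And>l. f l \<ge> 0" using summable_power_geometric[OF x] x by (auto simp: f_def)
  define Z where "Z = suminf f + 1"
  have "Z > 0" using suminf_nonneg[OF f] by (simp add: Z_def)
  moreover have "(\<Sum>j<m. real (m - j + 1) ^ K * 2 powr (real (j + 1) / real b)) \<le> Z * 2 powr (real m / real b)" for m
  proof -
    let ?G = "\<lambda>j. real (m - j + 1) ^ K * 2 powr (real (j + 1) / real b)"
    have "(\<Sum>j<m. ?G j) = (\<Sum>l<m. ?G (m - Suc l))" by (rule sum.nat_diff_reindex[symmetric])
    also have "\<dots> = (\<Sum>l<m. f l * 2 powr (real m / real b))"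
    proof (intro sum.cong refl)
      fix l assume "l \<in> {..<m}"
      hence l: "m - (m - Suc l) + 1 = l + 2" "real (m - Suc l + 1) = real m - real l" by auto
      have "(real m - real l) / real b = real m / real b + real l * (- 1 / real b)"
        using assms by (simp add: field_simps)
      hence "2 powr ((real m - real l) / real b) = 2 powr (real m / real b) * x ^ l"
      proof -
        have "x ^ l = 2 powr (real l * (- 1 / real b))" by (simp add: x_def powr_power)
        thus ?thesis using \<open>_ = real m / real b + _\<close> by (simp only: powr_add)
      qed
      thus "?G (m - Suc l) = f l * 2 powr (real m / real b)" unfolding l f_def by (simp add: add.commute)
    qed
    also have "\<dots> = (\<Sum>l<m. f l) * 2 powr (real m / real b)" by (simp add: sum_distrib_right)
    also have "\<dots> \<le> Z * 2 powr (real m / real b)"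
      using sum_le_suminf[OF f(1), of "{..<m}"] f(2) by (intro mult_right_mono) (auto simp: Z_def)
    finally show ?thesis .
  qed
  ultimately show ?thesis by blast
qed

text \<open>The position \<open>j\<close> is that of the highest bit in which \<open>x\<close> and \<open>y\<close> differ.\<close>

lemma splitting_level:
  assumes "x < y" "y < (2 :: nat) ^ m"
  shows "\<exists>j<m. x div 2 ^ Suc j = y div 2 ^ Suc j \<and> x div 2 ^ j \<noteq> y div 2 ^ j"
proof -
  define Q where "Q = (\<lambda>j. x div 2 ^ j = y div 2 ^ j)"
  define l where "l = (LEAST j. Q j)"
  have Qm: "Q m" using assms by (simp add: Q_def)
  have Ql: "Q l" unfolding l_def by (rule LeastI[of Q, OF Qm])
  have "l \<noteq> 0" using Ql assms(1) by (intro notI) (simp add: Q_def)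
  then obtain j where j: "l = Suc j" by (cases l) auto
  have "\<not> Q j" using not_less_Least[of j Q] j unfolding l_def by simp
  moreover have "l \<le> m" unfolding l_def by (rule Least_le[of Q, OF Qm])
  ultimately have "j < m" "x div 2 ^ Suc j = y div 2 ^ Suc j" "x div 2 ^ j \<noteq> y div 2 ^ j"
    using Ql j unfolding Q_def by simp_all
  thus ?thesis by blast
qed

lemma level_palette_size_le:
  fixes s t r n b :: nat
  assumes "s \<ge> 1" "t \<ge> 1" "r = s + t" "n \<ge> 1" "b > 0"
  shows "real ((s * n ^ (s - 1) + 1) * ((t * n ^ (t - 1) + 1) * (4 * 2 ^ (Suc j div b))))
     \<le> (16 * real r ^ 2) * real n ^ (r - 2) * 2 powr (real (j + 1) / real b)"
proof -
  have A: "s' * n ^ (s' - 1) + 1 \<le> 2 * r * n ^ (s' - 1)" if "s' \<le> r" "s' \<ge> 1" for s'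
  proof -
    have "1 \<le> n ^ (s' - 1)" using assms by simp
    hence "s' * n ^ (s' - 1) + 1 \<le> s' * n ^ (s' - 1) + n ^ (s' - 1)" by simp
    also have "\<dots> = (s' + 1) * n ^ (s' - 1)" by simp
    also have "\<dots> \<le> (2 * r) * n ^ (s' - 1)" using that by (intro mult_right_mono) auto
    finally show ?thesis .
  qed
  have B: "real (2 ^ (Suc j div b)) \<le> 2 powr (real (j + 1) / real b)"
  proof -
    have "real (Suc j div b) \<le> real (Suc j) / real b" by (rule of_nat_div_le_of_nat)
    hence "2 powr real (Suc j div b) \<le> 2 powr (real (j + 1) / real b)" by simp
    thus ?thesis by (simp add: powr_realpow)
  qed
  have "(s * n ^ (s - 1) + 1) * ((t * n ^ (t - 1) + 1) * (4 * 2 ^ (Suc j div b)))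
    \<le> (2 * r * n ^ (s - 1)) * ((2 * r * n ^ (t - 1)) * (4 * 2 ^ (Suc j div b)))"
    using A[of s] A[of t] assms by (intro mult_mono) auto
  also have "\<dots> = 16 * r ^ 2 * n ^ (r - 2) * 2 ^ (Suc j div b)"
  proof -
    have "(s - 1) + (t - 1) = r - 2" using assms by simp
    hence "n ^ (r - 2) = n ^ (s - 1) * n ^ (t - 1)" by (metis power_add)
    thus ?thesis by (simp add: power2_eq_square algebra_simps)
  qed
  finally have "real ((s * n ^ (s - 1) + 1) * ((t * n ^ (t - 1) + 1) * (4 * 2 ^ (Suc j div b))))
     \<le> real (16 * r ^ 2 * n ^ (r - 2) * 2 ^ (Suc j div b))" by (rule of_nat_mono)
  also have "\<dots> = (16 * real r ^ 2) * real n ^ (r - 2) * real (2 ^ (Suc j div b))" by simp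
  also have "\<dots> \<le> (16 * real r ^ 2) * real n ^ (r - 2) * 2 powr (real (j + 1) / real b)"
    using B by (intro mult_left_mono) auto
  finally show ?thesis .
qed

text \<open>The colour of an edge consists of the level at which the two elements next to its cut separate, a
set that separates its two parts, the colours of the parts in matching colourings, and the norm graph colour of the
two elements next to the cut. At level \<open>j\<close> these two elements lie in a common dyadic block of length \<open>2 ^ (j + 1)\<close>,
and only their positions in the block are coloured. Different blocks may use the same
colours, because \<open>K\<^sub>a\<^sub>,\<^sub>b\<close> is connected and so lies within one block.\<close>

theorem colouring_without_Berge:
  assumes b: "b \<ge> 2" and a: "a > fact (b - 1)" and r: "r \<ge> 2" "r < 2 * (a + b) - 1"
  shows "\<exists>C>0. \<forall>m. \<exists>col :: nat set \<Rightarrow> nat.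
    (\<forall>h. h \<subseteq> {..<2 ^ m} \<and> card h = r \<longrightarrow> real (col h) < C * (2 ^ m) ^ (r - 2) * 2 powr (real m / real b)) \<and>
    (\<forall>E i f \<psi>. E \<subseteq> {h. h \<subseteq> {..<2 ^ m} \<and> card h = r} \<longrightarrow> (\<forall>h\<in>E. col h = i) \<longrightarrow> \<not> Berge_embedding a b E f \<psi>)"
proof -
  have "fact (b - 1) \<ge> (1 :: nat)" by (rule fact_ge_1)
  hence a2: "a \<ge> 2" using a by linarith
  define s t where "s = r div 2" and "t = r - r div 2"
  have st: "s \<ge> 1" "t \<ge> 1" "r = s + t" "s < a + b" "t < a + b" using r by (auto simp: s_def t_def)
  \<comment> \<open>At most \<open>r ^ 2\<close> pairs of elements from the two parts of an edge have to be told apart.\<close>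
  define K where "K = r ^ 2"
  obtain Z where Z: "Z > 0" "\<And>m. (\<Sum>j<m. real (m - j + 1) ^ K * 2 powr (real (j + 1) / real b)) \<le> Z * 2 powr (real m / real b)"
    using weighted_level_sum_le[of b K] b by auto
  define C where "C = 2 ^ 2 ^ K * (16 * real r ^ 2) * Z"
  have C: "C > 0" using Z(1) r by (simp add: C_def)
  have "\<exists>col :: nat set \<Rightarrow> nat.
    (\<forall>h. h \<subseteq> {..<2 ^ m} \<and> card h = r \<longrightarrow> real (col h) < C * (2 ^ m) ^ (r - 2) * 2 powr (real m / real b)) \<and>
    (\<forall>E i f \<psi>. E \<subseteq> {h. h \<subseteq> {..<2 ^ m} \<and> card h = r} \<longrightarrow> (\<forall>h\<in>E. col h = i) \<longrightarrow> \<not> Berge_embedding a b E f \<psi>)" for m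
  proof -
    define n :: nat where "n = 2 ^ m"
    let ?H = "{h. h \<subseteq> {..<n} \<and> card h = r}"
    define Lo where "Lo = (\<lambda>h :: nat set. SOME A. A \<subseteq> h \<and> card A = s \<and> (\<forall>x\<in>A. \<forall>y\<in>h - A. x < y))"
    define Up where "Up = (\<lambda>h. h - Lo h)"
    have finH: "finite h" if "h \<in> ?H" for h using that r finite_subset by auto
    have Lo: "Lo h \<subseteq> h \<and> card (Lo h) = s \<and> (\<forall>x\<in>Lo h. \<forall>y\<in>Up h. x < y)" if "h \<in> ?H" for h
    proof -
      have "\<exists>A. A \<subseteq> h \<and> card A = s \<and> (\<forall>x\<in>A. \<forall>y\<in>h - A. x < y)"
        using lowest_elements_exist[OF finH[OF that], of s] that st by auto
      from someI_ex[OF this] show ?thesis by (simp add: Lo_def Up_def)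
    qed
    have fin_parts: "finite (Lo h)" "finite (Up h)" if "h \<in> ?H" for h
      using finH[OF that] Lo[OF that] finite_subset by (auto simp: Up_def)
    have card_Up: "card (Up h) = t" if "h \<in> ?H" for h
      using Lo[OF that] that st fin_parts[OF that] by (simp add: Up_def card_Diff_subset)
    have un: "Lo h \<union> Up h = h" if "h \<in> ?H" for h using Lo[OF that] by (auto simp: Up_def)
    \<comment> \<open>Disjoint parts have different representatives, here the elements next to the cut.\<close>
    define top bot where "top = (\<lambda>h. Max (Lo h))" and "bot = (\<lambda>h. Min (Up h))"
    have ne: "Lo h \<noteq> {}" "Up h \<noteq> {}" if "h \<in> ?H" for h
      using Lo[OF that] card_Up[OF that] st by (auto simp del: card_0_eq)
    have top_in: "top h \<in> Lo h" and bot_in: "bot h \<in> Up h" if "h \<in> ?H" for h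
      unfolding top_def bot_def using fin_parts[OF that] ne[OF that] by (auto intro: Max_in Min_in)
    have top_bot: "top h < bot h" "bot h < 2 ^ m" "top h < 2 ^ m" if "h \<in> ?H" for h
    proof -
      show 1: "top h < bot h" using Lo[OF that] top_in[OF that] bot_in[OF that] by blast
      show 2: "bot h < 2 ^ m" using bot_in[OF that] un[OF that] that by (auto simp: n_def)
      show "top h < 2 ^ m" using 1 2 by simp
    qed
    \<comment> \<open>At this level \<open>top h\<close> and \<open>bot h\<close> lie in the two halves of one block. As the cut respects the order, the half-blocks that meet \<open>Lo h\<close> precede those that meet \<open>Up h\<close>.\<close>
    define lv where "lv = (\<lambda>h. SOME j. j < m \<and> top h div 2 ^ Suc j = bot h div 2 ^ Suc j \<and> top h div 2 ^ j \<noteq> bot h div 2 ^ j)"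
    have lv: "lv h < m \<and> top h div 2 ^ Suc (lv h) = bot h div 2 ^ Suc (lv h) \<and> top h div 2 ^ lv h \<noteq> bot h div 2 ^ lv h"
      if "h \<in> ?H" for h
    proof -
      have "\<exists>j. j < m \<and> top h div 2 ^ Suc j = bot h div 2 ^ Suc j \<and> top h div 2 ^ j \<noteq> bot h div 2 ^ j"
        using splitting_level[OF top_bot(1,2)[OF that]] by blast
      from someI_ex[OF this] show ?thesis unfolding lv_def .
    qed
    have "\<forall>j. \<exists>\<S>. finite \<S> \<and> card \<S> \<le> (m - j + 1) ^ K * 2 ^ 2 ^ K \<and> separates \<S> m j K"
      by (intro allI separating_family)
    from choice[OF this] obtain \<S> where
      \<S>: "\<forall>j. finite (\<S> j) \<and> card (\<S> j) \<le> (m - j + 1) ^ K * 2 ^ 2 ^ K \<and> separates (\<S> j) m j K"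
      by (rule exE)
    define sep where "sep = (\<lambda>h. SOME S. S \<in> \<S> (lv h) \<and> Lo h \<subseteq> S \<and> Up h \<inter> S = {})"
    have sep: "sep h \<in> \<S> (lv h) \<and> Lo h \<subseteq> sep h \<and> Up h \<inter> sep h = {}" if h: "h \<in> ?H" for h
    proof -
      have "x div 2 ^ lv h \<noteq> y div 2 ^ lv h" if "x \<in> Lo h" "y \<in> Up h" for x y
      proof -
        have "x \<le> top h" unfolding top_def using fin_parts[OF h] that by (intro Max_ge)
        hence "x div 2 ^ lv h \<le> top h div 2 ^ lv h" by (rule div_le_mono)
        also have "top h div 2 ^ lv h < bot h div 2 ^ lv h"
          using lv[OF h] div_le_mono[OF less_imp_le[OF top_bot(1)[OF h]], of "2 ^ lv h"] by linarith
        also have "bot h \<le> y" unfolding bot_def using fin_parts[OF h] that by (intro Min_le)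
        hence "bot h div 2 ^ lv h \<le> y div 2 ^ lv h" by (rule div_le_mono)
        finally show ?thesis by simp
      qed
      moreover have "card (Lo h) * card (Up h) \<le> K"
        using Lo[OF h] card_Up[OF h] st mult_le_mono[of s r t r] by (simp add: K_def power2_eq_square)
      moreover have "Lo h \<subseteq> {..<2 ^ m}" "Up h \<subseteq> {..<2 ^ m}"
        using un[OF h] h unfolding n_def by blast+
      ultimately have "\<exists>S\<in>\<S> (lv h). Lo h \<subseteq> S \<and> Up h \<inter> S = {}"
        using \<S>[rule_format, of "lv h"] fin_parts[OF h] unfolding separates_def by simp
      hence "\<exists>S. S \<in> \<S> (lv h) \<and> Lo h \<subseteq> S \<and> Up h \<inter> S = {}" by blast
      from someI_ex[OF this] show ?thesis unfolding sep_def .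
    qed
    obtain \<mu>1 :: "nat set \<Rightarrow> nat" where \<mu>1: "\<And>h. h \<subseteq> {..<n} \<and> card h = s \<Longrightarrow> \<mu>1 h \<le> s * n ^ (s - 1)"
      "\<And>h h'. h \<subseteq> {..<n} \<and> card h = s \<and> h' \<subseteq> {..<n} \<and> card h' = s \<and> \<mu>1 h = \<mu>1 h' \<Longrightarrow> h = h' \<or> h \<inter> h' = {}"
      using matching_colouring[of s n] st by auto
    obtain \<mu>2 :: "nat set \<Rightarrow> nat" where \<mu>2: "\<And>h. h \<subseteq> {..<n} \<and> card h = t \<Longrightarrow> \<mu>2 h \<le> t * n ^ (t - 1)"
      "\<And>h h'. h \<subseteq> {..<n} \<and> card h = t \<and> h' \<subseteq> {..<n} \<and> card h' = t \<and> \<mu>2 h = \<mu>2 h' \<Longrightarrow> h = h' \<or> h \<inter> h' = {}"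
      using matching_colouring[of t n] st by auto
    have "\<forall>l. \<exists>\<chi>. bipartite_free_colouring b l \<chi>" using norm_graph_colouring[OF b] by (intro allI)
    from choice[OF this] obtain \<chi> where \<chi>: "\<forall>l. bipartite_free_colouring b l (\<chi> l)" by (rule exE)
    \<comment> \<open>Only positions within a block of length \<open>M j\<close> enter the last component, so that its range shrinks with the level.\<close>
    define M where "M = (\<lambda>j. 2 ^ Suc j :: nat)"
    define label where "label = (\<lambda>h. (lv h, sep h, \<mu>1 (Lo h), \<mu>2 (Up h), \<chi> (Suc (lv h)) (top h mod M (lv h)) (bot h mod M (lv h))))"
    define palette where "palette = (SIGMA j:{..<m}. \<S> j \<times> {..<s * n ^ (s - 1) + 1} \<times> {..<t * n ^ (t - 1) + 1} \<times> {..<4 * 2 ^ (Suc j div b) :: nat})"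
    have label_in: "label h \<in> palette" if h: "h \<in> ?H" for h
    proof -
      have "Lo h \<subseteq> {..<n} \<and> card (Lo h) = s" "Up h \<subseteq> {..<n} \<and> card (Up h) = t"
        using Lo[OF h] card_Up[OF h] un[OF h] h by blast+
      hence "\<mu>1 (Lo h) < s * n ^ (s - 1) + 1" "\<mu>2 (Up h) < t * n ^ (t - 1) + 1"
        using \<mu>1(1) \<mu>2(1) by (simp_all add: less_Suc_eq_le)
      moreover have "\<chi> (Suc (lv h)) (top h mod M (lv h)) (bot h mod M (lv h)) < 4 * 2 ^ (Suc (lv h) div b)"
        using \<chi> unfolding bipartite_free_colouring_def by (simp add: M_def)
      ultimately show ?thesis using lv[OF h] sep[OF h] by (simp add: label_def palette_def)
    qed
    have fin_palette: "finite palette" unfolding palette_def using \<S> by (intro finite_SigmaI) auto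
    have card_palette: "real (card palette) \<le> C * (2 ^ m) ^ (r - 2) * 2 powr (real m / real b)"
    proof -
      define N where "N = (\<lambda>j. (s * n ^ (s - 1) + 1) * ((t * n ^ (t - 1) + 1) * (4 * 2 ^ (Suc j div b))))"
      have "card palette = (\<Sum>j<m. card (\<S> j \<times> {..<s * n ^ (s - 1) + 1} \<times> {..<t * n ^ (t - 1) + 1} \<times> {..<4 * 2 ^ (Suc j div b) :: nat}))"
        unfolding palette_def using \<S> by (intro card_SigmaI) auto
      also have "\<dots> = (\<Sum>j<m. card (\<S> j) * N j)"
        by (simp only: card_cartesian_product card_lessThan N_def)
      finally have "real (card palette) = (\<Sum>j<m. real (card (\<S> j)) * real (N j))" by simp
      also have "\<dots> \<le> (\<Sum>j<m. (real (m - j + 1) ^ K * 2 ^ 2 ^ K) * ((16 * real r ^ 2) * real n ^ (r - 2) * 2 powr (real (j + 1) / real b)))"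
      proof (intro sum_mono mult_mono)
        fix j assume "j \<in> {..<m}"
        hence "real (card (\<S> j)) \<le> real ((m - j + 1) ^ K * 2 ^ 2 ^ K)" using \<S> by (intro of_nat_mono) blast
        thus "real (card (\<S> j)) \<le> real (m - j + 1) ^ K * 2 ^ 2 ^ K" by simp
        show "real (N j) \<le> (16 * real r ^ 2) * real n ^ (r - 2) * 2 powr (real (j + 1) / real b)"
          unfolding N_def using st b by (intro level_palette_size_le) (auto simp: n_def)
      qed auto
      also have "\<dots> = (\<Sum>j<m. (2 ^ 2 ^ K * (16 * real r ^ 2) * real n ^ (r - 2)) * (real (m - j + 1) ^ K * 2 powr (real (j + 1) / real b)))"
        by (intro sum.cong refl) (simp only: ac_simps)
      also have "\<dots> = (2 ^ 2 ^ K * (16 * real r ^ 2) * real n ^ (r - 2)) * (\<Sum>j<m. real (m - j + 1) ^ K * 2 powr (real (j + 1) / real b))"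
        by (simp only: sum_distrib_left)
      also have "\<dots> \<le> (2 ^ 2 ^ K * (16 * real r ^ 2) * real n ^ (r - 2)) * (Z * 2 powr (real m / real b))"
        using Z(2)[of m] by (intro mult_left_mono) auto
      also have "\<dots> = C * (2 ^ m) ^ (r - 2) * 2 powr (real m / real b)"
        by (simp add: C_def n_def)
      finally show ?thesis .
    qed
    obtain enc :: "nat \<times> nat set \<times> nat \<times> nat \<times> nat \<Rightarrow> nat" where
      enc: "enc ` palette \<subseteq> {..<card palette}" "inj_on enc palette"
      using card_le_inj[OF fin_palette, of "{..<card palette}"] by auto
    define col where "col = (\<lambda>h. enc (label h))"
    have "real (col h) < C * (2 ^ m) ^ (r - 2) * 2 powr (real m / real b)" if "h \<in> ?H" for h
    proof -
      have "col h < card palette" using enc(1) label_in[OF that] by (auto simp: col_def)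
      hence "real (col h) < real (card palette)" by simp
      thus ?thesis using card_palette by linarith
    qed
    moreover have "\<not> Berge_embedding a b E f \<psi>" if E: "E \<subseteq> ?H" and mono: "\<And>h. h \<in> E \<Longrightarrow> col h = i" for E i f \<psi>
    proof
      assume emb: "Berge_embedding a b E f \<psi>"
      have \<psi>: "\<psi> i j \<in> E" if "i < a" "j \<in> {a..<a + b}" for i j
        using emb that unfolding Berge_embedding_def by blast
      define h0 where "h0 = \<psi> 0 a"
      have h0: "h0 \<in> E" unfolding h0_def using a2 b by (intro \<psi>) auto
      have lab: "label h = label h0" if "h \<in> E" for h
        using inj_onD[OF enc(2), of "label h" "label h0"] label_in mono[OF that] mono[OF h0] E that h0
        unfolding col_def by (metis subsetD)
      define j where "j = lv h0"
      define S where "S = sep h0"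
      define c where "c = \<chi> (Suc j) (top h0 mod M j) (bot h0 mod M j)"
      have lv_E: "lv h = j" and sep_E: "sep h = S" and \<mu>_E: "\<mu>1 (Lo h) = \<mu>1 (Lo h0)" "\<mu>2 (Up h) = \<mu>2 (Up h0)"
        if "h \<in> E" for h using lab[OF that] by (simp_all add: label_def j_def S_def)
      have \<chi>_E: "\<chi> (Suc j) (top h mod M j) (bot h mod M j) = c" if "h \<in> E" for h
        using lab[OF that] lv_E[OF that] by (simp add: label_def j_def c_def)
      have div_E: "top h div M j = bot h div M j" if "h \<in> E" for h
        using lv[of h] lv_E[OF that] E that by (auto simp: M_def)
      have Lo_disj: "Lo h = Lo h'" if "h \<in> E" "h' \<in> E" "Lo h \<inter> Lo h' \<noteq> {}" for h h'
      proof -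
        have hh: "h \<in> ?H" "h' \<in> ?H" using that E by blast+
        have "Lo h \<subseteq> {..<n} \<and> card (Lo h) = s \<and> Lo h' \<subseteq> {..<n} \<and> card (Lo h') = s \<and> \<mu>1 (Lo h) = \<mu>1 (Lo h')"
          using Lo[OF hh(1)] Lo[OF hh(2)] hh \<mu>_E(1) that by auto
        from \<mu>1(2)[OF this] show ?thesis using that(3) by blast
      qed
      have Up_disj: "Up h = Up h'" if "h \<in> E" "h' \<in> E" "Up h \<inter> Up h' \<noteq> {}" for h h'
      proof -
        have hh: "h \<in> ?H" "h' \<in> ?H" using that E by blast+
        have "Up h \<subseteq> {..<n} \<and> card (Up h) = t \<and> Up h' \<subseteq> {..<n} \<and> card (Up h') = t \<and> \<mu>2 (Up h) = \<mu>2 (Up h')"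
          using card_Up[OF hh(1)] card_Up[OF hh(2)] un[OF hh(1)] un[OF hh(2)] hh \<mu>_E(2) that by auto
        from \<mu>2(2)[OF this] show ?thesis using that(3) by blast
      qed
      have "\<exists>g. inj_on g {..<a} \<and> inj_on g {a..<a + b} \<and>
        ((\<forall>i<a. \<forall>j\<in>{a..<a + b}. Lo (\<psi> i j) = g i \<and> Up (\<psi> i j) = g j) \<or>
         (\<forall>i<a. \<forall>j\<in>{a..<a + b}. Lo (\<psi> i j) = g j \<and> Up (\<psi> i j) = g i))"
      proof (rule embedding_between_groups[where S = S, OF _ _ Lo_disj Up_disj emb a2 b])
        fix h assume h: "h \<in> E"
        hence hH: "h \<in> ?H" using E by blast
        show "Lo h \<union> Up h = h \<and> Lo h \<subseteq> S \<and> Up h \<inter> S = {}"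
          using un[OF hH] sep[OF hH] sep_E[OF h] by simp
        show "finite h \<and> card (Lo h) < a + b \<and> card (Up h) < a + b"
          using finH[OF hH] Lo[OF hH] card_Up[OF hH] st by simp
      qed
      then obtain g where g: "inj_on g {..<a}" "inj_on g {a..<a + b}"
        "(\<forall>i<a. \<forall>j\<in>{a..<a + b}. Lo (\<psi> i j) = g i \<and> Up (\<psi> i j) = g j) \<or>
         (\<forall>i<a. \<forall>j\<in>{a..<a + b}. Lo (\<psi> i j) = g j \<and> Up (\<psi> i j) = g i)" by blast
      \<comment> \<open>The core vertices are replaced by representatives \<open>p i\<close> and \<open>q k\<close> of their parts; joined representatives share a block, so all of them do.\<close>
      have no_copy: False
        if parts: "\<And>i k. i < a \<Longrightarrow> k \<in> {a..<a + b} \<Longrightarrow> A (\<psi> i k) = g i \<and> B (\<psi> i k) = g k"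
          and inj_A: "\<And>h h'. h \<in> E \<Longrightarrow> h' \<in> E \<Longrightarrow> u (A h) = u (A h') \<Longrightarrow> A h = A h'"
          and inj_B: "\<And>h h'. h \<in> E \<Longrightarrow> h' \<in> E \<Longrightarrow> v (B h) = v (B h') \<Longrightarrow> B h = B h'"
          and block: "\<And>h. h \<in> E \<Longrightarrow> u (A h) div M j = v (B h) div M j"
          and col: "(\<forall>h\<in>E. \<chi> (Suc j) (u (A h) mod M j) (v (B h) mod M j) = c) \<or>
            (\<forall>h\<in>E. \<chi> (Suc j) (v (B h) mod M j) (u (A h) mod M j) = c)"
        for A B :: "nat set \<Rightarrow> nat set" and u v :: "nat set \<Rightarrow> nat"
      proof -
        define p q where "p = (\<lambda>i. u (g i))" and "q = (\<lambda>k. v (g k))"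
        have 0: "0 < a" "a \<in> {a..<a + b}" using a2 b by auto
        have p: "u (A (\<psi> i k)) = p i" and q: "v (B (\<psi> i k)) = q k"
          if "i < a" "k \<in> {a..<a + b}" for i k using parts[OF that] by (simp_all add: p_def q_def)
        have pq: "p i div M j = q k div M j" if "i < a" "k \<in> {a..<a + b}" for i k
          using block[OF \<psi>[OF that]] p[OF that] q[OF that] by simp
        have dp: "p i div M j = p 0 div M j" if "i < a" for i using pq[OF that 0(2)] pq[OF 0] by simp
        have dq: "q k div M j = p 0 div M j" if "k \<in> {a..<a + b}" for k using pq[OF 0(1) that] by simp
        have ip: "inj_on (\<lambda>i. p i mod M j) {..<a}"
        proof (rule inj_onI)
          fix i i' assume i: "i \<in> {..<a}" "i' \<in> {..<a}" "p i mod M j = p i' mod M j"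
          have ii: "i < a" "i' < a" using i by auto
          have "p i = p i'" using dp[OF ii(1)] dp[OF ii(2)] i(3) by (metis div_mod_decomp)
          hence "A (\<psi> i a) = A (\<psi> i' a)" using p[OF _ 0(2)] ii 0(2) by (intro inj_A \<psi>) simp_all
          hence "g i = g i'" using parts[OF ii(1) 0(2)] parts[OF ii(2) 0(2)] by simp
          thus "i = i'" using inj_onD[OF g(1)] i by blast
        qed
        have iq: "inj_on (\<lambda>k. q k mod M j) {a..<a + b}"
        proof (rule inj_onI)
          fix k k' assume k: "k \<in> {a..<a + b}" "k' \<in> {a..<a + b}" "q k mod M j = q k' mod M j"
          have "q k = q k'" using dq[OF k(1)] dq[OF k(2)] k(3) by (metis div_mod_decomp)
          hence "B (\<psi> 0 k) = B (\<psi> 0 k')" using q[OF 0(1)] k 0(1) by (intro inj_B \<psi>) simp_all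
          hence "g k = g k'" using parts[OF 0(1) k(1)] parts[OF 0(1) k(2)] by simp
          thus "k = k'" using inj_onD[OF g(2)] k by blast
        qed
        have "card ((\<lambda>i. p i mod M j) ` {..<a}) \<le> fact (b - 1)"
        proof (rule bipartite_free_colouringD[where Y = "(\<lambda>k. q k mod M j) ` {a..<a + b}" and c = c])
          show "bipartite_free_colouring b (Suc j) (\<chi> (Suc j))" using \<chi> by blast
          show "card ((\<lambda>k. q k mod M j) ` {a..<a + b}) = b" using card_image[OF iq] by simp
          have "\<psi> i k \<in> E \<and> u (A (\<psi> i k)) = p i \<and> v (B (\<psi> i k)) = q k"
            if "i \<in> {..<a}" "k \<in> {a..<a + b}" for i k
            using \<psi>[of i k] p[of i k] q[of i k] that by simp
          hence "(\<forall>i\<in>{..<a}. \<forall>k\<in>{a..<a + b}. \<chi> (Suc j) (p i mod M j) (q k mod M j) = c) \<or>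
            (\<forall>i\<in>{..<a}. \<forall>k\<in>{a..<a + b}. \<chi> (Suc j) (q k mod M j) (p i mod M j) = c)"
            using col by metis
          thus "(\<forall>x\<in>(\<lambda>i. p i mod M j) ` {..<a}. \<forall>y\<in>(\<lambda>k. q k mod M j) ` {a..<a + b}. \<chi> (Suc j) x y = c) \<or>
            (\<forall>x\<in>(\<lambda>i. p i mod M j) ` {..<a}. \<forall>y\<in>(\<lambda>k. q k mod M j) ` {a..<a + b}. \<chi> (Suc j) y x = c)"
            by (simp only: ball_simps)
        qed (auto simp: M_def)
        thus False using card_image[OF ip] a by simp
      qed
      have top_eq: "Lo h = Lo h'" if "h \<in> E" "h' \<in> E" "Max (Lo h) = Max (Lo h')" for h h'
        using Lo_disj[OF that(1,2)] top_in[of h] top_in[of h'] that E by (auto simp: top_def)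
      have bot_eq: "Up h = Up h'" if "h \<in> E" "h' \<in> E" "Min (Up h) = Min (Up h')" for h h'
        using Up_disj[OF that(1,2)] bot_in[of h] bot_in[of h'] that E by (auto simp: bot_def)
      note div_E' = div_E[unfolded top_def bot_def] and \<chi>_E' = \<chi>_E[unfolded top_def bot_def]
      show False
        using g(3)
      proof
        assume G: "\<forall>i<a. \<forall>j\<in>{a..<a + b}. Lo (\<psi> i j) = g i \<and> Up (\<psi> i j) = g j"
        show False
        proof (rule no_copy[of Lo Up Max Min])
          show "Lo (\<psi> i k) = g i \<and> Up (\<psi> i k) = g k" if "i < a" "k \<in> {a..<a + b}" for i k
            using G that by blast
          show "Lo h = Lo h'" if "h \<in> E" "h' \<in> E" "Max (Lo h) = Max (Lo h')" for h h' by (rule top_eq[OF that])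
          show "Up h = Up h'" if "h \<in> E" "h' \<in> E" "Min (Up h) = Min (Up h')" for h h' by (rule bot_eq[OF that])
          show "Max (Lo h) div M j = Min (Up h) div M j" if "h \<in> E" for h by (rule div_E'[OF that])
        qed (use \<chi>_E' in blast)
      next
        assume G: "\<forall>i<a. \<forall>j\<in>{a..<a + b}. Lo (\<psi> i j) = g j \<and> Up (\<psi> i j) = g i"
        show False
        proof (rule no_copy[of Up Lo Min Max])
          show "Up (\<psi> i k) = g i \<and> Lo (\<psi> i k) = g k" if "i < a" "k \<in> {a..<a + b}" for i k
            using G that by blast
          show "Lo h = Lo h'" if "h \<in> E" "h' \<in> E" "Max (Lo h) = Max (Lo h')" for h h' by (rule top_eq[OF that])
          show "Up h = Up h'" if "h \<in> E" "h' \<in> E" "Min (Up h) = Min (Up h')" for h h' by (rule bot_eq[OF that])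
          show "Min (Up h) div M j = Max (Lo h) div M j" if "h \<in> E" for h by (rule sym[OF div_E'[OF that]])
        qed (use \<chi>_E' in blast)
      qed
    qed
    ultimately show ?thesis unfolding n_def by (intro exI[of _ col]) blast
  qed
  thus ?thesis using C by blast
qed

section \<open>Counting edges in Berge-free hypergraphs\<close>

text \<open>An edge joins \<open>M\<close> whenever it still contains an unused pair at the time it is considered; pairs used
at that time stay used.\<close>

lemma greedy_representatives:
  assumes "finite E"
  shows "\<exists>M p. M \<subseteq> E \<and> inj_on p M \<and> (\<forall>h\<in>M. p h \<subseteq> h \<and> card (p h) = 2) \<and>
     (\<forall>h\<in>E - M. \<forall>e. e \<subseteq> h \<and> card e = 2 \<longrightarrow> e \<in> p ` M)"
  using assms
proof (induction rule: finite_induct)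
  case empty
  show ?case by (rule exI[of _ "{}"]) simp
next
  case (insert h E)
  obtain M p where M: "M \<subseteq> E" "inj_on p M" "\<forall>h\<in>M. p h \<subseteq> h \<and> card (p h) = 2"
    "\<forall>h\<in>E - M. \<forall>e. e \<subseteq> h \<and> card e = 2 \<longrightarrow> e \<in> p ` M"
    using insert.IH by (elim exE conjE)
  show ?case
  proof (cases "\<forall>e. e \<subseteq> h \<and> card e = 2 \<longrightarrow> e \<in> p ` M")
    case True
    have "M \<subseteq> insert h E" using M(1) by blast
    moreover have "\<forall>g\<in>insert h E - M. \<forall>e. e \<subseteq> g \<and> card e = 2 \<longrightarrow> e \<in> p ` M" using M(4) True by blast
    ultimately show ?thesis using M(2,3) by (intro exI[of _ M] exI[of _ p] conjI)
  next
    case False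
    then obtain e where e: "e \<subseteq> h" "card e = 2" "e \<notin> p ` M" by blast
    have hM: "h \<notin> M" using M(1) insert.hyps by blast
    define p' where "p' = p(h := e)"
    have p': "p' h = e" "\<And>g. g \<in> M \<Longrightarrow> p' g = p g" using hM by (auto simp: p'_def)
    have im: "p' ` M = p ` M" using p'(2) by (intro image_cong) auto
    have "inj_on p' (insert h M)"
      using M(2) e(3) im hM p' by (simp add: inj_on_insert) (metis (no_types, lifting) inj_on_cong)
    moreover have "\<forall>g\<in>insert h M. p' g \<subseteq> g \<and> card (p' g) = 2" using M(3) e p' by auto
    moreover have "\<forall>g\<in>insert h E - insert h M. \<forall>e. e \<subseteq> g \<and> card e = 2 \<longrightarrow> e \<in> p' ` insert h M"
    proof (intro ballI allI impI)
      fix g e' assume g: "g \<in> insert h E - insert h M" and e': "e' \<subseteq> g \<and> card e' = 2"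
      have "g \<in> E - M" using g by blast
      hence "e' \<in> p ` M" using M(4) e' by blast
      thus "e' \<in> p' ` insert h M" unfolding im[symmetric] by blast
    qed
    moreover have "insert h M \<subseteq> insert h E" using M(1) by blast
    ultimately show ?thesis by (intro exI[of _ "insert h M"] exI[of _ p'] conjI)
  qed
qed

definition graph_cliques :: "nat \<Rightarrow> nat \<Rightarrow> nat set set \<Rightarrow> nat set set" where
  "graph_cliques n r G = {h. h \<subseteq> {..<n} \<and> card h = r \<and> (\<forall>e. e \<subseteq> h \<and> card e = 2 \<longrightarrow> e \<in> G)}"

lemma finite_graph_cliques: "finite (graph_cliques n r G)"
  by (rule finite_subset[of _ "Pow {..<n}"]) (auto simp: graph_cliques_def)

text \<open>The pairs chosen by the greedy procedure form \<open>G\<close>. The edges that chose the pairs of a copy of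
\<open>K\<^sub>a\<^sub>,\<^sub>b\<close> in \<open>G\<close> are distinct, so they would form a Berge copy.\<close>

lemma Berge_free_card_le:
  assumes E: "E \<subseteq> {h. h \<subseteq> {..<n} \<and> card h = r}" and free: "\<And>f \<psi>. \<not> Berge_embedding a b E f \<psi>"
  shows "\<exists>G. G \<subseteq> {e. e \<subseteq> {..<n} \<and> card e = 2} \<and> \<not> complete_bipartite_in a b G \<and>
     card E \<le> card G + card (graph_cliques n r G)"
proof -
  have finE: "finite E" by (rule finite_subset[OF E]) simp
  obtain M p where M: "M \<subseteq> E" "inj_on p M" "\<forall>h\<in>M. p h \<subseteq> h \<and> card (p h) = 2"
    "\<forall>h\<in>E - M. \<forall>e. e \<subseteq> h \<and> card e = 2 \<longrightarrow> e \<in> p ` M"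
    using greedy_representatives[OF finE] by (elim exE conjE)
  define G where "G = p ` M"
  have 1: "G \<subseteq> {e. e \<subseteq> {..<n} \<and> card e = 2}" using M(1,3) E unfolding G_def by blast
  have 2: "\<not> complete_bipartite_in a b G"
  proof
    assume "complete_bipartite_in a b G"
    then obtain S T where ST: "card S = a" "card T = b" "finite S" "finite T" "S \<inter> T = {}"
      "\<forall>x\<in>S. \<forall>y\<in>T. {x, y} \<in> G" unfolding complete_bipartite_in_def by blast
    obtain f1 where f1: "bij_betw f1 {..<a} S"
      using finite_same_card_bij[of "{..<a}" S] ST by auto
    obtain f2 where f2: "bij_betw f2 {a..<a + b} T"
      using finite_same_card_bij[of "{a..<a + b}" T] ST by auto
    define f where "f = (\<lambda>i. if i < a then f1 i else f2 i)"
    have f_S: "f i \<in> S" if "i < a" for i using that f1 by (auto simp: f_def bij_betw_def)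
    have f_T: "f j \<in> T" if "j \<in> {a..<a + b}" for j using that f2 by (auto simp: f_def bij_betw_def)
    have inj1: "inj_on f {..<a}" using f1 by (auto simp: f_def bij_betw_def inj_on_def)
    have inj2: "inj_on f {a..<a + b}" using f2 by (auto simp: f_def bij_betw_def inj_on_def)
    have inj_f: "inj_on f {..<a + b}"
    proof (rule inj_onI)
      fix x y assume xy: "x \<in> {..<a + b}" "y \<in> {..<a + b}" "f x = f y"
      have T: "f z \<in> T" if "z \<in> {..<a + b}" "\<not> z < a" for z using f_T[of z] that by simp
      consider "x < a" "y < a" | "\<not> x < a" "\<not> y < a" | "x < a" "\<not> y < a" | "\<not> x < a" "y < a" by blast
      thus "x = y"
      proof cases
        case 1
        thus ?thesis using inj_onD[OF inj1 xy(3)] by simp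
      next
        case 2
        thus ?thesis using inj_onD[OF inj2 xy(3)] xy(1,2) by simp
      next
        case 3
        thus ?thesis using f_S[of x] T[OF xy(2)] xy(3) ST(5) by auto
      next
        case 4
        thus ?thesis using f_S[of y] T[OF xy(1)] xy(3) ST(5) by auto
      qed
    qed
    define \<psi> where "\<psi> = (\<lambda>i j. inv_into M p {f i, f j})"
    have e: "{f i, f j} \<in> p ` M" if "i < a" "j \<in> {a..<a + b}" for i j
      using ST(6) f_S[OF that(1)] f_T[OF that(2)] unfolding G_def by blast
    have \<psi>_M: "\<psi> i j \<in> M" and p_\<psi>: "p (\<psi> i j) = {f i, f j}" if "i < a" "j \<in> {a..<a + b}" for i j
      unfolding \<psi>_def using inv_into_into[OF e[OF that]] f_inv_into_f[OF e[OF that]] by simp_all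
    have "Berge_embedding a b E f \<psi>"
      unfolding Berge_embedding_def
    proof (intro conjI allI impI ballI inj_f)
      fix i j assume ij: "i < a" "j \<in> {a..<a + b}"
      show "\<psi> i j \<in> E" using \<psi>_M[OF ij] M(1) by blast
      have "{f i, f j} \<subseteq> \<psi> i j" using M(3) \<psi>_M[OF ij] p_\<psi>[OF ij] by metis
      thus "f i \<in> \<psi> i j" "f j \<in> \<psi> i j" by blast+
    next
      show "inj_on (\<lambda>(i, j). \<psi> i j) ({..<a} \<times> {a..<a + b})"
      proof (rule inj_onI)
        fix x y assume x: "x \<in> {..<a} \<times> {a..<a + b}" and y: "y \<in> {..<a} \<times> {a..<a + b}"
          and eq: "(\<lambda>(i, j). \<psi> i j) x = (\<lambda>(i, j). \<psi> i j) y"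
        obtain i j i' j' where xy: "x = (i, j)" "y = (i', j')" by (metis prod.exhaust)
        have ij: "i < a" "j \<in> {a..<a + b}" "i' < a" "j' \<in> {a..<a + b}" using x y xy by auto
        have "\<psi> i j = \<psi> i' j'" using eq xy by simp
        hence "{f i, f j} = {f i', f j'}" using p_\<psi>[OF ij(1,2)] p_\<psi>[OF ij(3,4)] by metis
        moreover have "f i \<noteq> f j'" "f j \<noteq> f i'" 
          using f_S[OF ij(1)] f_S[OF ij(3)] f_T[OF ij(2)] f_T[OF ij(4)] ST(5) by auto
        ultimately have "f i = f i'" "f j = f j'" by (auto simp: doubleton_eq_iff)
        hence "i = i'" "j = j'" using inj_onD[OF inj1, of i i'] inj_onD[OF inj2, of j j'] ij by auto
        thus "x = y" using xy by simp
      qed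
    qed
    thus False using free by blast
  qed
  have "E - M \<subseteq> graph_cliques n r G"
  proof
    fix h assume h: "h \<in> E - M"
    hence "h \<subseteq> {..<n} \<and> card h = r" using E by blast
    moreover have "\<forall>e. e \<subseteq> h \<and> card e = 2 \<longrightarrow> e \<in> G" using bspec[OF M(4) h] unfolding G_def .
    ultimately show "h \<in> graph_cliques n r G" by (simp add: graph_cliques_def)
  qed
  hence "card (E - M) \<le> card (graph_cliques n r G)" by (intro card_mono finite_graph_cliques)
  moreover have "card E = card M + card (E - M)"
    using M(1) finE by (metis card_Diff_subset card_mono finite_subset le_add_diff_inverse)
  moreover have "card M = card G" unfolding G_def using card_image[OF M(2)] by simp
  ultimately have 3: "card E \<le> card G + card (graph_cliques n r G)" by simp
  show ?thesis using 1 2 3 by blast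
qed

lemma card_graph_cliques_le:
  assumes "r \<ge> 2" "finite G"
    and "\<And>e. e \<in> G \<Longrightarrow> card {h \<in> graph_cliques n r G. e \<subseteq> h} \<le> N"
  shows "card (graph_cliques n r G) \<le> card G * N"
proof -
  have "graph_cliques n r G \<subseteq> (\<Union>e\<in>G. {h \<in> graph_cliques n r G. e \<subseteq> h})"
  proof
    fix h assume h: "h \<in> graph_cliques n r G"
    hence "2 \<le> card h" using assms(1) by (simp add: graph_cliques_def)
    then obtain e where e: "e \<subseteq> h" "card e = 2" by (metis obtain_subset_with_card_n)
    hence "e \<in> G" using h by (auto simp: graph_cliques_def)
    thus "h \<in> (\<Union>e\<in>G. {h \<in> graph_cliques n r G. e \<subseteq> h})" using e h by blast
  qed
  hence "card (graph_cliques n r G) \<le> card (\<Union>e\<in>G. {h \<in> graph_cliques n r G. e \<subseteq> h})"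
    using assms(2) finite_graph_cliques by (intro card_mono finite_UN_I) auto
  also have "\<dots> \<le> (\<Sum>e\<in>G. card {h \<in> graph_cliques n r G. e \<subseteq> h})" by (rule card_UN_le[OF assms(2)])
  also have "\<dots> \<le> (\<Sum>e\<in>G. N)" using assms(3) by (rule sum_mono)
  finally show ?thesis by simp
qed

lemma card_cliques_containing_edge_le:
  assumes "card e = 2"
  shows "card {h \<in> graph_cliques n r G. e \<subseteq> h} \<le> n ^ (r - 2)"
proof -
  have "inj_on (\<lambda>h. h - e) {h \<in> graph_cliques n r G. e \<subseteq> h}" by (auto simp: inj_on_def)
  moreover have "(\<lambda>h. h - e) ` {h \<in> graph_cliques n r G. e \<subseteq> h} \<subseteq> {h. h \<subseteq> {..<n} \<and> card h = r - 2}"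
  proof
    fix g assume "g \<in> (\<lambda>h. h - e) ` {h \<in> graph_cliques n r G. e \<subseteq> h}"
    then obtain h where h: "h \<in> graph_cliques n r G" "e \<subseteq> h" "g = h - e" by blast
    have "finite e" using assms by (metis card.infinite zero_neq_numeral)
    thus "g \<in> {h. h \<subseteq> {..<n} \<and> card h = r - 2}"
      using h assms by (auto simp: graph_cliques_def card_Diff_subset)
  qed
  moreover have "finite {h. h \<subseteq> {..<n} \<and> card h = r - 2}" by simp
  ultimately have "card {h \<in> graph_cliques n r G. e \<subseteq> h} \<le> card {h. h \<subseteq> {..<n} \<and> card h = r - 2}"
    by (rule card_inj_on_le)
  also have "\<dots> = n choose (r - 2)" using n_subsets[of "{..<n}" "r - 2"] by simp
  also have "\<dots> \<le> n ^ (r - 2)" by (cases "r - 2 \<le> n") (auto simp: binomial_le_pow binomial_eq_0)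
  finally show ?thesis .
qed

text \<open>The other vertices of such a clique belong to the common neighbourhood of the ends of \<open>e\<close>, which has
fewer than \<open>a\<close> elements.\<close>

lemma card_cliques_containing_edge_le_power:
  assumes G: "G \<subseteq> {e. e \<subseteq> {..<n} \<and> card e = 2}" and free: "\<not> complete_bipartite_in a 2 G" and e: "e \<in> G"
  shows "card {h \<in> graph_cliques n r G. e \<subseteq> h} \<le> 2 ^ a"
proof -
  obtain u v where uv: "e = {u, v}" "u \<noteq> v" using G e by (auto simp: card_2_iff)
  define W where "W = {w. {w, u} \<in> G \<and> {w, v} \<in> G}"
  have W_n: "W \<subseteq> {..<n}" using G by (auto simp: W_def)
  hence finW: "finite W" using finite_subset by blast
  have no: "{x, x} \<notin> G" for x using G by auto
  have "card W < a"
  proof (rule ccontr)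
    assume "\<not> card W < a"
    then obtain S where S: "S \<subseteq> W" "card S = a" "finite S" by (metis not_less obtain_subset_with_card_n)
    have "card {u, v} = 2" using uv by simp
    moreover have "S \<inter> {u, v} = {}" using S(1) no by (auto simp: W_def)
    moreover have "\<forall>x\<in>S. \<forall>y\<in>{u, v}. {x, y} \<in> G" using S(1) by (auto simp: W_def)
    ultimately show False using free S unfolding complete_bipartite_in_def by blast
  qed
  have "inj_on (\<lambda>h. h - e) {h \<in> graph_cliques n r G. e \<subseteq> h}" by (auto simp: inj_on_def)
  moreover have "(\<lambda>h. h - e) ` {h \<in> graph_cliques n r G. e \<subseteq> h} \<subseteq> Pow W"
  proof
    fix g assume "g \<in> (\<lambda>h. h - e) ` {h \<in> graph_cliques n r G. e \<subseteq> h}"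
    then obtain h where h: "h \<in> graph_cliques n r G" "e \<subseteq> h" "g = h - e" by blast
    have "w \<in> W" if "w \<in> g" for w
    proof -
      have "{w, u} \<subseteq> h" "{w, v} \<subseteq> h" "w \<noteq> u" "w \<noteq> v" using that h uv by auto
      moreover have "card {w, u} = 2" "card {w, v} = 2" using calculation by auto
      ultimately show ?thesis using h(1) unfolding graph_cliques_def W_def by blast
    qed
    thus "g \<in> Pow W" by blast
  qed
  ultimately have "card {h \<in> graph_cliques n r G. e \<subseteq> h} \<le> card (Pow W)"
    using finW by (intro card_inj_on_le) auto
  also have "\<dots> = 2 ^ card W" using finW by (rule card_Pow)
  also have "\<dots> \<le> 2 ^ a" using \<open>card W < a\<close> by (intro power_increasing) auto
  finally show ?thesis .
qed

lemma graph_cliques_empty: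
  assumes "\<not> complete_bipartite_in a b G" "a + b \<le> r"
  shows "graph_cliques n r G = {}"
proof (rule ccontr)
  assume "graph_cliques n r G \<noteq> {}"
  then obtain h where h: "h \<subseteq> {..<n}" "card h = r" "\<forall>e. e \<subseteq> h \<and> card e = 2 \<longrightarrow> e \<in> G"
    by (auto simp: graph_cliques_def)
  have "a \<le> card h" using h(2) assms(2) by simp
  then obtain S where S: "S \<subseteq> h" "card S = a" "finite S" by (metis obtain_subset_with_card_n)
  have "b \<le> card (h - S)" using S h(2) assms(2) by (simp add: card_Diff_subset)
  then obtain T where T: "T \<subseteq> h - S" "card T = b" "finite T" by (metis obtain_subset_with_card_n)
  have "{x, y} \<in> G" if "x \<in> S" "y \<in> T" for x y
  proof -
    have "x \<noteq> y" using that T(1) by blast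
    hence "card {x, y} = 2" by simp
    moreover have "{x, y} \<subseteq> h" using that S(1) T(1) by blast
    ultimately show ?thesis using h(3) by blast
  qed
  moreover have "S \<inter> T = {}" using T(1) by blast
  ultimately show False using assms(1) S T unfolding complete_bipartite_in_def by blast
qed

text \<open>Double counting of the vertices together with a set of \<open>b\<close> neighbours: every set of size \<open>b\<close> has
fewer than \<open>a\<close> common neighbours.\<close>

lemma sum_choose_degrees_le:
  assumes G: "G \<subseteq> {e. e \<subseteq> {..<n} \<and> card e = 2}" and free: "\<not> complete_bipartite_in a b G"
  shows "(\<Sum>v<n. card {w. {v, w} \<in> G} choose b) \<le> a * n ^ b"
proof -
  define nb where "nb = (\<lambda>v. {w. {v, w} \<in> G})"
  have nb_n: "nb v \<subseteq> {..<n}" for v using G by (auto simp: nb_def)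
  hence fin: "finite (nb v)" for v using finite_subset by blast
  have no: "{x, x} \<notin> G" for x using G by auto
  define Bs where "Bs = {B. B \<subseteq> {..<n} \<and> card B = b}"
  have finB: "finite Bs" by (simp add: Bs_def)
  have "(\<Sum>v<n. card (nb v) choose b) = (\<Sum>v<n. card {B \<in> Bs. B \<subseteq> nb v})"
  proof (intro sum.cong refl)
    fix v
    have "{B \<in> Bs. B \<subseteq> nb v} = {B. B \<subseteq> nb v \<and> card B = b}" using nb_n[of v] by (auto simp: Bs_def)
    thus "card (nb v) choose b = card {B \<in> Bs. B \<subseteq> nb v}" using n_subsets[OF fin] by simp
  qed
  also have "\<dots> = (\<Sum>v<n. \<Sum>B\<in>Bs. if B \<subseteq> nb v then 1 else 0)"
    using finB by (intro sum.cong refl) (simp add: sum.If_cases Int_def)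
  also have "\<dots> = (\<Sum>B\<in>Bs. \<Sum>v<n. if B \<subseteq> nb v then 1 else 0)" by (rule sum.swap)
  also have "\<dots> = (\<Sum>B\<in>Bs. card {v \<in> {..<n}. B \<subseteq> nb v})"
    by (intro sum.cong refl) (simp add: sum.If_cases Int_def)
  also have "\<dots> \<le> (\<Sum>B\<in>Bs. a)"
  proof (rule sum_mono, rule ccontr)
    fix B assume B: "B \<in> Bs" and "\<not> card {v \<in> {..<n}. B \<subseteq> nb v} \<le> a"
    hence le: "a \<le> card {v \<in> {..<n}. B \<subseteq> nb v}" by simp
    obtain S where S: "S \<subseteq> {v \<in> {..<n}. B \<subseteq> nb v}" "card S = a" "finite S"
      by (rule obtain_subset_with_card_n[OF le])
    have "finite B" "card B = b" using B finite_subset by (auto simp: Bs_def)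
    moreover have edge: "{x, y} \<in> G" if "x \<in> S" "y \<in> B" for x y using S(1) that by (auto simp: nb_def)
    moreover have "S \<inter> B = {}" using edge no by blast
    ultimately show False using free S(2,3) unfolding complete_bipartite_in_def by blast
  qed
  also have "\<dots> = a * (n choose b)" using n_subsets[of "{..<n}" b] by (simp add: Bs_def)
  also have "\<dots> \<le> a * n ^ b" by (cases "b \<le> n") (auto simp: binomial_le_pow binomial_eq_0)
  finally show ?thesis by (simp add: nb_def)
qed

text \<open>Degrees up to \<open>D = n powr (1 - 1 / b)\<close> contribute at most \<open>n * D\<close>. A larger degree \<open>d\<close> is at most
\<open>d ^ b / D ^ (b - 1)\<close>, and \<open>d ^ b\<close> is at most \<open>b ^ b\<close> times the number of sets of \<open>b\<close> neighbours, which is bounded by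
\<open>sum_choose_degrees_le\<close>. The constant \<open>b\<close> absorbs the degrees below \<open>b\<close>.\<close>

theorem Kovari_Sos_Turan:
  assumes G: "G \<subseteq> {e. e \<subseteq> {..<n} \<and> card e = 2}" and free: "\<not> complete_bipartite_in a b G"
    and b: "b \<ge> 1" and n: "n \<ge> 1"
  shows "real (card G) \<le> (1 + real b + real b ^ b * real a) * real n powr (2 - 1 / real b)"
proof -
  define nb where "nb = (\<lambda>v. {w. {v, w} \<in> G})"
  have nb_n: "nb v \<subseteq> {..<n}" for v using G by (auto simp: nb_def)
  hence fin: "finite (nb v)" for v using finite_subset by blast
  define d where "d = (\<lambda>v. real (card (nb v)))"
  define D where "D = real n powr (1 - 1 / real b)"
  have D: "D > 0" using n by (simp add: D_def)
  have "G \<subseteq> (\<Union>v\<in>{..<n}. (\<lambda>w. {v, w}) ` nb v)"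
  proof
    fix e assume e: "e \<in> G"
    then obtain v w where vw: "e = {v, w}" using G by (auto simp: card_2_iff)
    hence "v \<in> {..<n}" "w \<in> nb v" using e G by (auto simp: nb_def)
    thus "e \<in> (\<Union>v\<in>{..<n}. (\<lambda>w. {v, w}) ` nb v)" using vw by blast
  qed
  hence "card G \<le> card (\<Union>v\<in>{..<n}. (\<lambda>w. {v, w}) ` nb v)" using fin by (intro card_mono) auto
  also have "\<dots> \<le> (\<Sum>v<n. card ((\<lambda>w. {v, w}) ` nb v))" by (rule card_UN_le) simp
  also have "\<dots> \<le> (\<Sum>v<n. card (nb v))" using fin by (intro sum_mono card_image_le)
  finally have "real (card G) \<le> real (\<Sum>v<n. card (nb v))" by (rule of_nat_mono)
  hence 1: "real (card G) \<le> (\<Sum>v<n. d v)" by (simp add: d_def)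
  have bound: "d v \<le> D + real b + real b ^ b / D ^ (b - 1) * real (card (nb v) choose b)" for v
  proof (cases "d v \<le> D \<or> card (nb v) < b")
    case True
    have "0 \<le> real b ^ b / D ^ (b - 1) * real (card (nb v) choose b)" using D by simp
    moreover have "d v \<le> D + real b" using True D by (auto simp: d_def)
    ultimately show ?thesis by linarith
  next
    case False
    hence dv: "D \<le> d v" "b \<le> card (nb v)" by auto
    have dpos: "d v > 0" using D dv by linarith
    have "(d v / real b) ^ b \<le> real (card (nb v) choose b)"
      unfolding d_def by (rule binomial_ge_n_over_k_pow_k[OF dv(2)])
    hence c: "d v ^ b \<le> real b ^ b * real (card (nb v) choose b)"
      using b by (simp add: power_divide field_simps)
    have "d v * D ^ (b - 1) \<le> d v * d v ^ (b - 1)"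
      using dv D dpos by (intro mult_left_mono power_mono) auto
    also have "\<dots> = d v ^ b" using b by (metis One_nat_def Suc_pred le_eq_less_or_eq less_le_trans power_Suc zero_less_one)
    also note c
    finally have "d v \<le> real b ^ b / D ^ (b - 1) * real (card (nb v) choose b)"
      using D by (simp add: field_simps)
    thus ?thesis using D by linarith
  qed
  have "(\<Sum>v<n. d v) \<le> (\<Sum>v<n. (D + real b) + real b ^ b / D ^ (b - 1) * real (card (nb v) choose b))"
    using bound by (intro sum_mono)
  also have "\<dots> = real n * (D + real b) + real b ^ b / D ^ (b - 1) * real (\<Sum>v<n. card (nb v) choose b)"
    by (simp add: sum.distrib sum_distrib_left)
  also have "\<dots> \<le> real n * (D + real b) + real b ^ b / D ^ (b - 1) * real (a * n ^ b)"
    using sum_choose_degrees_le[OF G free] D unfolding nb_def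
    by (intro add_left_mono mult_left_mono of_nat_mono) auto
  also have "\<dots> \<le> (1 + real b + real b ^ b * real a) * real n powr (2 - 1 / real b)"
  proof -
    have "real n * D = real n powr 1 * real n powr (1 - 1 / real b)" using n by (simp add: D_def)
    also have "\<dots> = real n powr (2 - 1 / real b)" by (subst powr_add[symmetric]) simp
    finally have t1: "real n * D = real n powr (2 - 1 / real b)" .
    have "1 \<le> D" unfolding D_def using n b by (intro ge_one_powr_ge_zero) auto
    hence "real n * real b * 1 \<le> real n * real b * D" by (intro mult_left_mono) auto
    hence t2: "real n * real b \<le> real b * real n powr (2 - 1 / real b)"
      unfolding t1[symmetric] by (simp add: mult_ac)
    have "D ^ (b - 1) = real n powr ((1 - 1 / real b) * (real b - 1))"
      using n b by (simp add: D_def powr_power of_nat_diff mult.commute)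
    hence "real n ^ b / D ^ (b - 1) = real n powr real b / real n powr ((1 - 1 / real b) * (real b - 1))"
      using n by (simp add: powr_realpow)
    also have "\<dots> = real n powr (real b - (1 - 1 / real b) * (real b - 1))" by (simp add: powr_diff)
    also have "real b - (1 - 1 / real b) * (real b - 1) = 2 - 1 / real b" using b by (simp add: field_simps)
    finally have t3: "real n ^ b / D ^ (b - 1) = real n powr (2 - 1 / real b)" .
    have "real b ^ b / D ^ (b - 1) * real (a * n ^ b) = real b ^ b * real a * (real n ^ b / D ^ (b - 1))"
      by simp
    also have "\<dots> = real b ^ b * real a * real n powr (2 - 1 / real b)" by (simp only: t3)
    finally have t4: "real b ^ b / D ^ (b - 1) * real (a * n ^ b) = real b ^ b * real a * real n powr (2 - 1 / real b)" .
    show ?thesis unfolding t4 distrib_left t1 using t2 by (simp add: algebra_simps)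
  qed
  finally show ?thesis using 1 by linarith
qed

text \<open>If no colour class contained a Berge copy, all classes together would have fewer than \<open>n choose r\<close>
edges.\<close>

lemma ramsey_propertyI_counting:
  fixes a b r k n N :: nat
  assumes ab: "a \<ge> 1" "b \<ge> 1" and r: "r \<ge> 2" and n: "n \<ge> r"
    and cl: "\<And>G. G \<subseteq> {e. e \<subseteq> {..<n} \<and> card e = 2} \<Longrightarrow> \<not> complete_bipartite_in a b G \<Longrightarrow>
       card (graph_cliques n r G) \<le> card G * N"
    and large: "real k * (1 + real N) * (1 + real b + real b ^ b * real a) * real n powr (2 - 1 / real b)
       < (real n / real r) ^ r"
  shows "ramsey_property a b r k n"
  unfolding ramsey_property_def
proof (rule ballI, rule ccontr)
  let ?K = "1 + real b + real b ^ b * real a"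
  let ?H = "{h. h \<subseteq> {..<n} \<and> card h = r}"
  have edges: "edges (complete_uniform r n) = ?H" by (simp add: complete_uniform_def)
  fix c assume c: "c \<in> edges (complete_uniform r n) \<rightarrow> {..<k}"
    and contra: "\<not> (\<exists>H. subhypergraph H (complete_uniform r n) \<and> monochromatic c H \<and>
            (\<exists>F \<in> Berge (complete_bipartite a b). isomorphic H F))"
  have cls: "real (card {h \<in> ?H. c h = i}) \<le> (1 + real N) * ?K * real n powr (2 - 1 / real b)" for i
  proof -
    let ?E = "{h \<in> ?H. c h = i}"
    have free: "\<not> Berge_embedding a b ?E f \<psi>" for f \<psi>
    proof
      assume emb: "Berge_embedding a b ?E f \<psi>"
      have fn: "f x \<in> {..<n}" if "x \<in> {..<a + b}" for x
      proof -
        have \<psi>: "\<psi> i j \<in> ?E \<and> f i \<in> \<psi> i j \<and> f j \<in> \<psi> i j" if "i < a" "j \<in> {a..<a + b}" for i j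
          using emb that unfolding Berge_embedding_def by blast
        show ?thesis
        proof (cases "x < a")
          case True
          thus ?thesis using \<psi>[of x a] ab by auto
        next
          case False
          thus ?thesis using \<psi>[of 0 x] ab that by auto
        qed
      qed
      have "\<exists>H. subhypergraph H (complete_uniform r n) \<and> monochromatic c H \<and>
            (\<exists>F \<in> Berge (complete_bipartite a b). isomorphic H F)"
      proof (rule embedding_imp_Berge_subhypergraph[OF emb])
        show "?E \<subseteq> edges (complete_uniform r n)" unfolding edges by blast
        show "f ` {..<a + b} \<subseteq> {..<n}" using fn by (rule image_subsetI)
        show "c e = i" if "e \<in> ?E" for e using that by simp
      qed
      thus False using contra by (rule notE[rotated])
    qed
    have "?E \<subseteq> ?H" by blast
    from Berge_free_card_le[OF this free] obtain G where G: "G \<subseteq> {e. e \<subseteq> {..<n} \<and> card e = 2}"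
      "\<not> complete_bipartite_in a b G" "card ?E \<le> card G + card (graph_cliques n r G)" by (elim exE conjE)
    have "card ?E \<le> card G * (1 + N)" using G(3) cl[OF G(1,2)] by simp
    hence "real (card ?E) \<le> real (card G * (1 + N))" by (rule of_nat_mono)
    also have "\<dots> = real (card G) * (1 + real N)" by (simp add: distrib_left)
    also have "\<dots> \<le> (?K * real n powr (2 - 1 / real b)) * (1 + real N)"
      using Kovari_Sos_Turan[OF G(1,2)] ab n r by (intro mult_right_mono) auto
    finally show ?thesis by (simp add: mult_ac)
  qed
  have "?H \<subseteq> (\<Union>i\<in>{..<k}. {h \<in> ?H. c h = i})"
  proof
    fix h assume h: "h \<in> ?H"
    hence "c h \<in> {..<k}" using c unfolding edges by (rule funcset_mem[rotated])
    thus "h \<in> (\<Union>i\<in>{..<k}. {h \<in> ?H. c h = i})" using h by blast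
  qed
  hence "card ?H \<le> card (\<Union>i\<in>{..<k}. {h \<in> ?H. c h = i})" by (intro card_mono) auto
  also have "\<dots> \<le> (\<Sum>i<k. card {h \<in> ?H. c h = i})" by (rule card_UN_le) simp
  finally have "real (card ?H) \<le> real (\<Sum>i<k. card {h \<in> ?H. c h = i})" by (rule of_nat_mono)
  also have "\<dots> = (\<Sum>i<k. real (card {h \<in> ?H. c h = i}))" by simp
  also have "\<dots> \<le> (\<Sum>i<k. (1 + real N) * ?K * real n powr (2 - 1 / real b))" by (intro sum_mono cls)
  also have "\<dots> = real k * (1 + real N) * ?K * real n powr (2 - 1 / real b)" by simp
  also note large
  also have "(real n / real r) ^ r \<le> real (n choose r)" by (rule binomial_ge_n_over_k_pow_k[OF n])
  also have "real (n choose r) = real (card ?H)" using n_subsets[of "{..<n}" r] by simp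
  finally show False by simp
qed

section \<open>Growth of the Ramsey number\<close>

text \<open>About \<open>n powr colour_exponent b r\<close> classes of size \<open>n powr (2 - 1 / b)\<close> exhaust the \<open>r\<close>-sets of \<open>n\<close> vertices.\<close>

definition colour_exponent :: "nat \<Rightarrow> nat \<Rightarrow> real" where
  "colour_exponent b r = real r - 2 + 1 / real b"

lemma colour_exponent_pos:
  assumes "b \<ge> 1" "r \<ge> 2"
  shows "colour_exponent b r > 0"
proof -
  have "1 / real b > 0" "real r \<ge> 2" using assms by simp_all
  thus ?thesis unfolding colour_exponent_def by linarith
qed

lemma inverse_colour_exponent:
  assumes "b \<ge> 1"
  shows "1 / colour_exponent b r = real b / ((real r - 2) * real b + 1)"
proof -
  have "colour_exponent b r = ((real r - 2) * real b + 1) / real b"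
    using assms by (simp add: colour_exponent_def add_divide_distrib)
  thus ?thesis by simp
qed

lemma ramsey_number_eq_Least:
  "ramsey_number r (Berge (complete_bipartite a b)) k = (LEAST n. ramsey_property a b r k n)"
  by (simp add: ramsey_number_def ramsey_property_def)

text \<open>The trivial bound \<open>n ^ (r - 2)\<close> for the cliques on an edge gives at most \<open>O(n powr (r - 1 / b))\<close>
edges without a Berge copy, which is still of smaller order than \<open>n ^ r\<close>.\<close>

lemma ramsey_property_exists:
  assumes a: "a \<ge> 1" and b: "b \<ge> 1" and r: "r \<ge> 2"
  shows "\<exists>n. ramsey_property a b r k n"
proof -
  define A where "A = real k * 2 * (1 + real b + real b ^ b * real a) * real r ^ r"
  have A: "A \<ge> 0" by (simp add: A_def)
  define n where "n = nat \<lceil>A powr real b\<rceil> + r + 1"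
  have n: "n \<ge> r" "n \<ge> 1" by (simp_all add: n_def)
  have "A powr real b < real n" unfolding n_def by linarith
  hence "(A powr real b) powr (1 / real b) < real n powr (1 / real b)"
    using b by (intro powr_less_mono2) auto
  hence A_less: "A < real n powr (1 / real b)" using A b by (simp add: powr_powr)
  have "ramsey_property a b r k n"
  proof (rule ramsey_propertyI_counting[where N = "n ^ (r - 2)"])
    fix G assume G: "G \<subseteq> {e. e \<subseteq> {..<n} \<and> card e = 2}"
    have "finite G" by (rule finite_subset[OF G]) simp
    thus "card (graph_cliques n r G) \<le> card G * n ^ (r - 2)"
    proof (rule card_graph_cliques_le[OF r])
      show "card {h \<in> graph_cliques n r G. e \<subseteq> h} \<le> n ^ (r - 2)" if "e \<in> G" for e
        using G that by (intro card_cliques_containing_edge_le) auto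
    qed
  next
    let ?K = "1 + real b + real b ^ b * real a"
    have one: "1 \<le> real n ^ (r - 2)" using n(2) by simp
    have "real k * (1 + real (n ^ (r - 2))) * ?K * real n powr (2 - 1 / real b)
        \<le> real k * (2 * real n ^ (r - 2)) * ?K * real n powr (2 - 1 / real b)"
      using one by (intro mult_right_mono mult_left_mono) auto
    also have "\<dots> = A * (real n ^ (r - 2) * real n powr (2 - 1 / real b)) / real r ^ r"
      using r by (simp add: A_def)
    also have "\<dots> < real n powr (1 / real b) * (real n ^ (r - 2) * real n powr (2 - 1 / real b)) / real r ^ r"
      using A_less n(2) r by (intro divide_strict_right_mono mult_strict_right_mono) auto
    also have "real n powr (1 / real b) * (real n ^ (r - 2) * real n powr (2 - 1 / real b)) = real n ^ r"
    proof -
      have "real n ^ (r - 2) = real n powr real (r - 2)" using n(2) by (simp add: powr_realpow)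
      hence "real n powr (1 / real b) * (real n ^ (r - 2) * real n powr (2 - 1 / real b))
          = real n powr (1 / real b + (real (r - 2) + (2 - 1 / real b)))"
        by (simp only: powr_add)
      also have "1 / real b + (real (r - 2) + (2 - 1 / real b)) = real r" using r by (simp add: of_nat_diff)
      finally show ?thesis using n(2) by (simp add: powr_realpow)
    qed
    finally show "real k * (1 + real (n ^ (r - 2))) * ?K * real n powr (2 - 1 / real b) < (real n / real r) ^ r"
      by (simp add: power_divide)
  qed (use a b r n in auto)
  thus ?thesis ..
qed

lemma ramsey_number_le:
  assumes a: "a \<ge> 1" and b: "b \<ge> 1" and r: "r \<ge> 2"
    and cl: "\<And>n G. G \<subseteq> {e. e \<subseteq> {..<n} \<and> card e = 2} \<Longrightarrow> \<not> complete_bipartite_in a b G \<Longrightarrow>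
       card (graph_cliques n r G) \<le> card G * N"
  shows "\<exists>C. \<forall>k\<ge>1. real (ramsey_number r (Berge (complete_bipartite a b)) k)
    \<le> C * real k powr (1 / colour_exponent b r)"
proof -
  define e where "e = colour_exponent b r"
  have e: "e > 0" unfolding e_def by (rule colour_exponent_pos[OF b r])
  define A where "A = (1 + real N) * (1 + real b + real b ^ b * real a) * real r ^ r"
  have A: "A > 0" using r by (simp add: A_def add_pos_nonneg)
  define C where "C = A powr (1 / e) + real r + 1"
  have "real (ramsey_number r (Berge (complete_bipartite a b)) k) \<le> C * real k powr (1 / e)" if k: "k \<ge> 1" for k
  proof -
    define n where "n = nat \<lfloor>(real k * A) powr (1 / e)\<rfloor> + r + 1"
    have n: "n \<ge> r" "n \<ge> 1" by (simp_all add: n_def)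
    have "(real k * A) powr (1 / e) < real n" unfolding n_def using r by linarith
    hence "((real k * A) powr (1 / e)) powr e < real n powr e" using e by (intro powr_less_mono2) auto
    hence kA: "real k * A < real n powr e" using e A k by (simp add: powr_powr)
    have "ramsey_property a b r k n"
    proof (rule ramsey_propertyI_counting[where N = N])
      let ?K = "1 + real b + real b ^ b * real a"
      have "real k * (1 + real N) * ?K * real n powr (2 - 1 / real b)
          = real k * A * real n powr (2 - 1 / real b) / real r ^ r"
        using r by (simp add: A_def)
      also have "\<dots> < real n powr e * real n powr (2 - 1 / real b) / real r ^ r"
        using kA n(2) r by (intro divide_strict_right_mono mult_strict_right_mono) auto
      also have "real n powr e * real n powr (2 - 1 / real b) = real n ^ r"
      proof -
        have "real n powr e * real n powr (2 - 1 / real b) = real n powr (e + (2 - 1 / real b))"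
          by (simp only: powr_add)
        also have "e + (2 - 1 / real b) = real r" by (simp add: e_def colour_exponent_def)
        finally show ?thesis using n(2) by (simp add: powr_realpow)
      qed
      finally show "real k * (1 + real N) * ?K * real n powr (2 - 1 / real b) < (real n / real r) ^ r"
        by (simp add: power_divide)
    qed (use a b r n cl in auto)
    hence "ramsey_number r (Berge (complete_bipartite a b)) k \<le> n"
      unfolding ramsey_number_eq_Least by (rule Least_le)
    hence "real (ramsey_number r (Berge (complete_bipartite a b)) k) \<le> real n" by simp
    also have "real n \<le> (real k * A) powr (1 / e) + (real r + 1)" unfolding n_def by simp
    also have "(real k * A) powr (1 / e) = A powr (1 / e) * real k powr (1 / e)"
      using A by (simp add: powr_mult)
    also have "real r + 1 \<le> (real r + 1) * real k powr (1 / e)"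
      using ge_one_powr_ge_zero[of "real k" "1 / e"] k e by (simp add: mult_le_cancel_left1)
    finally show ?thesis by (simp add: C_def algebra_simps)
  qed
  thus ?thesis unfolding e_def by blast
qed

lemma not_ramsey_property:
  assumes col: "\<And>h. h \<subseteq> {..<M} \<and> card h = r \<Longrightarrow> col h < k"
    and free: "\<And>E i f \<psi>. E \<subseteq> {h. h \<subseteq> {..<M} \<and> card h = r} \<Longrightarrow> \<forall>h\<in>E. col h = i \<Longrightarrow> \<not> Berge_embedding a b E f \<psi>"
    and n: "n \<le> M"
  shows "\<not> ramsey_property a b r k n"
proof
  assume P: "ramsey_property a b r k n"
  have sub: "edges (complete_uniform r n) \<subseteq> {h. h \<subseteq> {..<M} \<and> card h = r}"
    using n by (auto simp: complete_uniform_def)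
  have "col \<in> edges (complete_uniform r n) \<rightarrow> {..<k}"
  proof (rule funcsetI)
    fix h assume "h \<in> edges (complete_uniform r n)"
    hence "h \<subseteq> {..<M} \<and> card h = r" using sub by blast
    thus "col h \<in> {..<k}" using col by simp
  qed
  from bspec[OF P[unfolded ramsey_property_def] this]
  obtain H F where H: "subhypergraph H (complete_uniform r n)" "monochromatic col H"
    "F \<in> Berge (complete_bipartite a b)" "isomorphic H F" by (elim exE conjE bexE)
  have hg: "hypergraph H" and E: "edges H \<subseteq> edges (complete_uniform r n)"
    using H(1) by (simp_all add: subhypergraph_def)
  obtain f \<psi> where emb: "Berge_embedding a b (edges H) f \<psi>"
    by (rule Berge_isomorphic_imp_embedding[OF hg H(3,4)])
  obtain i where i: "\<forall>h\<in>edges H. col h = i" using H(2) unfolding monochromatic_def by (elim exE)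
  have "edges H \<subseteq> {h. h \<subseteq> {..<M} \<and> card h = r}" using E sub by (rule subset_trans)
  from free[OF this i] emb show False by (rule notE)
qed

text \<open>With \<open>2 ^ m\<close> close to \<open>(k / C) powr (1 / e)\<close>, the colouring of the \<open>r\<close>-sets of \<open>2 ^ m\<close> vertices uses at most
\<open>k\<close> colours, and its restrictions serve all smaller vertex sets.\<close>

lemma ramsey_number_ge:
  assumes b: "b \<ge> 2" and a: "a > fact (b - 1)" and r: "r \<ge> 2" "r < 2 * (a + b) - 1"
  shows "\<exists>c>0. \<exists>k0. \<forall>k\<ge>k0. c * real k powr (1 / colour_exponent b r)
    \<le> real (ramsey_number r (Berge (complete_bipartite a b)) k)"
proof -
  define e where "e = colour_exponent b r"
  have b1: "b \<ge> 1" using b by simp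
  have a1: "a \<ge> 1" using a by simp
  have e: "e > 0" unfolding e_def by (rule colour_exponent_pos[OF b1 r(1)])
  obtain C where C: "C > 0" and "\<forall>m. \<exists>col :: nat set \<Rightarrow> nat.
    (\<forall>h. h \<subseteq> {..<2 ^ m} \<and> card h = r \<longrightarrow> real (col h) < C * (2 ^ m) ^ (r - 2) * 2 powr (real m / real b)) \<and>
    (\<forall>E i f \<psi>. E \<subseteq> {h. h \<subseteq> {..<2 ^ m} \<and> card h = r} \<longrightarrow> (\<forall>h\<in>E. col h = i) \<longrightarrow> \<not> Berge_embedding a b E f \<psi>)"
    using colouring_without_Berge[OF b a r] by (elim exE conjE)
  from choice[OF this(2)] obtain col :: "nat \<Rightarrow> nat set \<Rightarrow> nat" where col: "\<forall>m.
    (\<forall>h. h \<subseteq> {..<2 ^ m} \<and> card h = r \<longrightarrow> real (col m h) < C * (2 ^ m) ^ (r - 2) * 2 powr (real m / real b)) \<and>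
    (\<forall>E i f \<psi>. E \<subseteq> {h. h \<subseteq> {..<2 ^ m} \<and> card h = r} \<longrightarrow> (\<forall>h\<in>E. col m h = i) \<longrightarrow> \<not> Berge_embedding a b E f \<psi>)"
    by (rule exE)
  have palette: "C * (2 ^ m) ^ (r - 2) * 2 powr (real m / real b) = C * (2 ^ m) powr e" for m
  proof -
    have "(2 ^ m :: real) ^ (r - 2) = 2 powr (real m * real (r - 2))"
      by (simp add: powr_realpow[symmetric] powr_powr power_mult[symmetric])
    hence "(2 ^ m :: real) ^ (r - 2) * 2 powr (real m / real b) = 2 powr (real m * real (r - 2) + real m / real b)"
      by (simp only: powr_add)
    also have "real m * real (r - 2) + real m / real b = real m * e"
      using r(1) by (simp add: e_def colour_exponent_def of_nat_diff algebra_simps)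
    also have "2 powr (real m * e) = (2 ^ m) powr e" by (simp add: powr_realpow[symmetric] powr_powr)
    finally show ?thesis by (simp add: mult.assoc)
  qed
  define c where "c = (1 / C) powr (1 / e) / 2"
  have "c > 0" using C by (simp add: c_def)
  moreover have "c * real k powr (1 / e) \<le> real (ramsey_number r (Berge (complete_bipartite a b)) k)"
    if k: "k \<ge> nat \<lceil>C\<rceil> + 1" for k
  proof -
    have kC: "real k / C \<ge> 1" using k C by (simp add: le_divide_eq) linarith
    define y where "y = (real k / C) powr (1 / e)"
    have y: "y \<ge> 1" unfolding y_def using kC e by (intro ge_one_powr_ge_zero) auto
    define m where "m = nat \<lfloor>log 2 y\<rfloor>"
    have log0: "0 \<le> log 2 y" using y by simp
    have "real m \<le> log 2 y" using log0 by (simp add: m_def)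
    hence "2 powr real m \<le> 2 powr (log 2 y)" by simp
    hence m1: "2 ^ m \<le> y" using y by (simp add: powr_realpow)
    have "log 2 y < real (Suc m)" unfolding m_def using log0 by linarith
    hence "2 powr (log 2 y) < 2 powr real (Suc m)" by (rule powr_less_mono) simp
    hence m2: "y < 2 * 2 ^ m" using y by (simp only: powr_realpow) (simp add: powr_realpow)
    have "(2 ^ m) powr e \<le> y powr e" using m1 e by (intro powr_mono2) auto
    also have "\<dots> = real k / C" using e kC C by (simp add: y_def powr_powr)
    finally have size: "C * (2 ^ m) powr e \<le> real k" using C by (simp add: field_simps)
    have notP: "\<not> ramsey_property a b r k n" if "n \<le> 2 ^ m" for n
    proof (rule not_ramsey_property[OF _ _ that])
      fix h :: "nat set" assume "h \<subseteq> {..<2 ^ m} \<and> card h = r"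
      hence "real (col m h) < C * (2 ^ m) ^ (r - 2) * 2 powr (real m / real b)" using col by blast
      thus "col m h < k" using size unfolding palette by simp
    next
      fix E :: "nat set set" and i f \<psi>
      assume "E \<subseteq> {h. h \<subseteq> {..<2 ^ m} \<and> card h = r}" "\<forall>h\<in>E. col m h = i"
      thus "\<not> Berge_embedding a b E f \<psi>" using spec[OF col, of m, THEN conjunct2] by blast
    qed
    obtain n0 where "ramsey_property a b r k n0" using ramsey_property_exists[OF a1 b1 r(1)] by (rule exE)
    hence "ramsey_property a b r k (ramsey_number r (Berge (complete_bipartite a b)) k)"
      unfolding ramsey_number_eq_Least by (rule LeastI)
    hence "2 ^ m < ramsey_number r (Berge (complete_bipartite a b)) k" using notP by (meson not_le)
    hence "real (2 ^ m) \<le> real (ramsey_number r (Berge (complete_bipartite a b)) k)"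
      by (intro of_nat_mono less_imp_le)
    hence "(2 :: real) ^ m \<le> real (ramsey_number r (Berge (complete_bipartite a b)) k)" by simp
    moreover have "c * real k powr (1 / e) = y / 2"
      using C by (simp add: c_def y_def powr_divide)
    ultimately show ?thesis using m2 by linarith
  qed
  ultimately show ?thesis unfolding e_def by (intro exI[of _ c] conjI exI[of _ "nat \<lceil>C\<rceil> + 1"] allI impI)
qed

theorem theorem1p3:
  fixes a b r :: nat
  assumes "b \<ge> 2" and "a > fact (b - 1)" and "r \<ge> 2" and "r < 2 * (a + b) - 1"
  shows "(\<lambda>k. real (ramsey_number r (Berge (complete_bipartite a b)) k))
           \<in> \<Omega>(\<lambda>k. real k powr (real b / ((real r - 2) * real b + 1)))
    \<and> (b = 2 \<or> a + b \<le> r \<longrightarrow>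
         (\<lambda>k. real (ramsey_number r (Berge (complete_bipartite a b)) k))
           \<in> \<Theta>(\<lambda>k. real k powr (real b / ((real r - 2) * real b + 1))))"
proof -
  define R where "R = (\<lambda>k. real (ramsey_number r (Berge (complete_bipartite a b)) k))"
  define g where "g = (\<lambda>k. real k powr (real b / ((real r - 2) * real b + 1)))"
  have "fact (b - 1) \<ge> (1 :: nat)" by (rule fact_ge_1)
  hence ab: "a \<ge> 1" "b \<ge> 1" using assms by linarith+
  have g: "real k powr (1 / colour_exponent b r) = g k" for k
    unfolding g_def inverse_colour_exponent[OF ab(2)] ..
  have lower: "R \<in> \<Omega>(g)"
  proof -
    obtain c k0 where c: "c > 0" "\<forall>k\<ge>k0. c * g k \<le> R k"
      using ramsey_number_ge[OF assms] unfolding g R_def by (elim exE conjE)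
    have "eventually (\<lambda>k. c * norm (g k) \<le> norm (R k)) sequentially"
      unfolding eventually_sequentially
    proof (intro exI[of _ k0] allI impI)
      fix k assume "k0 \<le> k"
      hence "c * g k \<le> R k" using c(2) by blast
      thus "c * norm (g k) \<le> norm (R k)" by (simp add: g_def R_def)
    qed
    thus ?thesis by (rule landau_omega.bigI[OF c(1)])
  qed
  have upper: "R \<in> O(g)" if N: "\<And>n G. G \<subseteq> {e. e \<subseteq> {..<n} \<and> card e = 2} \<Longrightarrow>
      \<not> complete_bipartite_in a b G \<Longrightarrow> card (graph_cliques n r G) \<le> card G * N" for N
  proof -
    have "\<exists>C. \<forall>k\<ge>1. real (ramsey_number r (Berge (complete_bipartite a b)) k)
        \<le> C * real k powr (1 / colour_exponent b r)"
      by (rule ramsey_number_le[OF ab assms(3)], rule N)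
    then obtain C where C: "\<forall>k\<ge>1. R k \<le> C * g k"
      unfolding g R_def by (elim exE)
    have "eventually (\<lambda>k. norm (R k) \<le> C * norm (g k)) sequentially"
      unfolding eventually_sequentially
    proof (intro exI[of _ 1] allI impI)
      fix k :: nat assume "1 \<le> k"
      hence "R k \<le> C * g k" using C by blast
      thus "norm (R k) \<le> C * norm (g k)" by (simp add: g_def R_def)
    qed
    thus ?thesis by (rule bigoI)
  qed
  have "R \<in> \<Theta>(g)" if "b = 2 \<or> a + b \<le> r"
  proof (rule bigthetaI[OF _ lower])
    show "R \<in> O(g)"
      using that
    proof
      assume b2: "b = 2"
      show ?thesis
      proof (rule upper[of "2 ^ a"], rule card_graph_cliques_le[OF assms(3)])
        fix n and G :: "nat set set"
        assume G: "G \<subseteq> {e. e \<subseteq> {..<n} \<and> card e = 2}" and free: "\<not> complete_bipartite_in a b G"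
        show "finite G" by (rule finite_subset[OF G]) simp
        show "card {h \<in> graph_cliques n r G. e \<subseteq> h} \<le> 2 ^ a" if "e \<in> G" for e
          using card_cliques_containing_edge_le_power[OF G _ that] free b2 by blast
      qed
    next
      assume "a + b \<le> r"
      thus ?thesis using graph_cliques_empty by (intro upper[of 0]) simp
    qed
  qed
  thus ?thesis using lower unfolding R_def g_def by blast
qed

end
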